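(* Let $P\in M_n(\Bbbk[[\hbar]])$ be a matrix of Cartan type, $\mathcal R=(\mathfrak h,\Pi,\Pi^\vee)$ any realization of $P$, and $U=U^{\mathcal R}_{P,\hbar}(\mathfrak g)$ the associated formal multiparameter quantum universal enveloping algebra (FoMpQUEA). Then $U$ bears a structure of topological Hopf algebra over $\Bbbk[[\hbar]]$, with coproduct taking values in the $\hbar$-adically completed tensor product $U\,\widehat\otimes_{\Bbbk[[\hbar]]}\,U$, given on generators (for all $T\in\mathfrak h$, $\ell\in I$) by $$\Delta(E_\ell)=E_\ell\otimes 1+e^{\hbar T_\ell^+}\otimes E_\ell,\quad \Delta(T)=T\otimes 1+1\otimes T,\quad \Delta(F_\ell)=F_\ell\otimes e^{-\hbar T_\ell^-}+1\otimes F_\ell,$$ $$\epsilon(E_\ell)=0,\quad \epsilon(T)=0,\quad \epsilon(F_\ell)=0,$$ $$\mathcal S(E_\ell)=-e^{-\hbar T_\ell^+}E_\ell,\quad \mathcal S(T)=-T,\quad \mathcal S(F_\ell)=-F_\ell\, e^{+\hbar T_\ell^-}.$$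
   Context: $\Bbbk$ is a field of characteristic zero, $n\ge1$, $I=\{1,\dots,n\}$. $A=(a_{ij})_{i,j\in I}$ is a symmetrizable generalized Cartan matrix and $D=\mathrm{diag}(d_1,\dots,d_n)$ the unique diagonal matrix with coprime positive integer entries such that $DA$ is symmetric. $P=(p_{ij})\in M_n(\Bbbk[[\hbar]])$ is of Cartan type with Cartan matrix $A$ if $P+P^T=2DA$ (so $p_{ii}=2d_i$). A realization of $P$ (over $\Bbbk[[\hbar]]$) is a triple $\mathcal R=(\mathfrak h,\Pi,\Pi^\vee)$ with $\mathfrak h$ a free $\Bbbk[[\hbar]]$-module of finite rank, $\Pi^\vee=\{T_i^+,T_i^-\}_{i\in I}\subseteq\mathfrak h$, $\Pi=\{\alpha_i\}_{i\in I}\subseteq\mathfrak h^*=\mathrm{Hom}_{\Bbbk[[\hbar]]}(\mathfrak h,\Bbbk[[\hbar]])$, such that $\alpha_j(T_i^+)=p_{ij}$, $\alpha_j(T_i^-)=p_{ji}$ for all $i,j$, and the classes of $S_i:=\frac12(T_i^++T_i^-)$ ($i\in I$) in $\mathfrak h/\hbar\mathfrak h$ are $\Bbbk$-linearly independent. Set $q_i=e^{\hbar d_i}$, $q_{ij}^{\pm1/2}=e^{\pm\hbar p_{ij}/2}$; $\left[{m\atop k}\right]_q$ are the Gaussian binomials built from $[r]_q=(q^r-q^{-r})/(q-q^{-1})$. The FoMpQUEA $U^{\mathcal R}_{P,\hbar}(\mathfrak g)$ is the unital, associative, topological, $\hbar$-adically complete $\Bbbk[[\hbar]]$-algebra generated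 by the $\Bbbk[[\hbar]]$-module $\mathfrak h$ (its linear structure being preserved) and elements $E_i,F_i$ ($i\in I$), with relations, for $T,T',T''\in\mathfrak h$, $i,j\in I$: $TE_j-E_jT=\alpha_j(T)E_j$; $TF_j-F_jT=-\alpha_j(T)F_j$; $T'T''=T''T'$; $E_iF_j-F_jE_i=\delta_{ij}\dfrac{e^{\hbar T_i^+}-e^{-\hbar T_i^-}}{q_i-q_i^{-1}}$; and for $i\ne j$: $\sum_{k=0}^{1-a_{ij}}(-1)^k\left[{1-a_{ij}\atop k}\right]_{q_i}q_{ij}^{k/2}q_{ji}^{-k/2}E_i^{1-a_{ij}-k}E_jE_i^k=0$, $\ \sum_{k=0}^{1-a_{ij}}(-1)^k\left[{1-a_{ij}\atop k}\right]_{q_i}q_{ij}^{k/2}q_{ji}^{-k/2}F_i^kF_jF_i^{1-a_{ij}-k}=0$. The fraction means $\frac{\hbar}{q_i-q_i^{-1}}\cdot\hbar^{-1}(e^{\hbar T_i^+}-e^{-\hbar T_i^-})$, where $\frac{\hbar}{q_i-q_i^{-1}}\in\Bbbk[[\hbar]]$ and $\hbar^{-1}(\cdots)$ is the obvious power series. *)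

theory Defs
  imports
    "HOL-Computational_Algebra.Formal_Power_Series"
    "HOL-Analysis.Finite_Cartesian_Product"
    "HOL-Algebra.Module"
    "HOL-Algebra.QuotRing"
begin

section \<open>Modules and algebras over the ring of formal power series\<close>

text \<open>The variable \<open>\<hbar>\<close> is \<^const>\<open>fps_X\<close>. All modules and algebras are
  \<^typ>\<open>('k fps, 'a) module\<close> records over \<open>kh\<close>; for a mere module the fields \<open>mult\<close> and \<open>one\<close>
  are irrelevant. Every module carries its \<open>\<hbar>\<close>-adic topology, for which linear maps
  are automatically continuous.\<close>

definition kh :: "('k::field fps, 'k fps) module" where
  "kh = \<lparr>carrier = UNIV, mult = (*), one = 1, zero = 0, add = (+), smult = (*)\<rparr>"

locale kh_algebra = Module.module kh A + ring A
  for A :: "('k::field fps, 'a) module" (structure) +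
  assumes smult_mult_left:
      "x \<in> carrier A \<Longrightarrow> y \<in> carrier A \<Longrightarrow> (c \<odot>\<^bsub>A\<^esub> x) \<otimes>\<^bsub>A\<^esub> y = c \<odot>\<^bsub>A\<^esub> (x \<otimes>\<^bsub>A\<^esub> y)"
    and smult_mult_right:
      "x \<in> carrier A \<Longrightarrow> y \<in> carrier A \<Longrightarrow> x \<otimes>\<^bsub>A\<^esub> (c \<odot>\<^bsub>A\<^esub> y) = c \<odot>\<^bsub>A\<^esub> (x \<otimes>\<^bsub>A\<^esub> y)"

definition linear_maps ::
  "('k::field fps, 'a) module \<Rightarrow> ('k fps, 'b) module \<Rightarrow> ('a \<Rightarrow> 'b) set" where
  "linear_maps M N = {f \<in> carrier M \<rightarrow> carrier N.
     (\<forall>x\<in>carrier M. \<forall>y\<in>carrier M. f (x \<oplus>\<^bsub>M\<^esub> y) = f x \<oplus>\<^bsub>N\<^esub> f y) \<and>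
     (\<forall>c. \<forall>x\<in>carrier M. f (c \<odot>\<^bsub>M\<^esub> x) = c \<odot>\<^bsub>N\<^esub> f x)}"

definition alg_homs ::
  "('k::field fps, 'a) module \<Rightarrow> ('k fps, 'b) module \<Rightarrow> ('a \<Rightarrow> 'b) set" where
  "alg_homs A B = linear_maps A B \<inter> ring_hom A B"

definition free_finite_rank :: "('k::field fps, 'a) module \<Rightarrow> bool" where
  "free_finite_rank M \<longleftrightarrow> Module.module kh M \<and>
     (\<exists>B. finite B \<and> B \<subseteq> carrier M \<and>
        (\<forall>x\<in>carrier M. \<exists>!c. c \<in> extensional B \<and> x = (\<Oplus>\<^bsub>M\<^esub>b\<in>B. c b \<odot>\<^bsub>M\<^esub> b)))"

definition submodule_span :: "('k::field fps, 'a) module \<Rightarrow> 'a set \<Rightarrow> 'a set" where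
  "submodule_span M S = \<Inter>{N. submodule N kh M \<and> S \<subseteq> N}"

definition quot_alg ::
  "('k::field fps, 'a) module \<Rightarrow> 'a set \<Rightarrow> ('k fps, 'a set) module" where
  "quot_alg A I =
     \<lparr>carrier = carrier (A Quot I), mult = mult (A Quot I), one = one (A Quot I),
      zero = zero (A Quot I), add = add (A Quot I),
      smult = (\<lambda>c C. \<Union>x\<in>C. I +>\<^bsub>A\<^esub> (c \<odot>\<^bsub>A\<^esub> x))\<rparr>"

section \<open>The \<open>\<hbar>\<close>-adic topology\<close>

definition hpow :: "('k::field fps, 'a) module \<Rightarrow> nat \<Rightarrow> 'a set" where
  "hpow A m = (\<lambda>x. fps_X ^ m \<odot>\<^bsub>A\<^esub> x) ` carrier A"

text \<open>The inverse limit of the quotients of \<open>A\<close> by \<open>\<hbar>\<^sup>m A\<close>. The transition map from level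
  \<open>Suc m\<close> to level \<open>m\<close> sends a coset to the unique coset containing it, hence the compatibility
  condition is an inclusion.\<close>

definition completion ::
  "('k::field fps, 'a) module \<Rightarrow> ('k fps, nat \<Rightarrow> 'a set) module" where
  "completion A =
     \<lparr>carrier = {s. (\<forall>m. s m \<in> carrier (quot_alg A (hpow A m))) \<and> (\<forall>m. s (Suc m) \<subseteq> s m)},
      mult = (\<lambda>s t m. s m \<otimes>\<^bsub>quot_alg A (hpow A m)\<^esub> t m),
      one = (\<lambda>m. \<one>\<^bsub>quot_alg A (hpow A m)\<^esub>),
      zero = (\<lambda>m. \<zero>\<^bsub>quot_alg A (hpow A m)\<^esub>),
      add = (\<lambda>s t m. s m \<oplus>\<^bsub>quot_alg A (hpow A m)\<^esub> t m),
      smult = (\<lambda>c s m. c \<odot>\<^bsub>quot_alg A (hpow A m)\<^esub> s m)\<rparr>"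

definition to_completion ::
  "('k::field fps, 'a) module \<Rightarrow> 'a \<Rightarrow> nat \<Rightarrow> 'a set" where
  "to_completion A x = (\<lambda>m. hpow A m +>\<^bsub>A\<^esub> x)"

text \<open>Complete includes separated.\<close>

definition hadic_complete :: "('k::field fps, 'a) module \<Rightarrow> bool" where
  "hadic_complete A \<longleftrightarrow> bij_betw (to_completion A) (carrier A) (carrier (completion A))"

definition hsum :: "('k::field fps, 'a) module \<Rightarrow> (nat \<Rightarrow> 'a) \<Rightarrow> 'a" where
  "hsum A u = (THE s. s \<in> carrier A \<and>
     (\<forall>N. \<exists>M. \<forall>m\<ge>M. s \<ominus>\<^bsub>A\<^esub> (\<Oplus>\<^bsub>A\<^esub>k\<in>{..<m}. u k) \<in> hpow A N))"

text \<open>\<open>hexp A x\<close> is \<open>exp (\<hbar> x)\<close>.\<close>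

definition hexp :: "('k::field_char_0 fps, 'a) module \<Rightarrow> 'a \<Rightarrow> 'a" where
  "hexp A x = hsum A (\<lambda>k. (fps_const (1 / fact k) * fps_X ^ k) \<odot>\<^bsub>A\<^esub> (x [^]\<^bsub>A\<^esub> k))"

text \<open>\<open>hexp_diff_quot A x y\<close> is the power series \<open>\<hbar>\<^sup>-\<^sup>1 (exp (\<hbar> x) - exp (- \<hbar> y))\<close>, whose
  constant terms cancel; it is expanded termwise because \<open>A\<close> may have \<open>\<hbar>\<close>-torsion.\<close>

definition hexp_diff_quot :: "('k::field_char_0 fps, 'a) module \<Rightarrow> 'a \<Rightarrow> 'a \<Rightarrow> 'a" where
  "hexp_diff_quot A x y = hsum A (\<lambda>k. (fps_const (1 / fact (Suc k)) * fps_X ^ k) \<odot>\<^bsub>A\<^esub>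
     (x [^]\<^bsub>A\<^esub> Suc k \<ominus>\<^bsub>A\<^esub> (\<ominus>\<^bsub>A\<^esub> y) [^]\<^bsub>A\<^esub> Suc k))"

definition hclosed :: "('k::field fps, 'a) module \<Rightarrow> 'a set \<Rightarrow> bool" where
  "hclosed A I \<longleftrightarrow> (\<forall>x\<in>carrier A. (\<forall>m. \<exists>y\<in>I. x \<ominus>\<^bsub>A\<^esub> y \<in> hpow A m) \<longrightarrow> x \<in> I)"

definition closed_ideal_gen :: "('k::field fps, 'a) module \<Rightarrow> 'a set \<Rightarrow> 'a set" where
  "closed_ideal_gen A S = \<Inter>{I. ideal I A \<and> hclosed A I \<and> S \<subseteq> I}"

section \<open>Monoid algebras, free algebras and tensor products\<close>

definition monoid_alg ::
  "('x, 'm) monoid_scheme \<Rightarrow> ('k::field fps, 'x \<Rightarrow> 'k fps) module" where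
  "monoid_alg G =
     \<lparr>carrier = {f. finite {x. f x \<noteq> 0} \<and> {x. f x \<noteq> 0} \<subseteq> carrier G},
      mult = (\<lambda>f g z. \<Sum>(x, y)\<in>{(x, y). f x \<noteq> 0 \<and> g y \<noteq> 0 \<and> x \<otimes>\<^bsub>G\<^esub> y = z}. f x * g y),
      one = (\<lambda>x. if x = \<one>\<^bsub>G\<^esub> then 1 else 0),
      zero = (\<lambda>x. 0),
      add = (\<lambda>f g x. f x + g x),
      smult = (\<lambda>c f x. c * f x)\<rparr>"

definition single :: "'x \<Rightarrow> 'x \<Rightarrow> 'k::field fps" where
  "single x = (\<lambda>y. if y = x then 1 else 0)"

definition free_monoid :: "'x set \<Rightarrow> 'x list monoid" where
  "free_monoid X = \<lparr>carrier = lists X, mult = (@), one = []\<rparr>"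

text \<open>The free module on \<open>A \<times> B\<close> modulo the bilinearity relations; the convolution product of
  the monoid algebra induces \<open>(a \<otimes> b) (a' \<otimes> b') = a a' \<otimes> b b'\<close>.\<close>

definition bilinear_relators ::
  "('k::field fps, 'a) module \<Rightarrow> ('k fps, 'b) module \<Rightarrow> ('a \<times> 'b \<Rightarrow> 'k fps) set" where
  "bilinear_relators A B =
     {\<lambda>z. single (a \<oplus>\<^bsub>A\<^esub> a', b) z - single (a, b) z - single (a', b) z | a a' b.
        a \<in> carrier A \<and> a' \<in> carrier A \<and> b \<in> carrier B} \<union>
     {\<lambda>z. single (a, b \<oplus>\<^bsub>B\<^esub> b') z - single (a, b) z - single (a, b') z | a b b'.
        a \<in> carrier A \<and> b \<in> carrier B \<and> b' \<in> carrier B} \<union>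
     {\<lambda>z. single (c \<odot>\<^bsub>A\<^esub> a, b) z - c * single (a, b) z | c a b.
        a \<in> carrier A \<and> b \<in> carrier B} \<union>
     {\<lambda>z. single (a, c \<odot>\<^bsub>B\<^esub> b) z - c * single (a, b) z | c a b.
        a \<in> carrier A \<and> b \<in> carrier B}"

definition tensor ::
  "('k::field fps, 'a) module \<Rightarrow> ('k fps, 'b) module \<Rightarrow> ('k fps, ('a \<times> 'b \<Rightarrow> 'k fps) set) module"
  where "tensor A B = quot_alg (monoid_alg (A \<times>\<times> B))
     (submodule_span (monoid_alg (A \<times>\<times> B)) (bilinear_relators A B))"

definition tensor_elem ::
  "('k::field fps, 'a) module \<Rightarrow> ('k fps, 'b) module \<Rightarrow> 'a \<Rightarrow> 'b \<Rightarrow> ('a \<times> 'b \<Rightarrow> 'k fps) set" where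
  "tensor_elem A B a b =
     submodule_span (monoid_alg (A \<times>\<times> B)) (bilinear_relators A B)
       +>\<^bsub>monoid_alg (A \<times>\<times> B)\<^esub> single (a, b)"

type_synonym ('k, 'a, 'b) ctens = "nat \<Rightarrow> ('a \<times> 'b \<Rightarrow> 'k fps) set set"

definition ctensor ::
  "('k::field fps, 'a) module \<Rightarrow> ('k fps, 'b) module \<Rightarrow> ('k fps, ('k, 'a, 'b) ctens) module" where
  "ctensor A B = completion (tensor A B)"

definition ctensor_elem ::
  "('k::field fps, 'a) module \<Rightarrow> ('k fps, 'b) module \<Rightarrow> 'a \<Rightarrow> 'b \<Rightarrow> ('k, 'a, 'b) ctens" where
  "ctensor_elem A B a b = to_completion (tensor A B) (tensor_elem A B a b)"

text \<open>For a bilinear \<open>\<beta>\<close> with values in an \<open>\<hbar>\<close>-adically complete module \<open>C\<close>, this is the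
  unique linear map on the completed tensor product sending \<open>a \<otimes> b\<close> to \<open>\<beta> a b\<close>.\<close>

definition ctensor_lift ::
  "('k::field fps, 'a) module \<Rightarrow> ('k fps, 'b) module \<Rightarrow> ('k fps, 'c) module
     \<Rightarrow> ('a \<Rightarrow> 'b \<Rightarrow> 'c) \<Rightarrow> ('k, 'a, 'b) ctens \<Rightarrow> 'c" where
  "ctensor_lift A B C \<beta> =
     (THE \<phi>. \<phi> \<in> linear_maps (ctensor A B) C \<and> \<phi> \<in> extensional (carrier (ctensor A B)) \<and>
        (\<forall>a\<in>carrier A. \<forall>b\<in>carrier B. \<phi> (ctensor_elem A B a b) = \<beta> a b))"

definition ctensor_map ::
  "('k::field fps, 'a) module \<Rightarrow> ('k fps, 'b) module
     \<Rightarrow> ('k fps, 'c) module \<Rightarrow> ('k fps, 'd) module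
     \<Rightarrow> ('a \<Rightarrow> 'c) \<Rightarrow> ('b \<Rightarrow> 'd) \<Rightarrow> ('k, 'a, 'b) ctens \<Rightarrow> ('k, 'c, 'd) ctens" where
  "ctensor_map A B C D f g =
     ctensor_lift A B (ctensor C D) (\<lambda>a b. ctensor_elem C D (f a) (g b))"

definition ctensor_assoc ::
  "('k::field fps, 'a) module \<Rightarrow> ('k fps, 'b) module \<Rightarrow> ('k fps, 'c) module
     \<Rightarrow> ('k, ('k, 'a, 'b) ctens, 'c) ctens \<Rightarrow> ('k, 'a, ('k, 'b, 'c) ctens) ctens" where
  "ctensor_assoc A B C =
     ctensor_lift (ctensor A B) C (ctensor A (ctensor B C))
       (\<lambda>t c. ctensor_lift A B (ctensor A (ctensor B C))
          (\<lambda>a b. ctensor_elem A (ctensor B C) a (ctensor_elem B C b c)) t)"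

section \<open>Topological Hopf algebras\<close>

text \<open>Topological freeness of \<open>A\<close> is not part of the definition. The factor
  \<open>\<kk>[[\<hbar>]]\<close> in the counit axioms is absorbed by the identification
  \<open>\<kk>[[\<hbar>]] \<otimes> A = A\<close>.\<close>

locale topological_hopf_algebra = kh_algebra A
  for A :: "('k::field fps, 'a) module" (structure) +
  fixes \<Delta> :: "'a \<Rightarrow> ('k, 'a, 'a) ctens"
    and \<epsilon> :: "'a \<Rightarrow> 'k fps"
    and S :: "'a \<Rightarrow> 'a"
  assumes complete: "hadic_complete A"
    and comult_hom: "\<Delta> \<in> alg_homs A (ctensor A A)"
    and counit_hom: "\<epsilon> \<in> alg_homs A kh"
    and antipode_linear: "S \<in> linear_maps A A"
    and coassoc: "x \<in> carrier A \<Longrightarrow>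
        ctensor_assoc A A A (ctensor_map A A (ctensor A A) A \<Delta> (\<lambda>a. a) (\<Delta> x)) =
        ctensor_map A A A (ctensor A A) (\<lambda>a. a) \<Delta> (\<Delta> x)"
    and counit_left: "x \<in> carrier A \<Longrightarrow> ctensor_lift A A A (\<lambda>a b. \<epsilon> a \<odot>\<^bsub>A\<^esub> b) (\<Delta> x) = x"
    and counit_right: "x \<in> carrier A \<Longrightarrow> ctensor_lift A A A (\<lambda>a b. \<epsilon> b \<odot>\<^bsub>A\<^esub> a) (\<Delta> x) = x"
    and antipode_left: "x \<in> carrier A \<Longrightarrow>
        ctensor_lift A A A (\<lambda>a b. S a \<otimes>\<^bsub>A\<^esub> b) (\<Delta> x) = \<epsilon> x \<odot>\<^bsub>A\<^esub> \<one>\<^bsub>A\<^esub>"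
    and antipode_right: "x \<in> carrier A \<Longrightarrow>
        ctensor_lift A A A (\<lambda>a b. a \<otimes>\<^bsub>A\<^esub> S b) (\<Delta> x) = \<epsilon> x \<odot>\<^bsub>A\<^esub> \<one>\<^bsub>A\<^esub>"

section \<open>Multiparameter matrices and realizations\<close>

definition generalized_cartan_matrix :: "int ^ 'n ^ 'n \<Rightarrow> bool" where
  "generalized_cartan_matrix A \<longleftrightarrow>
     (\<forall>i. A $ i $ i = 2) \<and> (\<forall>i j. i \<noteq> j \<longrightarrow> A $ i $ j \<le> 0) \<and>
     (\<forall>i j. A $ i $ j = 0 \<longleftrightarrow> A $ j $ i = 0)"

definition diag_matrix :: "('n \<Rightarrow> nat) \<Rightarrow> int ^ 'n ^ 'n" where
  "diag_matrix d = (\<chi> i j. if i = j then int (d i) else 0)"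

definition symmetrizer :: "('n::finite \<Rightarrow> nat) \<Rightarrow> int ^ 'n ^ 'n \<Rightarrow> bool" where
  "symmetrizer d A \<longleftrightarrow> (\<forall>i. d i > 0) \<and> Gcd (range d) = 1 \<and>
     transpose (diag_matrix d ** A) = diag_matrix d ** A"

definition cartan_type ::
  "('k::field_char_0 fps) ^ 'n ^ 'n \<Rightarrow> ('n::finite \<Rightarrow> nat) \<Rightarrow> int ^ 'n ^ 'n \<Rightarrow> bool" where
  "cartan_type P d A \<longleftrightarrow>
     P + transpose P = (\<chi> i j. of_int (2 * (diag_matrix d ** A) $ i $ j))"

record ('k, 'n, 'h) triple =
  cartan :: "('k fps, 'h) module"
  root :: "'n \<Rightarrow> 'h \<Rightarrow> 'k fps"
  Tplus :: "'n \<Rightarrow> 'h"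
  Tminus :: "'n \<Rightarrow> 'h"

text \<open>The last clause is the linear independence over the residue field of the classes of
  \<open>S\<^sub>i = (T\<^sub>i\<^sup>+ + T\<^sub>i\<^sup>-) / 2\<close> modulo \<open>\<hbar>\<close>.\<close>

definition realization ::
  "('k::field_char_0 fps) ^ 'n ^ 'n \<Rightarrow> ('k, 'n::finite, 'h) triple \<Rightarrow> bool" where
  "realization P R \<longleftrightarrow>
     free_finite_rank (cartan R) \<and>
     (\<forall>i. Tplus R i \<in> carrier (cartan R) \<and> Tminus R i \<in> carrier (cartan R)) \<and>
     (\<forall>j. root R j \<in> linear_maps (cartan R) kh) \<and>
     (\<forall>i j. root R j (Tplus R i) = P $ i $ j \<and> root R j (Tminus R i) = P $ j $ i) \<and>
     (\<forall>c :: 'n \<Rightarrow> 'k.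
        (\<Oplus>\<^bsub>cartan R\<^esub>i\<in>UNIV. fps_const (c i) \<odot>\<^bsub>cartan R\<^esub>
           (fps_const (1 / 2) \<odot>\<^bsub>cartan R\<^esub> (Tplus R i \<oplus>\<^bsub>cartan R\<^esub> Tminus R i)))
          \<in> hpow (cartan R) 1 \<longrightarrow> (\<forall>i. c i = 0))"

section \<open>Quantum numbers\<close>

text \<open>\<open>exph a\<close> is \<open>exp (\<hbar> a)\<close>. All divisions below are exact in the power series ring:
  for \<open>q = exph (of_nat d)\<close> with \<open>d > 0\<close>, both \<open>\<hbar>\<close> and \<open>q\<^sup>r - q\<^sup>-\<^sup>r\<close> are multiples of
  \<open>q - q\<^sup>-\<^sup>1\<close>, and \<^const>\<open>divide\<close> on power series is exact division in that case.\<close>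

definition exph :: "'k::field_char_0 fps \<Rightarrow> 'k fps" where
  "exph a = fps_exp 1 oo (fps_X * a)"

definition qnum :: "'k::field_char_0 fps \<Rightarrow> nat \<Rightarrow> 'k fps" where
  "qnum q r = (q ^ r - inverse q ^ r) / (q - inverse q)"

definition qfact :: "'k::field_char_0 fps \<Rightarrow> nat \<Rightarrow> 'k fps" where
  "qfact q m = (\<Prod>r=1..m. qnum q r)"

definition qbinom :: "'k::field_char_0 fps \<Rightarrow> nat \<Rightarrow> nat \<Rightarrow> 'k fps" where
  "qbinom q m k = qfact q m / (qfact q k * qfact q (m - k))"

section \<open>The formal multiparameter quantum universal enveloping algebra\<close>

datatype ('n, 'h) generator = GenT 'h | GenE 'n | GenF 'n

definition serre_coeff ::
  "int ^ 'n ^ 'n \<Rightarrow> ('n \<Rightarrow> nat) \<Rightarrow> ('k::field_char_0 fps) ^ 'n ^ 'n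
     \<Rightarrow> 'n::finite \<Rightarrow> 'n \<Rightarrow> nat \<Rightarrow> 'k fps" where
  "serre_coeff A d P i j k =
     (- 1) ^ k * qbinom (exph (of_nat (d i))) (nat (1 - A $ i $ j)) k *
     exph (fps_const (1 / 2) * P $ i $ j) ^ k * exph (- (fps_const (1 / 2) * P $ j $ i)) ^ k"

text \<open>The differences of the two sides of the defining relations, evaluated in an algebra \<open>B\<close>
  at the images \<open>g\<close> of the generators. The first set expresses that the linear structure of
  \<open>\<hh>\<close> is preserved.\<close>

definition relators ::
  "int ^ 'n ^ 'n \<Rightarrow> ('n \<Rightarrow> nat) \<Rightarrow> ('k::field_char_0 fps) ^ 'n ^ 'n \<Rightarrow> ('k, 'n::finite, 'h) triple
     \<Rightarrow> ('k fps, 'b) module \<Rightarrow> (('n, 'h) generator \<Rightarrow> 'b) \<Rightarrow> 'b set" where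
  "relators A d P R B g =
    (let H = carrier (cartan R); T = (\<lambda>x. g (GenT x)); E = (\<lambda>i. g (GenE i)); F = (\<lambda>i. g (GenF i))
     in
       {T (a \<odot>\<^bsub>cartan R\<^esub> x \<oplus>\<^bsub>cartan R\<^esub> b \<odot>\<^bsub>cartan R\<^esub> y) \<ominus>\<^bsub>B\<^esub> (a \<odot>\<^bsub>B\<^esub> T x \<oplus>\<^bsub>B\<^esub> b \<odot>\<^bsub>B\<^esub> T y)
          | a b x y. x \<in> H \<and> y \<in> H} \<union>
       {(T x \<otimes>\<^bsub>B\<^esub> E j \<ominus>\<^bsub>B\<^esub> E j \<otimes>\<^bsub>B\<^esub> T x) \<ominus>\<^bsub>B\<^esub> root R j x \<odot>\<^bsub>B\<^esub> E j | x j. x \<in> H} \<union>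
       {(T x \<otimes>\<^bsub>B\<^esub> F j \<ominus>\<^bsub>B\<^esub> F j \<otimes>\<^bsub>B\<^esub> T x) \<ominus>\<^bsub>B\<^esub> (- root R j x) \<odot>\<^bsub>B\<^esub> F j | x j. x \<in> H} \<union>
       {T x \<otimes>\<^bsub>B\<^esub> T y \<ominus>\<^bsub>B\<^esub> T y \<otimes>\<^bsub>B\<^esub> T x | x y. x \<in> H \<and> y \<in> H} \<union>
       {(E i \<otimes>\<^bsub>B\<^esub> F j \<ominus>\<^bsub>B\<^esub> F j \<otimes>\<^bsub>B\<^esub> E i) \<ominus>\<^bsub>B\<^esub>
          (if i = j
           then (fps_X / (exph (of_nat (d i)) - inverse (exph (of_nat (d i))))) \<odot>\<^bsub>B\<^esub>
                  hexp_diff_quot B (T (Tplus R i)) (T (Tminus R i))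
           else \<zero>\<^bsub>B\<^esub>) | i j. True} \<union>
       {\<Oplus>\<^bsub>B\<^esub>k\<in>{..nat (1 - A $ i $ j)}. serre_coeff A d P i j k \<odot>\<^bsub>B\<^esub>
          (E i [^]\<^bsub>B\<^esub> (nat (1 - A $ i $ j) - k) \<otimes>\<^bsub>B\<^esub> E j \<otimes>\<^bsub>B\<^esub> E i [^]\<^bsub>B\<^esub> k) | i j. i \<noteq> j} \<union>
       {\<Oplus>\<^bsub>B\<^esub>k\<in>{..nat (1 - A $ i $ j)}. serre_coeff A d P i j k \<odot>\<^bsub>B\<^esub>
          (F i [^]\<^bsub>B\<^esub> k \<otimes>\<^bsub>B\<^esub> F j \<otimes>\<^bsub>B\<^esub> F i [^]\<^bsub>B\<^esub> (nat (1 - A $ i $ j) - k)) | i j. i \<noteq> j})"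

definition free_alg ::
  "('k, 'n, 'h) triple \<Rightarrow> ('k::field fps, ('n, 'h) generator list \<Rightarrow> 'k fps) module" where
  "free_alg R =
     monoid_alg (free_monoid (GenT ` carrier (cartan R) \<union> range GenE \<union> range GenF))"

definition free_gen ::
  "('k, 'n, 'h) triple \<Rightarrow> ('n, 'h) generator
     \<Rightarrow> nat \<Rightarrow> (('n, 'h) generator list \<Rightarrow> 'k::field fps) set" where
  "free_gen R x = to_completion (free_alg R) (single [x])"

type_synonym ('k, 'n, 'h) fompquea_elem =
  "(nat \<Rightarrow> (('n, 'h) generator list \<Rightarrow> 'k fps) set) set"

text \<open>The complete topological algebra given by the presentation: the \<open>\<hbar>\<close>-adic completion of
  the free algebra modulo the closed two-sided ideal generated by the relators. The closure
  makes the quotient \<open>\<hbar>\<close>-adically separated.\<close>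

definition fompquea_ideal ::
  "int ^ 'n ^ 'n \<Rightarrow> ('n \<Rightarrow> nat) \<Rightarrow> ('k::field_char_0 fps) ^ 'n ^ 'n \<Rightarrow> ('k, 'n::finite, 'h) triple
     \<Rightarrow> ('k, 'n, 'h) fompquea_elem" where
  "fompquea_ideal A d P R = closed_ideal_gen (completion (free_alg R))
     (relators A d P R (completion (free_alg R)) (free_gen R))"

definition fompquea ::
  "int ^ 'n ^ 'n \<Rightarrow> ('n \<Rightarrow> nat) \<Rightarrow> ('k::field_char_0 fps) ^ 'n ^ 'n \<Rightarrow> ('k, 'n::finite, 'h) triple
     \<Rightarrow> ('k fps, ('k, 'n, 'h) fompquea_elem) module" where
  "fompquea A d P R = quot_alg (completion (free_alg R)) (fompquea_ideal A d P R)"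

definition fompquea_gen ::
  "int ^ 'n ^ 'n \<Rightarrow> ('n \<Rightarrow> nat) \<Rightarrow> ('k::field_char_0 fps) ^ 'n ^ 'n \<Rightarrow> ('k, 'n::finite, 'h) triple
     \<Rightarrow> ('n, 'h) generator \<Rightarrow> ('k, 'n, 'h) fompquea_elem" where
  "fompquea_gen A d P R x =
     fompquea_ideal A d P R +>\<^bsub>completion (free_alg R)\<^esub> free_gen R x"

end

theory Submission
  imports Defs
begin

text \<open>\<open>U\<close> is initial among complete algebras with a family \<open>(T, E, F)\<close> satisfying the relations, so
  \<open>\<Delta>\<close>, \<open>\<epsilon>\<close> and \<open>S\<close> exist as soon as the prescribed images of the generators satisfy the relations
  in \<open>U \<otimes> U\<close>, \<open>\<kk>[[\<hbar>]]\<close> and the opposite algebra of \<open>U\<close>. Among these relations only the quantum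
  Serre relations are hard. The Gaussian binomial theorem factors a Serre sum into a product of
  q-commutators \<open>z \<mapsto> x z - c z x\<close>, and each factor annihilates the cross terms coming
  from \<open>\<Delta> E = E \<otimes> 1 + K \<otimes> E\<close>; the factors must be read in one order for \<open>E\<^sub>j \<otimes> 1\<close> and in the
  reverse order for \<open>K\<^sub>j \<otimes> E\<^sub>j\<close>. The Hopf axioms then need to be checked on generators only, by
  density of the subalgebra that they generate.\<close>

section \<open>Algebras over the ring of formal power series\<close>

text \<open>The algebra is only known to be \<hbar>-adically complete; \<hbar>-torsion is not
  excluded, so no identity may be obtained by cancelling \<hbar>. Exponentials are therefore
  compared through the series (exp (\<hbar> x) - 1) / \<hbar>, on coefficients or by coinduction on
  power series. The two orders of the q-commutator factors come from one scalar. Put \<theta> = exp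
  (\<hbar> (p_ij - p_ji) / 2) and m = 1 - a_ij. Since p_ij + p_ji = 2 d_i a_ij, one has \<theta> =
  exp (\<hbar> p_ij) q_i^(m-1) = exp (- \<hbar> p_ji) q_i^(1-m). The first form yields factors exp
  (\<hbar> p_ij) q_i^(2s), beginning with the scalar for moving K_i past E_j; the second yields exp
  (- \<hbar> p_ji) q_i^(-2s), beginning with the scalar for moving E_i past K_j. For the antipode,
  reversing products replaces \<theta> by its inverse, and moving the group-like factors to the left
  undoes this.\<close>

lemma kh_sel [simp]:
  "carrier kh = UNIV" "mult kh = (*)" "one kh = 1" "zero kh = 0" "add kh = (+)" "smult kh = (*)"
  by (simp_all add: kh_def)

lemma cring_kh: "cring (kh :: ('k::field fps, 'k fps) module)"
proof (rule cringI)
  show "abelian_group (kh :: ('k fps, 'k fps) module)"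
    by (rule abelian_groupI) (auto simp: algebra_simps intro: exI[of _ "- x" for x])
  show "comm_monoid (kh :: ('k fps, 'k fps) module)"
    by (rule comm_monoidI) (auto simp: algebra_simps)
qed (auto simp: algebra_simps)

lemma a_inv_kh [simp]: "\<ominus>\<^bsub>kh\<^esub> x = - (x :: 'k::field fps)"
proof -
  interpret cring "kh :: ('k fps, 'k fps) module" by (rule cring_kh)
  show ?thesis using minus_equality[of "- x" x] by simp
qed

lemma a_minus_kh [simp]: "x \<ominus>\<^bsub>kh\<^esub> y = x - (y :: 'k::field fps)"
  by (simp add: a_minus_def)

lemma nat_pow_kh [simp]: "x [^]\<^bsub>kh\<^esub> (n::nat) = (x :: 'k::field fps) ^ n"
  by (induction n) (simp_all add: nat_pow_def mult.commute)

lemma finsum_kh [simp]: "finsum kh f S = (\<Sum>i\<in>S. f i :: 'k::field fps)"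
proof -
  interpret cring "kh :: ('k fps, 'k fps) module" by (rule cring_kh)
  show ?thesis
  proof (cases "finite S")
    case True then show ?thesis by (induction S) auto
  qed simp
qed

text \<open>Additive inverses need not be supplied: \<open>(-1) \<odot> x\<close> is one, because
  \<open>0 \<odot> x\<close> is required to be zero. Quotients and completions can thus be treated
  without describing negation in them.\<close>

lemma kh_algebraI:
  fixes A :: "('k::field fps, 'a) module" (structure)
  assumes "\<And>x y. x \<in> carrier A \<Longrightarrow> y \<in> carrier A \<Longrightarrow> x \<oplus> y \<in> carrier A"
    and "\<zero> \<in> carrier A"
    and "\<And>x y z. x \<in> carrier A \<Longrightarrow> y \<in> carrier A \<Longrightarrow> z \<in> carrier A \<Longrightarrow> (x \<oplus> y) \<oplus> z = x \<oplus> (y \<oplus> z)"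
    and "\<And>x y. x \<in> carrier A \<Longrightarrow> y \<in> carrier A \<Longrightarrow> x \<oplus> y = y \<oplus> x"
    and "\<And>x. x \<in> carrier A \<Longrightarrow> \<zero> \<oplus> x = x"
    and "\<And>x y. x \<in> carrier A \<Longrightarrow> y \<in> carrier A \<Longrightarrow> x \<otimes> y \<in> carrier A"
    and "\<one> \<in> carrier A"
    and "\<And>x y z. x \<in> carrier A \<Longrightarrow> y \<in> carrier A \<Longrightarrow> z \<in> carrier A \<Longrightarrow> (x \<otimes> y) \<otimes> z = x \<otimes> (y \<otimes> z)"
    and "\<And>x. x \<in> carrier A \<Longrightarrow> \<one> \<otimes> x = x"
    and "\<And>x. x \<in> carrier A \<Longrightarrow> x \<otimes> \<one> = x"
    and "\<And>x y z. x \<in> carrier A \<Longrightarrow> y \<in> carrier A \<Longrightarrow> z \<in> carrier A \<Longrightarrow> (x \<oplus> y) \<otimes> z = x \<otimes> z \<oplus> y \<otimes> z"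
    and "\<And>x y z. x \<in> carrier A \<Longrightarrow> y \<in> carrier A \<Longrightarrow> z \<in> carrier A \<Longrightarrow> z \<otimes> (x \<oplus> y) = z \<otimes> x \<oplus> z \<otimes> y"
    and "\<And>c x. x \<in> carrier A \<Longrightarrow> c \<odot> x \<in> carrier A"
    and "\<And>c d x. x \<in> carrier A \<Longrightarrow> (c + d) \<odot> x = c \<odot> x \<oplus> d \<odot> x"
    and "\<And>c x y. x \<in> carrier A \<Longrightarrow> y \<in> carrier A \<Longrightarrow> c \<odot> (x \<oplus> y) = c \<odot> x \<oplus> c \<odot> y"
    and "\<And>c d x. x \<in> carrier A \<Longrightarrow> (c * d) \<odot> x = c \<odot> (d \<odot> x)"
    and "\<And>x. x \<in> carrier A \<Longrightarrow> 1 \<odot> x = x"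
    and "\<And>x. x \<in> carrier A \<Longrightarrow> 0 \<odot> x = \<zero>"
    and "\<And>c x y. x \<in> carrier A \<Longrightarrow> y \<in> carrier A \<Longrightarrow> (c \<odot> x) \<otimes> y = c \<odot> (x \<otimes> y)"
    and "\<And>c x y. x \<in> carrier A \<Longrightarrow> y \<in> carrier A \<Longrightarrow> x \<otimes> (c \<odot> y) = c \<odot> (x \<otimes> y)"
  shows "kh_algebra A"
proof -
  have neg: "\<exists>y\<in>carrier A. y \<oplus> x = \<zero>" if x: "x \<in> carrier A" for x
    using assms(14)[of x "-1" 1] assms(13)[of x "-1"] assms(17,18)[of x] x
    by (intro bexI[of _ "(-1) \<odot> x"]) simp_all
  have ab: "abelian_group A"
    by (rule abelian_groupI) (use assms neg in auto)
  have "ring A"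
    by (rule ringI[OF ab]) (use assms in \<open>auto intro!: monoidI\<close>)
  moreover have "Module.module kh A"
    by (rule moduleI[OF cring_kh ab]) (use assms in auto)
  ultimately show ?thesis
    using assms by (auto intro!: kh_algebra.intro kh_algebra_axioms.intro)
qed

context kh_algebra
begin

lemma smult_closed' [simp]: "x \<in> carrier A \<Longrightarrow> c \<odot> x \<in> carrier A"
  by (rule smult_closed) auto

lemma smult_l: "x \<in> carrier A \<Longrightarrow> (c + d) \<odot> x = c \<odot> x \<oplus> d \<odot> x"
  using smult_l_distr[of c d x] by simp

lemma smult_r: "x \<in> carrier A \<Longrightarrow> y \<in> carrier A \<Longrightarrow> c \<odot> (x \<oplus> y) = c \<odot> x \<oplus> c \<odot> y"
  using smult_r_distr[of c x y] by simp

lemma smult_smult: "x \<in> carrier A \<Longrightarrow> c \<odot> (d \<odot> x) = (c * d) \<odot> x"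
  using smult_assoc1[of c d x] by simp

lemma smult_1 [simp]: "x \<in> carrier A \<Longrightarrow> 1 \<odot> x = x"
  using smult_one[of x] by simp

lemma smult_0l [simp]: "x \<in> carrier A \<Longrightarrow> 0 \<odot> x = \<zero>"
  using smult_l_null[of x] by simp

lemma smult_0r [simp]: "c \<odot> \<zero> = \<zero>"
  using smult_r_null[of c] by simp

lemma smult_neg_l: "x \<in> carrier A \<Longrightarrow> (- c) \<odot> x = \<ominus> (c \<odot> x)"
  using smult_l_minus[of c x] by simp

lemma smult_neg_r: "x \<in> carrier A \<Longrightarrow> c \<odot> (\<ominus> x) = \<ominus> (c \<odot> x)"
  using smult_r_minus[of c x] by simp

lemma smult_diff_r: "x \<in> carrier A \<Longrightarrow> y \<in> carrier A \<Longrightarrow> c \<odot> (x \<ominus> y) = c \<odot> x \<ominus> c \<odot> y"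
  by (simp add: minus_eq smult_r smult_neg_r)

lemma smult_finsum: "f \<in> S \<rightarrow> carrier A \<Longrightarrow> c \<odot> finsum A f S = (\<Oplus>i\<in>S. c \<odot> f i)"
  by (cases "finite S") (simp_all add: finsum_smult_ldistr)

lemmas alg_simps = ring_simprules smult_mult_left smult_mult_right smult_r smult_l smult_smult
  smult_neg_l smult_neg_r

lemma minus_eq_zero_iff [simp]:
  assumes xy: "x \<in> carrier A" "y \<in> carrier A"
  shows "x \<ominus> y = \<zero> \<longleftrightarrow> x = y"
proof
  have "x = (x \<ominus> y) \<oplus> y" using xy by (simp add: ring_simprules)
  moreover assume "x \<ominus> y = \<zero>"
  ultimately show "x = y" using xy by simp
qed (use xy in \<open>simp add: minus_eq r_neg\<close>)

lemma minus_self [simp]: "x \<in> carrier A \<Longrightarrow> x \<ominus> x = \<zero>"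
  by simp

end

lemma kh_algebra_kh: "kh_algebra kh"
  by (rule kh_algebraI) (auto simp: algebra_simps)

subsection \<open>Linear maps\<close>

lemma linear_mapsI:
  assumes "\<And>x. x \<in> carrier M \<Longrightarrow> f x \<in> carrier N"
    and "\<And>x y. x \<in> carrier M \<Longrightarrow> y \<in> carrier M \<Longrightarrow> f (x \<oplus>\<^bsub>M\<^esub> y) = f x \<oplus>\<^bsub>N\<^esub> f y"
    and "\<And>c x. x \<in> carrier M \<Longrightarrow> f (c \<odot>\<^bsub>M\<^esub> x) = c \<odot>\<^bsub>N\<^esub> f x"
  shows "f \<in> linear_maps M N"
  using assms by (auto simp: linear_maps_def)

lemma linear_maps_closed: "f \<in> linear_maps M N \<Longrightarrow> x \<in> carrier M \<Longrightarrow> f x \<in> carrier N"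
  and linear_maps_add: "f \<in> linear_maps M N \<Longrightarrow> x \<in> carrier M \<Longrightarrow> y \<in> carrier M \<Longrightarrow>
    f (x \<oplus>\<^bsub>M\<^esub> y) = f x \<oplus>\<^bsub>N\<^esub> f y"
  and linear_maps_smult: "f \<in> linear_maps M N \<Longrightarrow> x \<in> carrier M \<Longrightarrow> f (c \<odot>\<^bsub>M\<^esub> x) = c \<odot>\<^bsub>N\<^esub> f x"
  by (auto simp: linear_maps_def)

lemmas linear_maps_simps = linear_maps_closed linear_maps_add linear_maps_smult

lemma linear_maps_id: "(\<lambda>x. x) \<in> linear_maps M M"
  by (simp add: linear_maps_def)

lemma linear_maps_comp:
  "f \<in> linear_maps M N \<Longrightarrow> g \<in> linear_maps N L \<Longrightarrow> (\<lambda>x. g (f x)) \<in> linear_maps M L"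
  by (auto simp: linear_maps_def Pi_def)

lemma linear_maps_cong:
  assumes "kh_algebra M" "f \<in> linear_maps M N" "\<And>x. x \<in> carrier M \<Longrightarrow> f x = g x"
  shows "g \<in> linear_maps M N"
proof -
  interpret kh_algebra M by fact
  show ?thesis using assms(2,3) by (intro linear_mapsI) (metis linear_maps_simps a_closed smult_closed')+
qed

locale linear_map = A: kh_algebra A + B: kh_algebra B
  for A :: "('k::field fps, 'a) module" and B :: "('k fps, 'b) module" and f +
  assumes linear: "f \<in> linear_maps A B"
begin

lemma closed [simp]: "x \<in> carrier A \<Longrightarrow> f x \<in> carrier B"
  using linear by (rule linear_maps_closed)

lemma add [simp]: "x \<in> carrier A \<Longrightarrow> y \<in> carrier A \<Longrightarrow> f (x \<oplus>\<^bsub>A\<^esub> y) = f x \<oplus>\<^bsub>B\<^esub> f y"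
  using linear by (rule linear_maps_add)

lemma smult [simp]: "x \<in> carrier A \<Longrightarrow> f (c \<odot>\<^bsub>A\<^esub> x) = c \<odot>\<^bsub>B\<^esub> f x"
  using linear by (rule linear_maps_smult)

lemma zero [simp]: "f \<zero>\<^bsub>A\<^esub> = \<zero>\<^bsub>B\<^esub>"
  using smult[of "\<zero>\<^bsub>A\<^esub>" 0] by simp

lemma neg [simp]: "x \<in> carrier A \<Longrightarrow> f (\<ominus>\<^bsub>A\<^esub> x) = \<ominus>\<^bsub>B\<^esub> f x"
  using smult[of x "-1"] by (simp add: A.smult_neg_l B.smult_neg_l)

lemma diff [simp]: "x \<in> carrier A \<Longrightarrow> y \<in> carrier A \<Longrightarrow> f (x \<ominus>\<^bsub>A\<^esub> y) = f x \<ominus>\<^bsub>B\<^esub> f y"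
  by (simp add: A.minus_eq B.minus_eq)

lemma finsum: "u \<in> S \<rightarrow> carrier A \<Longrightarrow> f (finsum A u S) = finsum B (\<lambda>i. f (u i)) S"
proof (induction S rule: infinite_finite_induct)
  case (insert x F)
  then have "u \<in> F \<rightarrow> carrier A" "u x \<in> carrier A" "(\<lambda>i. f (u i)) \<in> F \<rightarrow> carrier B" by (auto simp: Pi_def)
  with insert show ?case by simp
qed simp_all

lemma hpow: "x \<in> hpow A m \<Longrightarrow> f x \<in> hpow B m"
  by (auto simp: hpow_def)

end

lemma alg_homsI:
  assumes "f \<in> linear_maps A B"
    and "\<And>x y. x \<in> carrier A \<Longrightarrow> y \<in> carrier A \<Longrightarrow> f (x \<otimes>\<^bsub>A\<^esub> y) = f x \<otimes>\<^bsub>B\<^esub> f y"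
    and "f \<one>\<^bsub>A\<^esub> = \<one>\<^bsub>B\<^esub>"
  shows "f \<in> alg_homs A B"
  using assms by (auto simp: alg_homs_def linear_maps_def ring_hom_def)

lemma alg_homs_linear: "f \<in> alg_homs A B \<Longrightarrow> f \<in> linear_maps A B"
  and alg_homs_mult: "f \<in> alg_homs A B \<Longrightarrow> x \<in> carrier A \<Longrightarrow> y \<in> carrier A \<Longrightarrow>
    f (x \<otimes>\<^bsub>A\<^esub> y) = f x \<otimes>\<^bsub>B\<^esub> f y"
  and alg_homs_one: "f \<in> alg_homs A B \<Longrightarrow> f \<one>\<^bsub>A\<^esub> = \<one>\<^bsub>B\<^esub>"
  by (auto simp: alg_homs_def ring_hom_def)

lemma alg_homs_id: "(\<lambda>x. x) \<in> alg_homs A A"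
  by (simp add: alg_homs_def linear_maps_def ring_hom_def)

lemma alg_homs_comp:
  "f \<in> alg_homs A B \<Longrightarrow> g \<in> alg_homs B C \<Longrightarrow> (\<lambda>x. g (f x)) \<in> alg_homs A C"
  by (auto simp: alg_homs_def linear_maps_def ring_hom_def Pi_def)

locale alg_hom = A: kh_algebra A + B: kh_algebra B
  for A :: "('k::field fps, 'a) module" and B :: "('k fps, 'b) module" and f +
  assumes hom: "f \<in> alg_homs A B"
begin

sublocale linear_map A B f
  by unfold_locales (rule alg_homs_linear[OF hom])

lemma mult [simp]: "x \<in> carrier A \<Longrightarrow> y \<in> carrier A \<Longrightarrow> f (x \<otimes>\<^bsub>A\<^esub> y) = f x \<otimes>\<^bsub>B\<^esub> f y"
  using hom by (rule alg_homs_mult)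

lemma one [simp]: "f \<one>\<^bsub>A\<^esub> = \<one>\<^bsub>B\<^esub>"
  using hom by (rule alg_homs_one)

lemma pow [simp]: "x \<in> carrier A \<Longrightarrow> f (x [^]\<^bsub>A\<^esub> (n::nat)) = f x [^]\<^bsub>B\<^esub> n"
  by (induction n) auto

end

lemma linear_mapI: "kh_algebra A \<Longrightarrow> kh_algebra B \<Longrightarrow> f \<in> linear_maps A B \<Longrightarrow> linear_map A B f"
  by (simp add: linear_map.intro linear_map_axioms.intro)

lemma alg_homI: "kh_algebra A \<Longrightarrow> kh_algebra B \<Longrightarrow> f \<in> alg_homs A B \<Longrightarrow> alg_hom A B f"
  by (simp add: alg_hom.intro alg_hom_axioms.intro)

text \<open>Every algebra law is an equation, so it passes through a surjection that respects the
  operations. Only \<open>A\<close> is assumed to be an algebra; \<open>B\<close> is a bare record,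
  as for \<open>quot_alg\<close> and \<open>completion\<close>.\<close>

lemma surj_kh_algebra:
  assumes "kh_algebra A" and surj: "f ` carrier A = carrier B"
    and add: "\<And>x y. x \<in> carrier A \<Longrightarrow> y \<in> carrier A \<Longrightarrow> f x \<oplus>\<^bsub>B\<^esub> f y = f (x \<oplus>\<^bsub>A\<^esub> y)"
    and mult: "\<And>x y. x \<in> carrier A \<Longrightarrow> y \<in> carrier A \<Longrightarrow> f x \<otimes>\<^bsub>B\<^esub> f y = f (x \<otimes>\<^bsub>A\<^esub> y)"
    and smult: "\<And>c x. x \<in> carrier A \<Longrightarrow> c \<odot>\<^bsub>B\<^esub> f x = f (c \<odot>\<^bsub>A\<^esub> x)"
    and one: "\<one>\<^bsub>B\<^esub> = f \<one>\<^bsub>A\<^esub>" and zero: "\<zero>\<^bsub>B\<^esub> = f \<zero>\<^bsub>A\<^esub>"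
  shows "kh_algebra B" "f \<in> alg_homs A B"
proof -
  interpret kh_algebra A by fact
  show "kh_algebra B"
    by (rule kh_algebraI; (unfold surj[symmetric])?; (elim imageE)?; hypsubst?)
      (auto simp: add mult smult one zero alg_simps)
  show "f \<in> alg_homs A B"
    using surj by (auto intro!: alg_homsI linear_mapsI simp: add mult smult one)
qed

subsection \<open>The adic filtration\<close>

context kh_algebra
begin

lemma hpow_iff: "x \<in> hpow A m \<longleftrightarrow> (\<exists>y\<in>carrier A. x = fps_X ^ m \<odot> y)"
  by (auto simp: hpow_def)

lemma hpowI: "y \<in> carrier A \<Longrightarrow> fps_X ^ m \<odot> y \<in> hpow A m"
  by (auto simp: hpow_iff)

lemma hpow_carrier: "x \<in> hpow A m \<Longrightarrow> x \<in> carrier A"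
  by (auto simp: hpow_iff)

lemma hpow_0 [simp]: "hpow A 0 = carrier A"
  by (auto simp: hpow_iff)

lemma hpow_zero [simp]: "\<zero> \<in> hpow A m"
  using hpowI[of \<zero> m] by simp

lemma hpow_add: "x \<in> hpow A m \<Longrightarrow> y \<in> hpow A m \<Longrightarrow> x \<oplus> y \<in> hpow A m"
  by (auto simp: hpow_iff smult_r[symmetric])

lemma hpow_neg: "x \<in> hpow A m \<Longrightarrow> \<ominus> x \<in> hpow A m"
  by (auto simp: hpow_iff smult_neg_r[symmetric])

lemma hpow_diff: "x \<in> hpow A m \<Longrightarrow> y \<in> hpow A m \<Longrightarrow> x \<ominus> y \<in> hpow A m"
  by (simp add: minus_eq hpow_add hpow_neg)

lemma hpow_smult: "x \<in> hpow A m \<Longrightarrow> c \<odot> x \<in> hpow A m"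
proof -
  assume "x \<in> hpow A m"
  then obtain y where y: "y \<in> carrier A" "x = fps_X ^ m \<odot> y" by (auto simp: hpow_iff)
  then have "c \<odot> x = fps_X ^ m \<odot> (c \<odot> y)" by (simp add: smult_smult mult.commute)
  with y show ?thesis by (auto intro: hpowI)
qed

lemma hpow_mult_r: "x \<in> hpow A m \<Longrightarrow> y \<in> carrier A \<Longrightarrow> x \<otimes> y \<in> hpow A m"
  by (auto simp: hpow_iff smult_mult_left)

lemma hpow_mult_l: "x \<in> hpow A m \<Longrightarrow> y \<in> carrier A \<Longrightarrow> y \<otimes> x \<in> hpow A m"
  by (auto simp: hpow_iff smult_mult_right)

lemma hpow_smult_X: "x \<in> hpow A m \<Longrightarrow> fps_X ^ n \<odot> x \<in> hpow A (n + m)"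
  by (auto simp: hpow_iff smult_smult power_add)

lemma hpow_mono: assumes "x \<in> hpow A m" "n \<le> m" shows "x \<in> hpow A n"
proof -
  obtain y where "y \<in> carrier A" "x = fps_X ^ (n + (m - n)) \<odot> y"
    using assms by (auto simp: hpow_iff)
  then show ?thesis
    by (auto simp: hpow_iff power_add smult_smult[symmetric])
qed

lemma hpow_diff_trans:
  assumes "x \<ominus> y \<in> hpow A m" "y \<ominus> z \<in> hpow A m" "x \<in> carrier A" "y \<in> carrier A" "z \<in> carrier A"
  shows "x \<ominus> z \<in> hpow A m"
proof -
  have "x \<ominus> z = (x \<ominus> y) \<oplus> (y \<ominus> z)" using assms(3-5) by (simp add: alg_simps)
  then show ?thesis using hpow_add[OF assms(1,2)] by simp
qed

lemma hpow_diff_sym: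
  assumes "x \<ominus> y \<in> hpow A m" "x \<in> carrier A" "y \<in> carrier A"
  shows "y \<ominus> x \<in> hpow A m"
proof -
  have "y \<ominus> x = \<ominus> (x \<ominus> y)" using assms(2-3) by (simp add: alg_simps)
  then show ?thesis using hpow_neg[OF assms(1)] by simp
qed

lemma hpow_ideal: "ideal (hpow A m) A"
proof (rule idealI)
  show "subgroup (hpow A m) (add_monoid A)"
    by (rule add.subgroupI) (auto simp: hpow_carrier hpow_neg hpow_add simp flip: a_inv_def intro: hpow_zero)
qed (auto simp: ring_axioms hpow_mult_l hpow_mult_r)

lemma cauchy_diff:
  assumes "\<And>k. x k \<in> carrier A" "\<And>k. x (Suc k) \<ominus> x k \<in> hpow A k"
  shows "x (m + n) \<ominus> x m \<in> hpow A m"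
proof (induction n)
  case 0 show ?case using assms(1) by simp
next
  case (Suc n)
  show ?case
    by (rule hpow_diff_trans[OF _ Suc]) (use assms hpow_mono[of _ "m+n" m] in auto)
qed

lemma cauchy_diff_le:
  assumes "\<And>k. x k \<in> carrier A" "\<And>k. x (Suc k) \<ominus> x k \<in> hpow A k" "m \<le> n"
  shows "x n \<ominus> x m \<in> hpow A m"
  using cauchy_diff[OF assms(1,2), of m "n - m"] assms(3) by simp

end

subsection \<open>Quotients\<close>

text \<open>Scalars act through the unit, c x = (c 1) x, so a ring ideal is automatically a
  submodule.\<close>

lemma (in kh_algebra) ideal_smult:
  assumes "ideal I A" "x \<in> I" shows "c \<odot> x \<in> I"
proof -
  interpret ideal I A by fact
  have "c \<odot> x = (c \<odot> \<one>) \<otimes> x" using Icarr[OF assms(2)] by (simp add: smult_mult_left)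
  then show ?thesis using I_l_closed[OF assms(2)] by simp
qed

lemma (in kh_algebra) rcos_eq_iff:
  "ideal I A \<Longrightarrow> x \<in> carrier A \<Longrightarrow> y \<in> carrier A \<Longrightarrow> I +> x = I +> y \<longleftrightarrow> x \<ominus> y \<in> I"
  by (rule quotient_eq_iff_same_a_r_cos[symmetric])

lemma (in kh_algebra) mem_rcos_iff:
  assumes "ideal I A" "x \<in> carrier A" "y \<in> carrier A" shows "y \<in> I +> x \<longleftrightarrow> y \<ominus> x \<in> I"
proof -
  interpret ideal I A by fact
  show ?thesis using a_rcos_module_minus[OF ring_axioms assms(2,3)] .
qed

lemma
  fixes A :: "('k::field fps, 'a) module" (structure)
  assumes A: "kh_algebra A" and I: "ideal I A"
  shows kh_algebra_quot: "kh_algebra (quot_alg A I)"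
    and rcos_alg_hom: "(+>) I \<in> alg_homs A (quot_alg A I)"
    and rcos_surj: "(+>) I ` carrier A = carrier (quot_alg A I)"
proof -
  interpret kh_algebra A by fact
  interpret ideal I A by fact
  show surj: "(+>) I ` carrier A = carrier (quot_alg A I)"
    by (auto simp: quot_alg_def FactRing_simps)
  \<comment> \<open>The scalar action of \<open>quot_alg\<close> is a union over all
    representatives; it collapses because they all give the same coset.\<close>
  have sm: "(\<Union>y\<in>I +> x. I +> (c \<odot> y)) = I +> (c \<odot> x)" if x: "x \<in> carrier A" for c x
  proof -
    have "I +> (c \<odot> y) = I +> (c \<odot> x)" if "y \<in> I +> x" for y
    proof -
      have y: "y \<in> carrier A" using that x a_elemrcos_carrier by blast
      then have "y \<ominus> x \<in> I" using that x mem_rcos_iff[OF I] by blast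
      then have "c \<odot> (y \<ominus> x) \<in> I" by (rule ideal_smult[OF I])
      then show ?thesis using x y by (simp add: rcos_eq_iff[OF I] smult_diff_r)
    qed
    moreover have "x \<in> I +> x" using x by (rule a_rcos_self)
    ultimately show ?thesis by blast
  qed
  show "kh_algebra (quot_alg A I)" "(+>) I \<in> alg_homs A (quot_alg A I)"
    by (rule surj_kh_algebra[OF A surj]; simp add: quot_alg_def FactRing_def a_rcos_sum
        rcoset_mult_add sm a_rcos_zero[OF I additive_subgroup.zero_closed[OF additive_subgroup_axioms]])+
qed

text \<open>The last conclusion is conditional so that one construction serves linear maps (on
  tensor products) as well as algebra homomorphisms (on the presented algebra).\<close>

lemma quot_alg_lift:
  fixes A :: "('k::field fps, 'a) module" (structure)
  assumes A: "kh_algebra A" and B: "kh_algebra B" and I: "ideal I A"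
    and f: "f \<in> linear_maps A B" and ker: "\<And>x. x \<in> I \<Longrightarrow> f x = \<zero>\<^bsub>B\<^esub>"
  obtains g where "g \<in> linear_maps (quot_alg A I) B" "\<And>x. x \<in> carrier A \<Longrightarrow> g (I +> x) = f x"
    "f \<in> alg_homs A B \<Longrightarrow> g \<in> alg_homs (quot_alg A I) B"
proof
  interpret kh_algebra A by fact
  interpret f: linear_map A B f using A B f by (rule linear_mapI)
  interpret Q: kh_algebra "quot_alg A I" by (rule kh_algebra_quot[OF A I])
  interpret p: alg_hom A "quot_alg A I" "(+>) I"
    by (rule alg_homI[OF A Q.kh_algebra_axioms rcos_alg_hom[OF A I]])
  define g where "g C = f (SOME x. x \<in> carrier A \<and> C = I +> x)" for C
  show g: "g (I +> x) = f x" if x: "x \<in> carrier A" for x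
  proof -
    let ?y = "SOME y. y \<in> carrier A \<and> I +> x = I +> y"
    have y: "?y \<in> carrier A \<and> I +> x = I +> ?y" by (rule someI[of "\<lambda>y. y \<in> carrier A \<and> I +> x = I +> y" x]) (simp add: x)
    then have "x \<ominus> ?y \<in> I" using x rcos_eq_iff[OF I] by blast
    then have "f (x \<ominus> ?y) = \<zero>\<^bsub>B\<^esub>" by (rule ker)
    then show ?thesis unfolding g_def using x y by simp
  qed
  have surj: "\<exists>x\<in>carrier A. C = I +> x" if "C \<in> carrier (quot_alg A I)" for C
    using that rcos_surj[OF A I] by blast
  show lin: "g \<in> linear_maps (quot_alg A I) B"
  proof (rule linear_mapsI)
    fix C D assume "C \<in> carrier (quot_alg A I)" "D \<in> carrier (quot_alg A I)"
    then obtain x y where "x \<in> carrier A" "C = I +> x" "y \<in> carrier A" "D = I +> y"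
      using surj by meson
    then show "g (C \<oplus>\<^bsub>quot_alg A I\<^esub> D) = g C \<oplus>\<^bsub>B\<^esub> g D"
      using g[of "x \<oplus> y"] g p.add[of x y] by simp
  next
    fix c C assume "C \<in> carrier (quot_alg A I)"
    then obtain x where "x \<in> carrier A" "C = I +> x" using surj by meson
    then show "g (c \<odot>\<^bsub>quot_alg A I\<^esub> C) = c \<odot>\<^bsub>B\<^esub> g C"
      using g[of "c \<odot> x"] g p.smult[of x c] by simp
  qed (use surj g in force)
  show "g \<in> alg_homs (quot_alg A I) B" if f: "f \<in> alg_homs A B"
  proof (rule alg_homsI[OF lin])
    fix C D assume "C \<in> carrier (quot_alg A I)" "D \<in> carrier (quot_alg A I)"
    then obtain x y where "x \<in> carrier A" "C = I +> x" "y \<in> carrier A" "D = I +> y"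
      using surj by meson
    then show "g (C \<otimes>\<^bsub>quot_alg A I\<^esub> D) = g C \<otimes>\<^bsub>B\<^esub> g D"
      using g[of "x \<otimes> y"] g p.mult[of x y] alg_homs_mult[OF f] by simp
  qed (use g[of \<one>] p.one alg_homs_one[OF f] in simp)
qed

subsection \<open>Completeness\<close>

text \<open>The rate is fixed: entry \<open>m\<close> already determines the limit modulo \<hbar>^m.
  Such sequences are exactly the choices of representatives for the points of the inverse
  limit.\<close>

definition cauchy_seqs :: "('k::field fps, 'a) module \<Rightarrow> (nat \<Rightarrow> 'a) set" where
  "cauchy_seqs A = {x. (\<forall>m. x m \<in> carrier A) \<and> (\<forall>m. x (Suc m) \<ominus>\<^bsub>A\<^esub> x m \<in> hpow A m)}"

definition separated :: "('k::field fps, 'a) module \<Rightarrow> bool" where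
  "separated A \<longleftrightarrow> (\<forall>x\<in>carrier A. (\<forall>m. x \<in> hpow A m) \<longrightarrow> x = \<zero>\<^bsub>A\<^esub>)"

definition cls :: "('k::field fps, 'a) module \<Rightarrow> (nat \<Rightarrow> 'a) \<Rightarrow> nat \<Rightarrow> 'a set" where
  "cls A x = (\<lambda>m. hpow A m +>\<^bsub>A\<^esub> x m)"

text \<open>Calculations in the completion are made here, on representatives and entrywise, and are
  then carried over along the surjection \<open>cls\<close>.\<close>

definition cauchy_alg :: "('k::field fps, 'a) module \<Rightarrow> ('k fps, nat \<Rightarrow> 'a) module" where
  "cauchy_alg A = \<lparr>carrier = cauchy_seqs A, mult = (\<lambda>x y m. x m \<otimes>\<^bsub>A\<^esub> y m), one = (\<lambda>m. \<one>\<^bsub>A\<^esub>),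
     zero = (\<lambda>m. \<zero>\<^bsub>A\<^esub>), add = (\<lambda>x y m. x m \<oplus>\<^bsub>A\<^esub> y m), smult = (\<lambda>c x m. c \<odot>\<^bsub>A\<^esub> x m)\<rparr>"

lemma to_completion_eq_cls: "to_completion A x = cls A (\<lambda>_. x)"
  by (simp add: to_completion_def cls_def)

lemma separatedD:
  assumes "separated A" "kh_algebra A" "x \<in> carrier A" "y \<in> carrier A" "\<And>m. x \<ominus>\<^bsub>A\<^esub> y \<in> hpow A m"
  shows "x = y"
proof -
  interpret kh_algebra A by fact
  have "x \<ominus>\<^bsub>A\<^esub> y = \<zero>\<^bsub>A\<^esub>" using assms unfolding separated_def by blast
  then show ?thesis using assms(3,4) by simp
qed

context kh_algebra
begin

lemma l_diff_distr:
  "x \<in> carrier A \<Longrightarrow> y \<in> carrier A \<Longrightarrow> z \<in> carrier A \<Longrightarrow> (x \<ominus> y) \<otimes> z = x \<otimes> z \<ominus> y \<otimes> z"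
  by (simp add: minus_eq l_distr l_minus)

lemma r_diff_distr:
  "x \<in> carrier A \<Longrightarrow> y \<in> carrier A \<Longrightarrow> z \<in> carrier A \<Longrightarrow> z \<otimes> (x \<ominus> y) = z \<otimes> x \<ominus> z \<otimes> y"
  by (simp add: minus_eq r_distr r_minus)

lemma diff_telescope:
  "x \<in> carrier A \<Longrightarrow> y \<in> carrier A \<Longrightarrow> z \<in> carrier A \<Longrightarrow> (x \<ominus> y) \<oplus> (y \<ominus> z) = x \<ominus> z"
  by (simp add: ring_simprules)

lemma diff_add_cancel: "x \<in> carrier A \<Longrightarrow> y \<in> carrier A \<Longrightarrow> (x \<ominus> y) \<oplus> y = x"
  by (simp add: minus_eq a_assoc l_neg)

lemma diff_diff_cancel:
  assumes "x \<in> carrier A" "y \<in> carrier A" "z \<in> carrier A"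
  shows "(x \<ominus> z) \<ominus> (y \<ominus> z) = x \<ominus> y"
  using diff_telescope[of x z y] assms by (simp add: minus_eq minus_add a_comm)

lemma cauchy_seqsD:
  "x \<in> cauchy_seqs A \<Longrightarrow> x m \<in> carrier A" "x \<in> cauchy_seqs A \<Longrightarrow> x (Suc m) \<ominus> x m \<in> hpow A m"
  by (auto simp: cauchy_seqs_def)

lemma cauchy_seqs_le: "x \<in> cauchy_seqs A \<Longrightarrow> m \<le> n \<Longrightarrow> x n \<ominus> x m \<in> hpow A m"
  by (rule cauchy_diff_le) (auto simp: cauchy_seqs_def)

lemma cauchy_seqs_const [simp]: "x \<in> carrier A \<Longrightarrow> (\<lambda>_. x) \<in> cauchy_seqs A"
  by (simp add: cauchy_seqs_def)

lemma cauchy_seqs_add: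
  assumes "x \<in> cauchy_seqs A" "y \<in> cauchy_seqs A" shows "(\<lambda>m. x m \<oplus> y m) \<in> cauchy_seqs A"
proof -
  have "(x (Suc m) \<oplus> y (Suc m)) \<ominus> (x m \<oplus> y m) = (x (Suc m) \<ominus> x m) \<oplus> (y (Suc m) \<ominus> y m)" for m
    using assms[THEN cauchy_seqsD(1)] by (simp add: alg_simps)
  then show ?thesis using assms by (auto simp: cauchy_seqs_def hpow_add)
qed

lemma cauchy_seqs_mult:
  assumes "x \<in> cauchy_seqs A" "y \<in> cauchy_seqs A" shows "(\<lambda>m. x m \<otimes> y m) \<in> cauchy_seqs A"
proof -
  have "(x (Suc m) \<otimes> y (Suc m)) \<ominus> (x m \<otimes> y m)
      = (x (Suc m) \<ominus> x m) \<otimes> y (Suc m) \<oplus> x m \<otimes> (y (Suc m) \<ominus> y m)" for m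
    using assms[THEN cauchy_seqsD(1)] by (simp add: l_diff_distr r_diff_distr diff_telescope)
  then show ?thesis using assms by (auto simp: cauchy_seqs_def hpow_add hpow_mult_l hpow_mult_r)
qed

lemma cauchy_seqs_smult:
  assumes "x \<in> cauchy_seqs A" shows "(\<lambda>m. c \<odot> x m) \<in> cauchy_seqs A"
  using assms by (auto simp: cauchy_seqs_def hpow_smult simp flip: smult_diff_r)

lemma kh_algebra_cauchy: "kh_algebra (cauchy_alg A)"
  by (rule kh_algebraI) (auto simp: cauchy_alg_def cauchy_seqs_add cauchy_seqs_mult cauchy_seqs_smult
      cauchy_seqsD(1) fun_eq_iff alg_simps)

lemma cls_eq_iff:
  assumes "x \<in> cauchy_seqs A" "y \<in> cauchy_seqs A"
  shows "cls A x = cls A y \<longleftrightarrow> (\<forall>m. x m \<ominus> y m \<in> hpow A m)"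
  using assms by (simp add: cls_def fun_eq_iff rcos_eq_iff hpow_ideal cauchy_seqsD(1))

lemma cls_surj: "cls A ` cauchy_seqs A = carrier (completion A)"
proof (intro equalityI subsetI)
  interpret hp: ideal "hpow A m" A for m by (rule hpow_ideal)
  fix s assume "s \<in> cls A ` cauchy_seqs A"
  then obtain x where x: "x \<in> cauchy_seqs A" and s: "s = cls A x" by auto
  note [simp] = cauchy_seqsD(1)[OF x]
  have "hpow A m +> x m \<in> carrier (quot_alg A (hpow A m))" for m
    using rcos_surj[OF kh_algebra_axioms hpow_ideal, of m] cauchy_seqsD(1)[OF x, of m] by blast
  moreover have "hpow A (Suc m) +> x (Suc m) \<subseteq> hpow A m +> x m" for m
  proof
    fix y assume y: "y \<in> hpow A (Suc m) +> x (Suc m)"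
    then have yc: "y \<in> carrier A"
      using hp.a_elemrcos_carrier cauchy_seqsD(1)[OF x] by blast
    then have "y \<ominus> x (Suc m) \<in> hpow A (Suc m)" using y by (simp add: mem_rcos_iff hpow_ideal)
    then have "y \<ominus> x m \<in> hpow A m"
      by (rule hpow_diff_trans[OF hpow_mono cauchy_seqsD(2)[OF x]]) (auto simp: yc)
    then show "y \<in> hpow A m +> x m" using yc by (simp add: mem_rcos_iff hpow_ideal)
  qed
  ultimately show "s \<in> carrier (completion A)" by (simp add: s cls_def completion_def)
next
  interpret hp: ideal "hpow A m" A for m by (rule hpow_ideal)
  fix s assume s: "s \<in> carrier (completion A)"
  then have "s m \<in> carrier (quot_alg A (hpow A m))" for m by (simp add: completion_def)
  then have "\<exists>x. x \<in> carrier A \<and> s m = hpow A m +> x" for m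
    using rcos_surj[OF kh_algebra_axioms hpow_ideal, of m] by blast
  then obtain x where x: "\<And>m. x m \<in> carrier A" "\<And>m. s m = hpow A m +> x m" by metis
  \<comment> \<open>The inclusion of the cosets at consecutive levels is precisely the Cauchy
    condition on representatives.\<close>
  have "x (Suc m) \<in> s m" for m
    using s hp.a_rcos_self[OF x(1)[of "Suc m"], of "Suc m"] x(2)[of "Suc m"]
    by (auto simp: completion_def)
  then have "x (Suc m) \<ominus> x m \<in> hpow A m" for m
    using x by (simp add: mem_rcos_iff hpow_ideal)
  then have "x \<in> cauchy_seqs A" using x by (simp add: cauchy_seqs_def)
  moreover have "s = cls A x" using x by (simp add: cls_def fun_eq_iff)
  ultimately show "s \<in> cls A ` cauchy_seqs A" by auto
qed

lemma kh_algebra_completion: "kh_algebra (completion A)"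
  and cls_hom: "cls A \<in> alg_homs (cauchy_alg A) (completion A)"
proof -
  have q: "alg_hom A (quot_alg A (hpow A m)) ((+>) (hpow A m))" for m
    by (intro alg_homI kh_algebra_axioms kh_algebra_quot hpow_ideal rcos_alg_hom)
  interpret q: alg_hom A "quot_alg A (hpow A m)" "(+>) (hpow A m)" for m by (rule q)
  have surj: "cls A ` carrier (cauchy_alg A) = carrier (completion A)"
    by (simp add: cauchy_alg_def cls_surj)
  note [simp] = cauchy_seqsD(1) and [simp del] = q.add q.mult q.smult q.one q.zero
  show "kh_algebra (completion A)" "cls A \<in> alg_homs (cauchy_alg A) (completion A)"
    by (rule surj_kh_algebra[OF kh_algebra_cauchy surj];
        auto simp: cauchy_alg_def cls_def completion_def fun_eq_iff
          q.add[symmetric] q.mult[symmetric] q.smult[symmetric] q.one[symmetric] q.zero[symmetric])+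
qed

lemma completion_cases:
  assumes "s \<in> carrier (completion A)"
  obtains x where "x \<in> cauchy_seqs A" "s = cls A x"
  using assms cls_surj[symmetric] by auto

lemma cls_carrier: "x \<in> cauchy_seqs A \<Longrightarrow> cls A x \<in> carrier (completion A)"
  using cls_surj by blast

lemma cls_smult:
  assumes "x \<in> cauchy_seqs A"
  shows "c \<odot>\<^bsub>completion A\<^esub> cls A x = cls A (\<lambda>m. c \<odot> x m)"
  using linear_maps_smult[OF alg_homs_linear[OF cls_hom], of x c] assms by (simp add: cauchy_alg_def)

lemma
  assumes "x \<in> cauchy_seqs A" "y \<in> cauchy_seqs A"
  shows cls_add: "cls A x \<oplus>\<^bsub>completion A\<^esub> cls A y = cls A (\<lambda>m. x m \<oplus> y m)"
    and cls_mult: "cls A x \<otimes>\<^bsub>completion A\<^esub> cls A y = cls A (\<lambda>m. x m \<otimes> y m)"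
    and cls_diff: "cls A x \<ominus>\<^bsub>completion A\<^esub> cls A y = cls A (\<lambda>m. x m \<ominus> y m)"
proof -
  have hom: "alg_hom (cauchy_alg A) (completion A) (cls A)"
    by (rule alg_homI[OF kh_algebra_cauchy kh_algebra_completion cls_hom])
  interpret h: alg_hom "cauchy_alg A" "completion A" "cls A" by (rule hom)
  note sm = cls_smult
  show "cls A x \<oplus>\<^bsub>completion A\<^esub> cls A y = cls A (\<lambda>m. x m \<oplus> y m)"
    "cls A x \<otimes>\<^bsub>completion A\<^esub> cls A y = cls A (\<lambda>m. x m \<otimes> y m)"
    using h.add[of x y] h.mult[of x y] assms by (simp_all add: cauchy_alg_def)
  have "cls A x \<ominus>\<^bsub>completion A\<^esub> cls A y = cls A x \<oplus>\<^bsub>completion A\<^esub> ((-1) \<odot>\<^bsub>completion A\<^esub> cls A y)"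
    using assms cls_carrier by (simp add: h.B.minus_eq h.B.smult_neg_l)
  also have "\<dots> = cls A (\<lambda>m. x m \<oplus> (-1) \<odot> y m)"
    using h.add[of x "\<lambda>m. (-1) \<odot> y m"] sm[of y "-1"] assms cauchy_seqs_smult[of y "-1"]
    by (simp add: cauchy_alg_def)
  also have "(\<lambda>m. x m \<oplus> (-1) \<odot> y m) = (\<lambda>m. x m \<ominus> y m)"
    using assms[THEN cauchy_seqsD(1)] by (simp add: minus_eq smult_neg_l)
  finally show "cls A x \<ominus>\<^bsub>completion A\<^esub> cls A y = cls A (\<lambda>m. x m \<ominus> y m)" .
qed

lemma to_completion_hom: "to_completion A \<in> alg_homs A (completion A)"
proof (rule alg_homsI[OF linear_mapsI])
  show "to_completion A \<one> = \<one>\<^bsub>completion A\<^esub>"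
    by (simp add: to_completion_eq_cls cls_def completion_def quot_alg_def FactRing_def)
qed (simp_all add: to_completion_eq_cls cls_add cls_mult cls_smult cls_carrier)

lemma separated_iff_inj: "separated A \<longleftrightarrow> inj_on (to_completion A) (carrier A)"
proof -
  have "to_completion A x = to_completion A y \<longleftrightarrow> (\<forall>m. x \<ominus> y \<in> hpow A m)"
    if "x \<in> carrier A" "y \<in> carrier A" for x y
    using that by (simp add: to_completion_eq_cls cls_eq_iff)
  then have *: "inj_on (to_completion A) (carrier A) \<longleftrightarrow>
      (\<forall>x\<in>carrier A. \<forall>y\<in>carrier A. (\<forall>m. x \<ominus> y \<in> hpow A m) \<longrightarrow> x = y)"
    by (auto simp: inj_on_def)
  show ?thesis unfolding *
  proof
    assume "separated A"
    then show "\<forall>x\<in>carrier A. \<forall>y\<in>carrier A. (\<forall>m. x \<ominus> y \<in> hpow A m) \<longrightarrow> x = y"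
      using separatedD[OF _ kh_algebra_axioms] by blast
  next
    assume *: "\<forall>x\<in>carrier A. \<forall>y\<in>carrier A. (\<forall>m. x \<ominus> y \<in> hpow A m) \<longrightarrow> x = y"
    show "separated A" unfolding separated_def
    proof (intro ballI impI)
      fix x assume x: "x \<in> carrier A" "\<forall>m. x \<in> hpow A m"
      have "x \<ominus> \<zero> = x" using x(1) by (simp add: minus_eq)
      then show "x = \<zero>" using * x by (metis zero_closed)
    qed
  qed
qed

text \<open>Injectivity of the map to the inverse limit is separatedness, and surjectivity is the
  existence of limits at the standard rate. Completeness is checked and used in this form.\<close>

lemma hadic_complete_iff:
  "hadic_complete A \<longleftrightarrow>
     separated A \<and> (\<forall>x\<in>cauchy_seqs A. \<exists>c\<in>carrier A. \<forall>m. c \<ominus> x m \<in> hpow A m)"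
proof -
  have "(\<exists>c\<in>carrier A. \<forall>m. c \<ominus> x m \<in> hpow A m) \<longleftrightarrow> cls A x \<in> to_completion A ` carrier A"
    if "x \<in> cauchy_seqs A" for x
    unfolding image_iff Bex_def
    by (rule arg_cong[of _ _ Ex], rule ext, rule conj_cong[OF refl], subst eq_commute)
      (simp add: to_completion_eq_cls cls_eq_iff that)
  moreover have "to_completion A ` carrier A \<subseteq> carrier (completion A)"
    using linear_maps_closed[OF alg_homs_linear[OF to_completion_hom]] by blast
  then have "to_completion A ` carrier A = carrier (completion A) \<longleftrightarrow>
      (\<forall>x\<in>cauchy_seqs A. cls A x \<in> to_completion A ` carrier A)"
    unfolding cls_surj[symmetric] by blast
  ultimately have "to_completion A ` carrier A = carrier (completion A) \<longleftrightarrow>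
      (\<forall>x\<in>cauchy_seqs A. \<exists>c\<in>carrier A. \<forall>m. c \<ominus> x m \<in> hpow A m)"
    by simp
  then show ?thesis by (simp add: hadic_complete_def bij_betw_def separated_iff_inj)
qed

lemma complete_separated: "hadic_complete A \<Longrightarrow> separated A"
  by (simp add: hadic_complete_iff)

text \<open>The \<hbar>-adic topology of the completion is that of the inverse limit. From right to
  left one has to divide a Cauchy sequence by \<hbar>^m although quotients are not unique: the entry
  \<open>x m\<close> and all later increments are multiples of \<hbar>^m, and chosen quotients add
  up to a Cauchy sequence. It matters that the topology is given by a single element
  \<hbar>.\<close>

lemma cls_hpow_iff:
  assumes x: "x \<in> cauchy_seqs A"
  shows "cls A x \<in> hpow (completion A) m \<longleftrightarrow> x m \<in> hpow A m"
proof
  note [simp] = cauchy_seqsD(1)[OF x]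
  assume "cls A x \<in> hpow (completion A) m"
  then obtain y where y: "y \<in> cauchy_seqs A" "cls A x = fps_X ^ m \<odot>\<^bsub>completion A\<^esub> cls A y"
    using kh_algebra.hpow_iff[OF kh_algebra_completion] completion_cases by metis
  then have "cls A x = cls A (\<lambda>k. fps_X ^ m \<odot> y k)" by (simp add: cls_smult)
  then have "x m \<ominus> fps_X ^ m \<odot> y m \<in> hpow A m"
    using cls_eq_iff[OF x cauchy_seqs_smult[OF y(1)]] by simp
  then have "(x m \<ominus> fps_X ^ m \<odot> y m) \<oplus> fps_X ^ m \<odot> y m \<in> hpow A m"
    by (rule hpow_add) (use y(1) in \<open>auto intro: hpowI cauchy_seqsD\<close>)
  also have "(x m \<ominus> fps_X ^ m \<odot> y m) \<oplus> fps_X ^ m \<odot> y m = x m"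
    using cauchy_seqsD(1)[OF y(1), of m] by (simp add: ring_simprules)
  finally show "x m \<in> hpow A m" .
next
  note [simp] = cauchy_seqsD(1)[OF x]
  assume "x m \<in> hpow A m"
  then obtain y0 where y0: "y0 \<in> carrier A" "x m = fps_X ^ m \<odot> y0" by (auto simp: hpow_iff)
  have "\<exists>y. y \<in> carrier A \<and> x (Suc (m + k)) \<ominus> x (m + k) = fps_X ^ (m + k) \<odot> y" for k
    using cauchy_seqsD(2)[OF x, of "m + k"] by (auto simp: hpow_iff)
  then obtain y where y: "\<And>k. y k \<in> carrier A"
    "\<And>k. x (Suc (m + k)) \<ominus> x (m + k) = fps_X ^ (m + k) \<odot> y k" by metis
  \<comment> \<open>\<open>z k\<close> is \<open>y0\<close> plus the sum of \<hbar>^i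
    \<open>y i\<close> for i < k, that is, \<open>x (m + k)\<close> divided by \<hbar>^m with a
    definite choice of quotients.\<close>
  define z where "z = rec_nat y0 (\<lambda>k zk. fps_X ^ k \<odot> y k \<oplus> zk)"
  have z_simps: "z 0 = y0" "z (Suc k) = fps_X ^ k \<odot> y k \<oplus> z k" for k by (simp_all add: z_def)
  have zc [simp]: "z k \<in> carrier A" for k by (induction k) (simp_all add: z_simps y0 y)
  have "z (Suc k) \<ominus> z k = fps_X ^ k \<odot> y k" for k using y by (simp add: z_simps ring_simprules)
  then have z: "z \<in> cauchy_seqs A" using y by (simp add: cauchy_seqs_def hpowI)
  have xz: "x (m + k) = fps_X ^ m \<odot> z k" for k
  proof (induction k)
    case (Suc k)
    have "x (Suc (m + k)) = (x (Suc (m + k)) \<ominus> x (m + k)) \<oplus> x (m + k)"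
      by (simp add: diff_add_cancel)
    also have "\<dots> = fps_X ^ m \<odot> z (Suc k)"
      unfolding y(2) using y(1) by (simp add: Suc z_simps smult_r smult_smult power_add)
    finally show ?case by simp
  qed (simp add: y0 z_simps)
  \<comment> \<open>Passing from index \<open>k\<close> to index \<open>m + k\<close> changes a
    Cauchy sequence only within its class.\<close>
  have "x k \<ominus> fps_X ^ m \<odot> z k \<in> hpow A k" for k
    using hpow_diff_sym[OF cauchy_seqs_le[OF x, of k "m + k"]] by (simp add: xz[symmetric])
  then have "cls A x = fps_X ^ m \<odot>\<^bsub>completion A\<^esub> cls A z"
    by (simp add: cls_smult z cls_eq_iff x cauchy_seqs_smult)
  then show "cls A x \<in> hpow (completion A) m"
    using kh_algebra.hpowI[OF kh_algebra_completion cls_carrier[OF z]] by simp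
qed

lemma completion_dense:
  assumes "s \<in> carrier (completion A)"
  obtains x where "x \<in> carrier A" "s \<ominus>\<^bsub>completion A\<^esub> to_completion A x \<in> hpow (completion A) m"
proof -
  obtain x where x: "x \<in> cauchy_seqs A" "s = cls A x" using completion_cases[OF assms] .
  then have "s \<ominus>\<^bsub>completion A\<^esub> to_completion A (x m) = cls A (\<lambda>k. x k \<ominus> x m)"
    by (simp add: to_completion_eq_cls cls_diff cauchy_seqsD(1))
  moreover have "(\<lambda>k. x k \<ominus> x m) \<in> cauchy_seqs A"
  proof -
    have "(x (Suc k) \<ominus> x m) \<ominus> (x k \<ominus> x m) = x (Suc k) \<ominus> x k" for k
      using cauchy_seqsD(1)[OF x(1)] by (simp add: diff_diff_cancel)
    then show ?thesis using x(1) by (auto simp: cauchy_seqs_def)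
  qed
  ultimately show ?thesis using that[of "x m"] cauchy_seqsD(1)[OF x(1)] by (simp add: cls_hpow_iff)
qed

lemma hadic_complete_completion: "hadic_complete (completion A)"
proof -
  interpret C: kh_algebra "completion A" by (rule kh_algebra_completion)
  have zero: "\<zero>\<^bsub>completion A\<^esub> = cls A (\<lambda>_. \<zero>)"
    using linear_map.zero[OF linear_mapI[OF kh_algebra_axioms kh_algebra_completion
        alg_homs_linear[OF to_completion_hom]]] by (simp add: to_completion_eq_cls)
  show ?thesis unfolding C.hadic_complete_iff
  proof (intro conjI ballI)
    show "separated (completion A)" unfolding separated_def
    proof (intro ballI impI)
      fix s assume s: "s \<in> carrier (completion A)" "\<forall>m. s \<in> hpow (completion A) m"
      obtain x where x: "x \<in> cauchy_seqs A" "s = cls A x" using completion_cases[OF s(1)] .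
      then have "x m \<in> hpow A m" for m using s(2) by (simp add: cls_hpow_iff)
      then show "s = \<zero>\<^bsub>completion A\<^esub>"
        using x by (simp add: zero cls_eq_iff minus_eq cauchy_seqsD(1))
    qed
  next
    fix s assume s: "s \<in> cauchy_seqs (completion A)"
    have "\<exists>y. y \<in> cauchy_seqs A \<and> s m = cls A y" for m
      using C.cauchy_seqsD(1)[OF s, of m] completion_cases by metis
    then obtain x where x: "\<And>m. x m \<in> cauchy_seqs A" "\<And>m. s m = cls A (x m)" by metis
    note [simp] = cauchy_seqsD(1)[OF x(1)]
    have seq: "(\<lambda>k. x m k \<ominus> x n k) \<in> cauchy_seqs A" for m n
    proof -
      have "(x m (Suc k) \<ominus> x n (Suc k)) \<ominus> (x m k \<ominus> x n k)
          = (x m (Suc k) \<ominus> x m k) \<ominus> (x n (Suc k) \<ominus> x n k)" for k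
        by (simp add: ring_simprules)
      then show ?thesis using x(1) by (auto simp: cauchy_seqs_def hpow_diff)
    qed
    have d: "x (Suc m) m \<ominus> x m m \<in> hpow A m" for m
      using C.cauchy_seqsD(2)[OF s, of m] by (simp add: x cls_diff cls_hpow_iff seq)
    \<comment> \<open>The limit is represented by the diagonal: row \<open>m\<close> is known modulo
      \<hbar>^m from its entry \<open>m\<close>, and neighbouring rows agree there.\<close>
    define c where "c m = x m m" for m
    have "c (Suc m) \<ominus> c m \<in> hpow A m" for m
      unfolding c_def by (rule hpow_diff_trans[OF cauchy_seqsD(2)[OF x(1)] d]) simp_all
    then have c: "c \<in> cauchy_seqs A" by (simp add: cauchy_seqs_def c_def)
    have "cls A c \<ominus>\<^bsub>completion A\<^esub> s m \<in> hpow (completion A) m" for m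
    proof -
      have "(\<lambda>k. c k \<ominus> x m k) \<in> cauchy_seqs A"
      proof -
        have "(c (Suc k) \<ominus> x m (Suc k)) \<ominus> (c k \<ominus> x m k)
            = (c (Suc k) \<ominus> c k) \<ominus> (x m (Suc k) \<ominus> x m k)" for k
          by (simp add: c_def ring_simprules)
        then show ?thesis using x(1)[of m] c by (auto simp: cauchy_seqs_def hpow_diff)
      qed
      then show ?thesis using c x by (simp add: cls_diff cls_hpow_iff) (simp add: c_def)
    qed
    then show "\<exists>c\<in>carrier (completion A). \<forall>m. c \<ominus>\<^bsub>completion A\<^esub> s m \<in> hpow (completion A) m"
      using cls_carrier[OF c] by blast
  qed
qed

end

section \<open>Extension of continuous maps to completions\<close>

lemma linear_maps_cauchy:
  assumes "linear_map A B f" "x \<in> cauchy_seqs A" shows "(\<lambda>m. f (x m)) \<in> cauchy_seqs B"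
proof -
  interpret linear_map A B f by fact
  show ?thesis
    using assms(2) hpow by (auto simp: cauchy_seqs_def simp flip: diff)
qed

text \<open>Linear maps are continuous, so they are determined by a dense submodule.\<close>

lemma linear_maps_completion_eqI:
  assumes A: "kh_algebra A" and C: "kh_algebra C" "separated C"
    and f: "f \<in> linear_maps (completion A) C" and g: "g \<in> linear_maps (completion A) C"
    and eq: "\<And>x. x \<in> carrier A \<Longrightarrow> f (to_completion A x) = g (to_completion A x)"
    and s: "s \<in> carrier (completion A)"
  shows "f s = g s"
proof (rule separatedD[OF C(2,1)])
  interpret A: kh_algebra A by fact
  interpret f: linear_map "completion A" C f by (rule linear_mapI[OF A.kh_algebra_completion C(1) f])
  interpret g: linear_map "completion A" C g by (rule linear_mapI[OF A.kh_algebra_completion C(1) g])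
  show "f s \<in> carrier C" "g s \<in> carrier C" using s by simp_all
  fix m
  obtain x where x: "x \<in> carrier A" "s \<ominus>\<^bsub>completion A\<^esub> to_completion A x \<in> hpow (completion A) m"
    using A.completion_dense[OF s] .
  let ?t = "to_completion A x"
  have t: "?t \<in> carrier (completion A)"
    using x(1) by (rule linear_maps_closed[OF alg_homs_linear[OF A.to_completion_hom]])
  have "f (s \<ominus>\<^bsub>completion A\<^esub> ?t) \<ominus>\<^bsub>C\<^esub> g (s \<ominus>\<^bsub>completion A\<^esub> ?t) \<in> hpow C m"
    by (rule f.B.hpow_diff[OF f.hpow[OF x(2)] g.hpow[OF x(2)]])
  also have "f (s \<ominus>\<^bsub>completion A\<^esub> ?t) \<ominus>\<^bsub>C\<^esub> g (s \<ominus>\<^bsub>completion A\<^esub> ?t) = f s \<ominus>\<^bsub>C\<^esub> g s"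
    using s t f.closed[OF s] g.closed[OF s] g.closed[OF t] eq[OF x(1)]
    by (simp add: f.B.ring_simprules)
  finally show "f s \<ominus>\<^bsub>C\<^esub> g s \<in> hpow C m" .
qed

text \<open>The value at a point is the limit of \<open>f\<close> along any representing Cauchy
  sequence. Since limits in \<open>C\<close> are unique, each law for \<open>g\<close> follows once
  the expected value is seen to be such a limit; this is the role of \<open>uniq\<close>.\<close>

lemma completion_lift:
  assumes A: "kh_algebra A" and C: "kh_algebra C" "hadic_complete C"
    and f: "f \<in> linear_maps A C"
  obtains g where "g \<in> linear_maps (completion A) C"
    "\<And>x. x \<in> carrier A \<Longrightarrow> g (to_completion A x) = f x"
    "f \<in> alg_homs A C \<Longrightarrow> g \<in> alg_homs (completion A) C"
proof -
  interpret f: linear_map A C f by (rule linear_mapI[OF A C(1) f])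
  note sep = separatedD[OF f.B.complete_separated[OF C(2)] C(1)]
  have "\<exists>c. c \<in> carrier C \<and> (\<forall>x\<in>cauchy_seqs A. s = cls A x \<longrightarrow> (\<forall>m. c \<ominus>\<^bsub>C\<^esub> f (x m) \<in> hpow C m))"
    if s: "s \<in> carrier (completion A)" for s
  proof -
    obtain x where x: "x \<in> cauchy_seqs A" "s = cls A x" using f.A.completion_cases[OF s] .
    obtain c where c: "c \<in> carrier C" "\<And>m. c \<ominus>\<^bsub>C\<^esub> f (x m) \<in> hpow C m"
      using C(2) linear_maps_cauchy[OF f.linear_map_axioms x(1)] by (auto simp: f.B.hadic_complete_iff)
    have "c \<ominus>\<^bsub>C\<^esub> f (y m) \<in> hpow C m" if y: "y \<in> cauchy_seqs A" "s = cls A y" for y m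
    proof -
      have "x m \<ominus>\<^bsub>A\<^esub> y m \<in> hpow A m" using x y f.A.cls_eq_iff by metis
      then have "f (x m \<ominus>\<^bsub>A\<^esub> y m) \<in> hpow C m" by (rule f.hpow)
      with c x y show ?thesis
        by (intro f.B.hpow_diff_trans[OF c(2)]) (simp_all add: f.A.cauchy_seqsD(1))
    qed
    with c show ?thesis by blast
  qed
  then obtain g where g: "\<And>s. s \<in> carrier (completion A) \<Longrightarrow> g s \<in> carrier C"
    "\<And>x m. x \<in> cauchy_seqs A \<Longrightarrow> g (cls A x) \<ominus>\<^bsub>C\<^esub> f (x m) \<in> hpow C m"
    using f.A.cls_carrier by metis
  have uniq: "g (cls A x) = c"
    if "x \<in> cauchy_seqs A" "c \<in> carrier C" "\<And>m. c \<ominus>\<^bsub>C\<^esub> f (x m) \<in> hpow C m" for x c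
  proof (rule sep)
    show "g (cls A x) \<ominus>\<^bsub>C\<^esub> c \<in> hpow C m" for m
      using that g f.A.cls_carrier
      by (intro f.B.hpow_diff_trans[OF g(2)[OF that(1)] f.B.hpow_diff_sym[OF that(3)]])
        (simp_all add: f.A.cauchy_seqsD(1))
  qed (use that g f.A.cls_carrier in auto)
  note closed [simp] = f.A.cauchy_seqsD(1) g(1)[OF f.A.cls_carrier]
  show ?thesis
  proof
    show lin: "g \<in> linear_maps (completion A) C"
    proof (rule linear_mapsI)
      fix s t assume "s \<in> carrier (completion A)" "t \<in> carrier (completion A)"
      then obtain x y where xy: "x \<in> cauchy_seqs A" "y \<in> cauchy_seqs A" "s = cls A x" "t = cls A y"
        by (elim f.A.completion_cases) auto
      have "g (cls A (\<lambda>m. x m \<oplus>\<^bsub>A\<^esub> y m)) = g s \<oplus>\<^bsub>C\<^esub> g t"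
      proof (rule uniq)
        fix m
        have "(g s \<oplus>\<^bsub>C\<^esub> g t) \<ominus>\<^bsub>C\<^esub> f (x m \<oplus>\<^bsub>A\<^esub> y m) = (g s \<ominus>\<^bsub>C\<^esub> f (x m)) \<oplus>\<^bsub>C\<^esub> (g t \<ominus>\<^bsub>C\<^esub> f (y m))"
          using xy by (simp add: f.B.ring_simprules)
        then show "(g s \<oplus>\<^bsub>C\<^esub> g t) \<ominus>\<^bsub>C\<^esub> f (x m \<oplus>\<^bsub>A\<^esub> y m) \<in> hpow C m"
          using xy g(2) f.B.hpow_add by simp
      qed (use xy in \<open>auto intro: f.A.cauchy_seqs_add\<close>)
      then show "g (s \<oplus>\<^bsub>completion A\<^esub> t) = g s \<oplus>\<^bsub>C\<^esub> g t" using xy by (simp add: f.A.cls_add)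
    next
      fix c s assume "s \<in> carrier (completion A)"
      then obtain x where x: "x \<in> cauchy_seqs A" "s = cls A x" by (elim f.A.completion_cases) auto
      have "g (cls A (\<lambda>m. c \<odot>\<^bsub>A\<^esub> x m)) = c \<odot>\<^bsub>C\<^esub> g s"
        by (rule uniq) (use x g(2) in \<open>auto intro: f.A.cauchy_seqs_smult f.B.hpow_smult
            simp flip: f.B.smult_diff_r\<close>)
      then show "g (c \<odot>\<^bsub>completion A\<^esub> s) = c \<odot>\<^bsub>C\<^esub> g s" using x by (simp add: f.A.cls_smult)
    qed (rule g(1))
    show gx: "g (to_completion A x) = f x" if "x \<in> carrier A" for x
      unfolding to_completion_eq_cls by (rule uniq) (use that in simp_all)
    show "g \<in> alg_homs (completion A) C" if hom: "f \<in> alg_homs A C"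
    proof (rule alg_homsI[OF lin])
      fix s t assume "s \<in> carrier (completion A)" "t \<in> carrier (completion A)"
      then obtain x y where xy: "x \<in> cauchy_seqs A" "y \<in> cauchy_seqs A" "s = cls A x" "t = cls A y"
        by (elim f.A.completion_cases) auto
      have "g (cls A (\<lambda>m. x m \<otimes>\<^bsub>A\<^esub> y m)) = g s \<otimes>\<^bsub>C\<^esub> g t"
      proof (rule uniq)
        fix m
        have "(g s \<otimes>\<^bsub>C\<^esub> g t) \<ominus>\<^bsub>C\<^esub> (f (x m) \<otimes>\<^bsub>C\<^esub> f (y m))
            = (g s \<ominus>\<^bsub>C\<^esub> f (x m)) \<otimes>\<^bsub>C\<^esub> g t \<oplus>\<^bsub>C\<^esub> f (x m) \<otimes>\<^bsub>C\<^esub> (g t \<ominus>\<^bsub>C\<^esub> f (y m))"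
          using xy by (simp add: f.B.l_diff_distr f.B.r_diff_distr f.B.diff_telescope)
        then show "(g s \<otimes>\<^bsub>C\<^esub> g t) \<ominus>\<^bsub>C\<^esub> f (x m \<otimes>\<^bsub>A\<^esub> y m) \<in> hpow C m"
          using xy g(2) by (simp add: alg_homs_mult[OF hom] f.B.hpow_add f.B.hpow_mult_l f.B.hpow_mult_r)
      qed (use xy in \<open>auto intro: f.A.cauchy_seqs_mult\<close>)
      then show "g (s \<otimes>\<^bsub>completion A\<^esub> t) = g s \<otimes>\<^bsub>C\<^esub> g t" using xy by (simp add: f.A.cls_mult)
    qed (use gx[of "\<one>\<^bsub>A\<^esub>"] alg_homs_one[OF hom] alg_homs_one[OF f.A.to_completion_hom] in simp)
  qed
qed

subsection \<open>Monoid algebras\<close>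

lemma (in kh_algebra) submodule_iff:
  "submodule N kh A \<longleftrightarrow> N \<subseteq> carrier A \<and> \<zero> \<in> N \<and> (\<forall>x\<in>N. \<forall>y\<in>N. x \<oplus> y \<in> N) \<and> (\<forall>c. \<forall>x\<in>N. c \<odot> x \<in> N)"
  (is "_ \<longleftrightarrow> ?R")
proof
  assume N: "submodule N kh A"
  then have "\<zero> \<in> N" using subgroup.one_closed[OF submodule.axioms(1)[OF N]] by simp
  then show ?R using submoduleE[OF N] by auto
next
  assume R: ?R
  show "submodule N kh A"
  proof (rule submoduleI)
    fix x assume "x \<in> N"
    then have "(-1) \<odot> x \<in> N" "x \<in> carrier A" using R by auto
    then show "\<ominus> x \<in> N" by (simp add: smult_neg_l)
  qed (use R in auto)
qed

lemma submodule_vimage: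
  assumes "linear_map A B f" "submodule N kh B"
  shows "submodule {x \<in> carrier A. f x \<in> N} kh A"
proof -
  interpret linear_map A B f by fact
  show ?thesis using assms(2) by (auto simp: A.submodule_iff B.submodule_iff)
qed

context kh_algebra
begin

lemma add_diff_diff: "x \<in> carrier A \<Longrightarrow> y \<in> carrier A \<Longrightarrow> (x \<oplus> y) \<ominus> x \<ominus> y = \<zero>"
  using r_neg[of "x \<oplus> y"] by (simp add: minus_eq minus_add a_assoc)

lemma submodule_carrier: "submodule (carrier A) kh A"
  by (auto simp: submodule_iff)

lemma submodule_zero: "submodule {\<zero>} kh A"
  by (auto simp: submodule_iff)

lemma submodule_span: assumes "S \<subseteq> carrier A" shows "submodule (submodule_span A S) kh A"
  using submodule_carrier assms unfolding submodule_span_def submodule_iff by blast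

lemma span_incl: "S \<subseteq> submodule_span A S"
  by (auto simp: submodule_span_def)

lemma span_minimal: "submodule N kh A \<Longrightarrow> S \<subseteq> N \<Longrightarrow> submodule_span A S \<subseteq> N"
  by (auto simp: submodule_span_def)

lemma linear_mult_left: "y \<in> carrier A \<Longrightarrow> (\<lambda>x. x \<otimes> y) \<in> linear_maps A A"
  by (rule linear_mapsI) (auto simp: l_distr smult_mult_left)

lemma linear_mult_right: "y \<in> carrier A \<Longrightarrow> (\<lambda>x. y \<otimes> x) \<in> linear_maps A A"
  by (rule linear_mapsI) (auto simp: r_distr smult_mult_right)

end

lemma monoid_alg_sel [simp]:
  "zero (monoid_alg G) = (\<lambda>x. 0)" "add (monoid_alg G) = (\<lambda>f g x. f x + g x)"
  "smult (monoid_alg G) = (\<lambda>c f x. c * f x)" "one (monoid_alg G) = single \<one>\<^bsub>G\<^esub>"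
  by (simp_all add: monoid_alg_def single_def fun_eq_iff)

lemma carrier_monoid_alg:
  "f \<in> carrier (monoid_alg G) \<longleftrightarrow> finite {x. f x \<noteq> 0} \<and> {x. f x \<noteq> 0} \<subseteq> carrier G"
  by (simp add: monoid_alg_def)

lemma single_carrier [simp]:
  "(single x :: 'x \<Rightarrow> 'k::field fps) \<in> carrier (monoid_alg G) \<longleftrightarrow> x \<in> carrier G"
proof -
  have "{y. (single x :: 'x \<Rightarrow> 'k fps) y \<noteq> 0} = {x}" by (auto simp: single_def)
  then show ?thesis by (simp add: carrier_monoid_alg)
qed

lemma monoid_alg_add_closed:
  assumes "f \<in> carrier (monoid_alg G)" "g \<in> carrier (monoid_alg G)"
  shows "(\<lambda>x. f x + g x) \<in> carrier (monoid_alg G)"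
proof -
  have "{x. f x + g x \<noteq> 0} \<subseteq> {x. f x \<noteq> 0} \<union> {x. g x \<noteq> 0}" by auto
  then show ?thesis using assms finite_subset unfolding carrier_monoid_alg by blast
qed

lemma monoid_alg_smult_closed:
  "f \<in> carrier (monoid_alg G) \<Longrightarrow> (\<lambda>x. c * f x) \<in> carrier (monoid_alg G)"
  unfolding carrier_monoid_alg by (auto elim: rev_finite_subset)

lemma monoid_alg_zero_closed: "(\<lambda>x. 0) \<in> carrier (monoid_alg G)"
  by (simp add: carrier_monoid_alg)

lemma monoid_alg_induct [consumes 1, case_names zero add]:
  assumes f: "f \<in> carrier (monoid_alg G)"
    and zero: "P (\<lambda>x. 0)"
    and add: "\<And>c x f. x \<in> carrier G \<Longrightarrow> f \<in> carrier (monoid_alg G) \<Longrightarrow> P f \<Longrightarrow> P (\<lambda>z. c * single x z + f z)"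
  shows "P f"
proof -
  have "finite {x. f x \<noteq> 0}" using f by (simp add: carrier_monoid_alg)
  moreover have "P f" if "finite S" "S = {x. f x \<noteq> 0}" "S \<subseteq> carrier G" for S f
    using that
  proof (induction S arbitrary: f rule: finite_induct)
    case empty
    then have "f = (\<lambda>x. 0)" by auto
    then show ?case using zero by simp
  next
    case (insert x S)
    define f' where "f' = (\<lambda>z. if z = x then 0 else f z)"
    have S: "S = {x. f' x \<noteq> 0}" using insert by (auto simp: f'_def)
    then have "P f'" using insert by auto
    moreover have "f' \<in> carrier (monoid_alg G)" using S insert by (auto simp: carrier_monoid_alg)
    ultimately have "P (\<lambda>z. f x * single x z + f' z)" using insert by (intro add) auto
    also have "(\<lambda>z. f x * single x z + f' z) = f" by (auto simp: fun_eq_iff f'_def single_def)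
    finally show ?case .
  qed
  ultimately show ?thesis using f by (auto simp: carrier_monoid_alg)
qed

text \<open>The product is summed over an arbitrary finite box containing the supports, so that
  products with different supports can be added over one index set.\<close>

lemma monoid_alg_mult_sum:
  assumes "finite X" "finite Y" "{x. f x \<noteq> 0} \<subseteq> X" "{x. g x \<noteq> 0} \<subseteq> Y"
  shows "(f \<otimes>\<^bsub>monoid_alg G\<^esub> g) z = (\<Sum>(x, y)\<in>X \<times> Y. if x \<otimes>\<^bsub>G\<^esub> y = z then f x * g y else 0)"
proof -
  have "(\<Sum>p\<in>X \<times> Y. if fst p \<otimes>\<^bsub>G\<^esub> snd p = z then f (fst p) * g (snd p) else 0)
      = (\<Sum>p\<in>{p. f (fst p) \<noteq> 0 \<and> g (snd p) \<noteq> 0 \<and> fst p \<otimes>\<^bsub>G\<^esub> snd p = z}. f (fst p) * g (snd p))"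
    using assms by (intro sum.mono_neutral_cong_right) auto
  then show ?thesis by (simp add: monoid_alg_def case_prod_unfold)
qed

text \<open>The shape \<open>c * f x + f' x\<close> combines additivity with homogeneity and is the
  shape produced by the induction over supports.\<close>

lemma
  assumes "f \<in> carrier (monoid_alg G)" "f' \<in> carrier (monoid_alg G)" "g \<in> carrier (monoid_alg G)"
  shows monoid_alg_l_distr: "(\<lambda>x. c * f x + f' x) \<otimes>\<^bsub>monoid_alg G\<^esub> g
      = (\<lambda>z. c * (f \<otimes>\<^bsub>monoid_alg G\<^esub> g) z + (f' \<otimes>\<^bsub>monoid_alg G\<^esub> g) z)" (is "?L")
    and monoid_alg_r_distr: "g \<otimes>\<^bsub>monoid_alg G\<^esub> (\<lambda>x. c * f x + f' x)
      = (\<lambda>z. c * (g \<otimes>\<^bsub>monoid_alg G\<^esub> f) z + (g \<otimes>\<^bsub>monoid_alg G\<^esub> f') z)" (is "?R")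
proof -
  let ?X = "{x. f x \<noteq> 0} \<union> {x. f' x \<noteq> 0}" and ?Y = "{x. g x \<noteq> 0}"
  have fin: "finite ?X" "finite ?Y" using assms by (auto simp: carrier_monoid_alg)
  note l = monoid_alg_mult_sum[OF fin] and r = monoid_alg_mult_sum[OF fin(2,1)]
  have sub: "{x. c * f x + f' x \<noteq> 0} \<subseteq> ?X" "{x. f x \<noteq> 0} \<subseteq> ?X" "{x. f' x \<noteq> 0} \<subseteq> ?X" by auto
  show ?L
    by (rule ext, simp only: l[OF sub(1) order_refl] l[OF sub(2) order_refl] l[OF sub(3) order_refl])
      (auto simp: sum_distrib_left sum.distrib[symmetric] algebra_simps intro!: sum.cong)
  show ?R
    by (rule ext, simp only: r[OF order_refl sub(1)] r[OF order_refl sub(2)] r[OF order_refl sub(3)])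
      (auto simp: sum_distrib_left sum.distrib[symmetric] algebra_simps intro!: sum.cong)
qed

lemma monoid_alg_single_mult:
  "single x \<otimes>\<^bsub>monoid_alg G\<^esub> single y = (single (x \<otimes>\<^bsub>G\<^esub> y) :: _ \<Rightarrow> 'k::field fps)"
proof
  fix z
  show "(single x \<otimes>\<^bsub>monoid_alg G\<^esub> single y) z = (single (x \<otimes>\<^bsub>G\<^esub> y) z :: 'k fps)"
    by (subst monoid_alg_mult_sum[of "{x}" "{y}"]) (auto simp: single_def)
qed

lemma monoid_alg_zero_mult:
  "(\<lambda>x. 0) \<otimes>\<^bsub>monoid_alg G\<^esub> g = (\<lambda>x. 0 :: 'k::field fps)" "g \<otimes>\<^bsub>monoid_alg G\<^esub> (\<lambda>x. 0) = (\<lambda>x. 0 :: 'k fps)"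
  by (auto simp: monoid_alg_def)

lemma monoid_alg_mult_closed:
  assumes G: "monoid G" and f: "f \<in> carrier (monoid_alg G)" and g: "g \<in> carrier (monoid_alg G)"
  shows "f \<otimes>\<^bsub>monoid_alg G\<^esub> g \<in> carrier (monoid_alg G)"
  using f
proof (induction rule: monoid_alg_induct)
  case (add c x f)
  have "single x \<otimes>\<^bsub>monoid_alg G\<^esub> g \<in> carrier (monoid_alg G)"
    using g
    by (induction rule: monoid_alg_induct)
      (use add(1) monoid.m_closed[OF G] in \<open>simp_all add: monoid_alg_zero_mult monoid_alg_zero_closed
          monoid_alg_r_distr monoid_alg_single_mult monoid_alg_add_closed monoid_alg_smult_closed\<close>)
  with add g show ?case
    by (simp add: monoid_alg_l_distr monoid_alg_add_closed monoid_alg_smult_closed)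
qed (simp add: monoid_alg_zero_mult monoid_alg_zero_closed)

lemma kh_algebra_monoid_alg:
  assumes G: "monoid G" shows "kh_algebra (monoid_alg G :: ('k::field fps, 'x \<Rightarrow> 'k fps) module)"
proof -
  interpret monoid G by fact
  let ?M = "monoid_alg G :: ('k fps, 'x \<Rightarrow> 'k fps) module"
  note cl = monoid_alg_mult_closed[OF G]
  \<comment> \<open>Associativity is reduced to the monoid in three stages: with two, then one, then
    no factor restricted to a basis element.\<close>
  have ss: "(single x \<otimes>\<^bsub>?M\<^esub> single y) \<otimes>\<^bsub>?M\<^esub> h = single x \<otimes>\<^bsub>?M\<^esub> (single y \<otimes>\<^bsub>?M\<^esub> h)"
    if "x \<in> carrier G" "y \<in> carrier G" "h \<in> carrier ?M" for x y h
    using that(3)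
    by (induction rule: monoid_alg_induct)
      (use that in \<open>simp_all add: monoid_alg_zero_mult monoid_alg_r_distr monoid_alg_single_mult m_assoc cl\<close>)
  have s: "(single x \<otimes>\<^bsub>?M\<^esub> g) \<otimes>\<^bsub>?M\<^esub> h = single x \<otimes>\<^bsub>?M\<^esub> (g \<otimes>\<^bsub>?M\<^esub> h)"
    if "x \<in> carrier G" "g \<in> carrier ?M" "h \<in> carrier ?M" for x g h
    using that(2)
    by (induction rule: monoid_alg_induct)
      (use that in \<open>simp_all add: monoid_alg_zero_mult monoid_alg_r_distr monoid_alg_l_distr ss cl\<close>)
  have assoc: "(f \<otimes>\<^bsub>?M\<^esub> g) \<otimes>\<^bsub>?M\<^esub> h = f \<otimes>\<^bsub>?M\<^esub> (g \<otimes>\<^bsub>?M\<^esub> h)"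
    if "f \<in> carrier ?M" "g \<in> carrier ?M" "h \<in> carrier ?M" for f g h
    using that(1)
    by (induction rule: monoid_alg_induct)
      (use that in \<open>simp_all add: monoid_alg_zero_mult monoid_alg_l_distr s cl\<close>)
  have l_one: "single \<one>\<^bsub>G\<^esub> \<otimes>\<^bsub>?M\<^esub> f = f" and r_one: "f \<otimes>\<^bsub>?M\<^esub> single \<one>\<^bsub>G\<^esub> = f" if "f \<in> carrier ?M" for f
    using that
    by (induction rule: monoid_alg_induct)
      (simp_all add: monoid_alg_zero_mult monoid_alg_r_distr monoid_alg_l_distr monoid_alg_single_mult)
  have distr: "(\<lambda>x. f x + f' x) \<otimes>\<^bsub>?M\<^esub> g = (\<lambda>z. (f \<otimes>\<^bsub>?M\<^esub> g) z + (f' \<otimes>\<^bsub>?M\<^esub> g) z)"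
    "g \<otimes>\<^bsub>?M\<^esub> (\<lambda>x. f x + f' x) = (\<lambda>z. (g \<otimes>\<^bsub>?M\<^esub> f) z + (g \<otimes>\<^bsub>?M\<^esub> f') z)"
    if "f \<in> carrier ?M" "f' \<in> carrier ?M" "g \<in> carrier ?M" for f f' g
    using monoid_alg_l_distr[OF that, of 1] monoid_alg_r_distr[OF that, of 1] by simp_all
  have sm: "(\<lambda>x. c * f x) \<otimes>\<^bsub>?M\<^esub> g = (\<lambda>z. c * (f \<otimes>\<^bsub>?M\<^esub> g) z)"
    "g \<otimes>\<^bsub>?M\<^esub> (\<lambda>x. c * f x) = (\<lambda>z. c * (g \<otimes>\<^bsub>?M\<^esub> f) z)"
    if "f \<in> carrier ?M" "g \<in> carrier ?M" for f g c
    using monoid_alg_l_distr[OF that(1) monoid_alg_zero_closed that(2), of c]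
      monoid_alg_r_distr[OF that(1) monoid_alg_zero_closed that(2), of c]
    by (simp_all add: monoid_alg_zero_mult)
  show ?thesis
    by (rule kh_algebraI; (simp only: monoid_alg_sel)?)
      (simp_all add: monoid_alg_zero_closed monoid_alg_add_closed monoid_alg_smult_closed
        cl assoc l_one r_one distr sm algebra_simps)
qed

lemma monoid_alg_minus:
  assumes "monoid G" "f \<in> carrier (monoid_alg G)" "g \<in> carrier (monoid_alg G)"
  shows "f \<ominus>\<^bsub>monoid_alg G\<^esub> g = (\<lambda>x. f x - (g x :: 'k::field fps))"
proof -
  interpret kh_algebra "monoid_alg G" by (rule kh_algebra_monoid_alg[OF assms(1)])
  have "\<ominus>\<^bsub>monoid_alg G\<^esub> g = (\<lambda>x. - g x)"
    using smult_neg_l[OF assms(3), of 1] by simp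
  then show ?thesis by (simp add: a_minus_def)
qed

lemma submodule_monoid_alg:
  assumes G: "monoid G" and N: "submodule N kh (monoid_alg G)"
    and s: "\<And>x. x \<in> carrier G \<Longrightarrow> single x \<in> N" and f: "f \<in> carrier (monoid_alg G)"
  shows "f \<in> N"
proof -
  interpret kh_algebra "monoid_alg G" by (rule kh_algebra_monoid_alg[OF G])
  have N': "(\<lambda>x. 0) \<in> N" "\<And>x y. x \<in> N \<Longrightarrow> y \<in> N \<Longrightarrow> (\<lambda>z. x z + y z) \<in> N" "\<And>x c. x \<in> N \<Longrightarrow> (\<lambda>z. c * x z) \<in> N"
    using N by (auto simp: submodule_iff)
  show ?thesis using f by (induction rule: monoid_alg_induct) (auto intro!: N' s)
qed

lemma linear_maps_monoid_alg_eqI: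
  assumes G: "monoid G" and C: "kh_algebra C"
    and f: "f \<in> linear_maps (monoid_alg G) C" and g: "g \<in> linear_maps (monoid_alg G) C"
    and eq: "\<And>x. x \<in> carrier G \<Longrightarrow> f (single x) = g (single x)"
    and h: "h \<in> carrier (monoid_alg G)"
  shows "f h = g h"
proof -
  interpret M: kh_algebra "monoid_alg G" by (rule kh_algebra_monoid_alg[OF G])
  interpret f: linear_map "monoid_alg G" C f by (rule linear_mapI[OF M.kh_algebra_axioms C f])
  interpret g: linear_map "monoid_alg G" C g by (rule linear_mapI[OF M.kh_algebra_axioms C g])
  have "submodule {x \<in> carrier (monoid_alg G). f x = g x} kh (monoid_alg G)"
    using f.zero g.zero f.add g.add f.smult g.smult M.a_closed M.smult_closed' M.zero_closed
    unfolding M.submodule_iff by auto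
  from submodule_monoid_alg[OF G this _ h] eq show ?thesis by simp
qed

section \<open>Linear extension from a basis\<close>

definition lin_ext :: "('k::field fps, 'c) module \<Rightarrow> ('x \<Rightarrow> 'c) \<Rightarrow> ('x \<Rightarrow> 'k fps) \<Rightarrow> 'c" where
  "lin_ext C \<rho> f = (\<Oplus>\<^bsub>C\<^esub>x\<in>{x. f x \<noteq> 0}. f x \<odot>\<^bsub>C\<^esub> \<rho> x)"

lemma
  fixes C :: "('k::field fps, 'c) module" and G :: "('x, 'm) monoid_scheme"
  assumes C: "kh_algebra C" and \<rho>: "\<And>x. x \<in> carrier G \<Longrightarrow> \<rho> x \<in> carrier C"
  shows lin_ext_linear: "lin_ext C \<rho> \<in> linear_maps (monoid_alg G) C"
    and lin_ext_single: "x \<in> carrier G \<Longrightarrow> lin_ext C \<rho> (single x) = \<rho> x"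
proof -
  interpret kh_algebra C by fact
  \<comment> \<open>The sum may be enlarged to any finite set containing the support, which makes
    sums for different elements comparable.\<close>
  have sup: "lin_ext C \<rho> f = (\<Oplus>\<^bsub>C\<^esub>x\<in>S. f x \<odot>\<^bsub>C\<^esub> \<rho> x)"
    if "finite S" "{x. f x \<noteq> 0} \<subseteq> S" "S \<subseteq> carrier G" for f S
    unfolding lin_ext_def using that \<rho> by (intro add.finprod_mono_neutral_cong_left) auto
  show "lin_ext C \<rho> \<in> linear_maps (monoid_alg G) C"
  proof (rule linear_mapsI; (simp only: monoid_alg_sel)?)
    fix f g :: "'x \<Rightarrow> 'k fps"
    assume fg: "f \<in> carrier (monoid_alg G)" "g \<in> carrier (monoid_alg G)"
    let ?S = "{x. f x \<noteq> 0} \<union> {x. g x \<noteq> 0}"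
    have S: "finite ?S" "?S \<subseteq> carrier G" using fg by (auto simp: carrier_monoid_alg)
    have "lin_ext C \<rho> (\<lambda>x. f x + g x) = (\<Oplus>\<^bsub>C\<^esub>x\<in>?S. f x \<odot>\<^bsub>C\<^esub> \<rho> x \<oplus>\<^bsub>C\<^esub> g x \<odot>\<^bsub>C\<^esub> \<rho> x)"
      using S(2) \<rho> by (subst sup[OF S(1) _ S(2)]) (auto intro!: finsum_cong' smult_l)
    also have "\<dots> = lin_ext C \<rho> f \<oplus>\<^bsub>C\<^esub> lin_ext C \<rho> g"
      using S(2) \<rho> by (subst (1 2) sup[OF S(1) _ S(2)]) (auto intro!: finsum_addf)
    finally show "lin_ext C \<rho> (\<lambda>x. f x + g x) = lin_ext C \<rho> f \<oplus>\<^bsub>C\<^esub> lin_ext C \<rho> g" .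
  next
    fix c and f :: "'x \<Rightarrow> 'k fps"
    assume f: "f \<in> carrier (monoid_alg G)"
    let ?S = "{x. f x \<noteq> 0}"
    have S: "finite ?S" "?S \<subseteq> carrier G" using f by (auto simp: carrier_monoid_alg)
    have "lin_ext C \<rho> (\<lambda>x. c * f x) = (\<Oplus>\<^bsub>C\<^esub>x\<in>?S. c \<odot>\<^bsub>C\<^esub> (f x \<odot>\<^bsub>C\<^esub> \<rho> x))"
      using S(2) \<rho> by (subst sup[OF S(1) _ S(2)]) (auto intro!: finsum_cong' simp: smult_smult)
    also have "\<dots> = c \<odot>\<^bsub>C\<^esub> lin_ext C \<rho> f"
      unfolding lin_ext_def using S(2) \<rho> by (intro smult_finsum[symmetric]) auto
    finally show "lin_ext C \<rho> (\<lambda>x. c * f x) = c \<odot>\<^bsub>C\<^esub> lin_ext C \<rho> f" .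
  next
    fix f :: "'x \<Rightarrow> 'k fps"
    assume "f \<in> carrier (monoid_alg G)"
    then show "lin_ext C \<rho> f \<in> carrier C"
      unfolding lin_ext_def using \<rho> by (intro finsum_closed) (auto simp: carrier_monoid_alg)
  qed
  show "lin_ext C \<rho> (single x) = \<rho> x" if "x \<in> carrier G"
    using that \<rho> by (subst sup[of "{x}"]) (auto simp: single_def)
qed

lemma lin_ext_alg_hom:
  assumes G: "monoid G" and C: "kh_algebra C" and \<rho>: "\<And>x. x \<in> carrier G \<Longrightarrow> \<rho> x \<in> carrier C"
    and mult: "\<And>x y. x \<in> carrier G \<Longrightarrow> y \<in> carrier G \<Longrightarrow> \<rho> (x \<otimes>\<^bsub>G\<^esub> y) = \<rho> x \<otimes>\<^bsub>C\<^esub> \<rho> y"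
    and one: "\<rho> \<one>\<^bsub>G\<^esub> = \<one>\<^bsub>C\<^esub>"
  shows "lin_ext C \<rho> \<in> alg_homs (monoid_alg G) C"
proof (rule alg_homsI)
  let ?M = "monoid_alg G"
  interpret G: monoid G by fact
  interpret C: kh_algebra C by fact
  interpret M: kh_algebra ?M by (rule kh_algebra_monoid_alg[OF G])
  show lin: "lin_ext C \<rho> \<in> linear_maps ?M C" by (rule lin_ext_linear[OF C \<rho>])
  note single = lin_ext_single[OF C \<rho>]
  note cl = linear_maps_closed[OF lin]
  have s: "lin_ext C \<rho> (single x \<otimes>\<^bsub>?M\<^esub> g) = \<rho> x \<otimes>\<^bsub>C\<^esub> lin_ext C \<rho> g"
    if x: "x \<in> carrier G" and g: "g \<in> carrier ?M" for x g
    by (rule linear_maps_monoid_alg_eqI[OF G C _ _ _ g],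
        rule linear_maps_comp[OF M.linear_mult_right lin], simp add: x,
        rule linear_maps_comp[OF lin C.linear_mult_right], rule \<rho>[OF x])
      (use x in \<open>simp add: monoid_alg_single_mult single mult\<close>)
  show "lin_ext C \<rho> (f \<otimes>\<^bsub>?M\<^esub> g) = lin_ext C \<rho> f \<otimes>\<^bsub>C\<^esub> lin_ext C \<rho> g"
    if f: "f \<in> carrier ?M" and g: "g \<in> carrier ?M" for f g
    by (rule linear_maps_monoid_alg_eqI[OF G C _ _ _ f],
        rule linear_maps_comp[OF M.linear_mult_left lin], rule g,
        rule linear_maps_comp[OF lin C.linear_mult_left], rule cl[OF g])
      (use g in \<open>simp add: single s\<close>)
  show "lin_ext C \<rho> \<one>\<^bsub>?M\<^esub> = \<one>\<^bsub>C\<^esub>" by (simp add: single one)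
qed

subsection \<open>Tensor products\<close>

definition bilinear_maps ::
  "('k::field fps, 'a) module \<Rightarrow> ('k fps, 'b) module \<Rightarrow> ('k fps, 'c) module \<Rightarrow> ('a \<Rightarrow> 'b \<Rightarrow> 'c) set" where
  "bilinear_maps A B C = {\<beta>. (\<forall>b\<in>carrier B. (\<lambda>a. \<beta> a b) \<in> linear_maps A C) \<and>
     (\<forall>a\<in>carrier A. \<beta> a \<in> linear_maps B C)}"

lemma bilinear_mapsI:
  assumes "\<And>b. b \<in> carrier B \<Longrightarrow> (\<lambda>a. \<beta> a b) \<in> linear_maps A C"
    and "\<And>a. a \<in> carrier A \<Longrightarrow> (\<lambda>b. \<beta> a b) \<in> linear_maps B C"
  shows "\<beta> \<in> bilinear_maps A B C"
  using assms by (auto simp: bilinear_maps_def)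

lemma bilinear_mapsD:
  assumes "\<beta> \<in> bilinear_maps A B C"
  shows "b \<in> carrier B \<Longrightarrow> (\<lambda>a. \<beta> a b) \<in> linear_maps A C"
    and "a \<in> carrier A \<Longrightarrow> (\<lambda>b. \<beta> a b) \<in> linear_maps B C"
  using assms by (auto simp: bilinear_maps_def)

abbreviation bilinear_span ::
  "('k::field fps, 'a) module \<Rightarrow> ('k fps, 'b) module \<Rightarrow> ('a \<times> 'b \<Rightarrow> 'k fps) set" where
  "bilinear_span A B \<equiv> submodule_span (monoid_alg (A \<times>\<times> B)) (bilinear_relators A B)"

locale tensor_prod = A: kh_algebra A + B: kh_algebra B
  for A :: "('k::field fps, 'a) module" and B :: "('k fps, 'b) module"
begin

abbreviation "M \<equiv> monoid_alg (A \<times>\<times> B) :: ('k fps, 'a \<times> 'b \<Rightarrow> 'k fps) module"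

lemma monoid_prod: "monoid (A \<times>\<times> B)"
  by (rule DirProd_monoid[OF A.is_monoid B.is_monoid])

sublocale M: kh_algebra M
  by (rule kh_algebra_monoid_alg[OF monoid_prod])

text \<open>The relators are defined by pointwise subtraction of functions; as differences in the
  ring \<open>M\<close> they become accessible to distributivity and to linear maps.\<close>

lemma bilinear_relators_eq:
  "bilinear_relators A B =
     {single (a \<oplus>\<^bsub>A\<^esub> a', b) \<ominus>\<^bsub>M\<^esub> single (a, b) \<ominus>\<^bsub>M\<^esub> single (a', b) | a a' b.
        a \<in> carrier A \<and> a' \<in> carrier A \<and> b \<in> carrier B} \<union>
     {single (a, b \<oplus>\<^bsub>B\<^esub> b') \<ominus>\<^bsub>M\<^esub> single (a, b) \<ominus>\<^bsub>M\<^esub> single (a, b') | a b b'.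
        a \<in> carrier A \<and> b \<in> carrier B \<and> b' \<in> carrier B} \<union>
     {single (c \<odot>\<^bsub>A\<^esub> a, b) \<ominus>\<^bsub>M\<^esub> c \<odot>\<^bsub>M\<^esub> single (a, b) | c a b.
        a \<in> carrier A \<and> b \<in> carrier B} \<union>
     {single (a, c \<odot>\<^bsub>B\<^esub> b) \<ominus>\<^bsub>M\<^esub> c \<odot>\<^bsub>M\<^esub> single (a, b) | c a b.
        a \<in> carrier A \<and> b \<in> carrier B}" (is "_ = ?S1 \<union> ?S2 \<union> ?S3 \<union> ?S4")
proof -
  have m: "f \<ominus>\<^bsub>M\<^esub> g = (\<lambda>x. f x - g x)" if "f \<in> carrier M" "g \<in> carrier M" for f g
    by (rule monoid_alg_minus[OF monoid_prod that])
  have m2: "single p \<ominus>\<^bsub>M\<^esub> single q \<ominus>\<^bsub>M\<^esub> single r = (\<lambda>z. single p z - single q z - single r z)"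
    if "p \<in> carrier (A \<times>\<times> B)" "q \<in> carrier (A \<times>\<times> B)" "r \<in> carrier (A \<times>\<times> B)" for p q r
  proof -
    have "single p \<ominus>\<^bsub>M\<^esub> single q \<in> carrier M"
      using that by (intro M.minus_closed) (simp_all only: single_carrier)
    then show ?thesis using m[of "single p \<ominus>\<^bsub>M\<^esub> single q" "single r"] m[of "single p" "single q"] that
      by (simp only: single_carrier)
  qed
  have m3: "single p \<ominus>\<^bsub>M\<^esub> c \<odot>\<^bsub>M\<^esub> single q = (\<lambda>z. single p z - c * single q z)"
    if "p \<in> carrier (A \<times>\<times> B)" "q \<in> carrier (A \<times>\<times> B)" for p q c
    using m[of "single p" "c \<odot>\<^bsub>M\<^esub> single q"] M.smult_closed'[of "single q" c] that by simp
  show ?thesis unfolding bilinear_relators_def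
    by (intro arg_cong2[of _ _ _ _ "(\<union>)"] Collect_cong ex_cong1 rev_conj_cong arg_cong2[of _ _ _ _ "(=)"] refl)
      (auto simp: m2 m3 simp del: monoid_alg_sel)
qed

lemma bilinear_relatorsI:
  "a \<in> carrier A \<Longrightarrow> a' \<in> carrier A \<Longrightarrow> b \<in> carrier B \<Longrightarrow>
    single (a \<oplus>\<^bsub>A\<^esub> a', b) \<ominus>\<^bsub>M\<^esub> single (a, b) \<ominus>\<^bsub>M\<^esub> single (a', b) \<in> bilinear_relators A B"
  "a \<in> carrier A \<Longrightarrow> b \<in> carrier B \<Longrightarrow> b' \<in> carrier B \<Longrightarrow>
    single (a, b \<oplus>\<^bsub>B\<^esub> b') \<ominus>\<^bsub>M\<^esub> single (a, b) \<ominus>\<^bsub>M\<^esub> single (a, b') \<in> bilinear_relators A B"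
  "a \<in> carrier A \<Longrightarrow> b \<in> carrier B \<Longrightarrow>
    single (c \<odot>\<^bsub>A\<^esub> a, b) \<ominus>\<^bsub>M\<^esub> c \<odot>\<^bsub>M\<^esub> single (a, b) \<in> bilinear_relators A B"
  "a \<in> carrier A \<Longrightarrow> b \<in> carrier B \<Longrightarrow>
    single (a, c \<odot>\<^bsub>B\<^esub> b) \<ominus>\<^bsub>M\<^esub> c \<odot>\<^bsub>M\<^esub> single (a, b) \<in> bilinear_relators A B"
  unfolding bilinear_relators_eq by blast+

lemma bilinear_relators_cases:
  assumes "r \<in> bilinear_relators A B"
  obtains (1) a a' b where "r = single (a \<oplus>\<^bsub>A\<^esub> a', b) \<ominus>\<^bsub>M\<^esub> single (a, b) \<ominus>\<^bsub>M\<^esub> single (a', b)"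
      "a \<in> carrier A" "a' \<in> carrier A" "b \<in> carrier B"
    | (2) a b b' where "r = single (a, b \<oplus>\<^bsub>B\<^esub> b') \<ominus>\<^bsub>M\<^esub> single (a, b) \<ominus>\<^bsub>M\<^esub> single (a, b')"
      "a \<in> carrier A" "b \<in> carrier B" "b' \<in> carrier B"
    | (3) a b c where "r = single (c \<odot>\<^bsub>A\<^esub> a, b) \<ominus>\<^bsub>M\<^esub> c \<odot>\<^bsub>M\<^esub> single (a, b)"
      "a \<in> carrier A" "b \<in> carrier B"
    | (4) a b c where "r = single (a, c \<odot>\<^bsub>B\<^esub> b) \<ominus>\<^bsub>M\<^esub> c \<odot>\<^bsub>M\<^esub> single (a, b)"
      "a \<in> carrier A" "b \<in> carrier B"
proof -
  from assms show thesis
    unfolding bilinear_relators_eq Un_iff mem_Collect_eq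
    apply (elim disjE exE conjE)
    subgoal by (rule 1)
    subgoal by (rule 2)
    subgoal by (rule 3)
    subgoal by (rule 4)
    done
qed

lemma bilinear_relators_carrier: "bilinear_relators A B \<subseteq> carrier M"
  unfolding bilinear_relators_eq by (auto simp del: monoid_alg_sel)

lemma span_submodule: "submodule (bilinear_span A B) kh M"
  by (rule M.submodule_span[OF bilinear_relators_carrier])

text \<open>A relator times a basis element \<open>(x, y)\<close>, on either side, is again a
  relator, because multiplication by \<open>x\<close> and by \<open>y\<close> is linear in each
  factor. Linearity extends this to arbitrary multipliers and then to the whole span. Hence the
  convolution product descends to the tensor product.\<close>

lemma span_ideal: "ideal (bilinear_span A B) M"
proof -
  let ?N = "bilinear_span A B"
  note [simp del] = monoid_alg_sel
  have rs: "r \<otimes>\<^bsub>M\<^esub> single p \<in> bilinear_relators A B"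
    if r: "r \<in> bilinear_relators A B" and p: "p \<in> carrier (A \<times>\<times> B)" for r p
  proof -
    obtain x y where p: "p = (x, y)" "x \<in> carrier A" "y \<in> carrier B" using p by auto
    show ?thesis
      using r
    proof (cases rule: bilinear_relators_cases)
      case (1 a a' b)
      then show ?thesis using p bilinear_relatorsI(1)[of "a \<otimes>\<^bsub>A\<^esub> x" "a' \<otimes>\<^bsub>A\<^esub> x" "b \<otimes>\<^bsub>B\<^esub> y"]
        by (simp add: M.l_diff_distr M.smult_mult_left monoid_alg_single_mult A.l_distr B.l_distr A.smult_mult_left B.smult_mult_left)
    next
      case (2 a b b')
      then show ?thesis using p bilinear_relatorsI(2)[of "a \<otimes>\<^bsub>A\<^esub> x" "b \<otimes>\<^bsub>B\<^esub> y" "b' \<otimes>\<^bsub>B\<^esub> y"]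
        by (simp add: M.l_diff_distr M.smult_mult_left monoid_alg_single_mult A.l_distr B.l_distr A.smult_mult_left B.smult_mult_left)
    next
      case (3 a b c)
      then show ?thesis using p bilinear_relatorsI(3)[of "a \<otimes>\<^bsub>A\<^esub> x" "b \<otimes>\<^bsub>B\<^esub> y" c]
        by (simp add: M.l_diff_distr M.smult_mult_left monoid_alg_single_mult A.l_distr B.l_distr A.smult_mult_left B.smult_mult_left)
    next
      case (4 a b c)
      then show ?thesis using p bilinear_relatorsI(4)[of "a \<otimes>\<^bsub>A\<^esub> x" "b \<otimes>\<^bsub>B\<^esub> y" c]
        by (simp add: M.l_diff_distr M.smult_mult_left monoid_alg_single_mult A.l_distr B.l_distr A.smult_mult_left B.smult_mult_left)
    qed
  qed
  have ls: "single p \<otimes>\<^bsub>M\<^esub> r \<in> bilinear_relators A B"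
    if r: "r \<in> bilinear_relators A B" and p: "p \<in> carrier (A \<times>\<times> B)" for r p
  proof -
    obtain x y where p: "p = (x, y)" "x \<in> carrier A" "y \<in> carrier B" using p by auto
    show ?thesis
      using r
    proof (cases rule: bilinear_relators_cases)
      case (1 a a' b)
      then show ?thesis using p bilinear_relatorsI(1)[of "x \<otimes>\<^bsub>A\<^esub> a" "x \<otimes>\<^bsub>A\<^esub> a'" "y \<otimes>\<^bsub>B\<^esub> b"]
        by (simp add: M.r_diff_distr M.smult_mult_right monoid_alg_single_mult A.r_distr B.r_distr A.smult_mult_right B.smult_mult_right)
    next
      case (2 a b b')
      then show ?thesis using p bilinear_relatorsI(2)[of "x \<otimes>\<^bsub>A\<^esub> a" "y \<otimes>\<^bsub>B\<^esub> b" "y \<otimes>\<^bsub>B\<^esub> b'"]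
        by (simp add: M.r_diff_distr M.smult_mult_right monoid_alg_single_mult A.r_distr B.r_distr A.smult_mult_right B.smult_mult_right)
    next
      case (3 a b c)
      then show ?thesis using p bilinear_relatorsI(3)[of "x \<otimes>\<^bsub>A\<^esub> a" "y \<otimes>\<^bsub>B\<^esub> b" c]
        by (simp add: M.r_diff_distr M.smult_mult_right monoid_alg_single_mult A.r_distr B.r_distr A.smult_mult_right B.smult_mult_right)
    next
      case (4 a b c)
      then show ?thesis using p bilinear_relatorsI(4)[of "x \<otimes>\<^bsub>A\<^esub> a" "y \<otimes>\<^bsub>B\<^esub> b" c]
        by (simp add: M.r_diff_distr M.smult_mult_right monoid_alg_single_mult A.r_distr B.r_distr A.smult_mult_right B.smult_mult_right)
    qed
  qed
  have sub: "submodule {x \<in> carrier M. f x \<in> ?N} kh M" if "f \<in> linear_maps M M" for f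
    by (rule submodule_vimage[OF linear_mapI[OF M.kh_algebra_axioms M.kh_algebra_axioms that] span_submodule])
  have N: "?N \<subseteq> carrier M" using span_submodule by (simp add: M.submodule_iff)
  have r1: "r \<otimes>\<^bsub>M\<^esub> m \<in> ?N" if r: "r \<in> bilinear_relators A B" and m: "m \<in> carrier M" for r m
    using submodule_monoid_alg[OF monoid_prod sub[OF M.linear_mult_right] _ m] r rs
      M.span_incl bilinear_relators_carrier by (auto simp: subset_iff)
  have l1: "m \<otimes>\<^bsub>M\<^esub> r \<in> ?N" if r: "r \<in> bilinear_relators A B" and m: "m \<in> carrier M" for r m
    using submodule_monoid_alg[OF monoid_prod sub[OF M.linear_mult_left] _ m] r ls
      M.span_incl bilinear_relators_carrier by (auto simp: subset_iff)
  have r2: "r \<otimes>\<^bsub>M\<^esub> m \<in> ?N" if r: "r \<in> ?N" and m: "m \<in> carrier M" for r m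
    using M.span_minimal[OF sub[OF M.linear_mult_left[OF m]], of "bilinear_relators A B"] r r1 m
      bilinear_relators_carrier by (auto simp: subset_iff)
  have l2: "m \<otimes>\<^bsub>M\<^esub> r \<in> ?N" if r: "r \<in> ?N" and m: "m \<in> carrier M" for r m
    using M.span_minimal[OF sub[OF M.linear_mult_right[OF m]], of "bilinear_relators A B"] r l1 m
      bilinear_relators_carrier by (auto simp: subset_iff)
  show ?thesis
    by (rule idealI[OF M.ring_axioms submodule.axioms(1)[OF span_submodule]]) (auto intro: r2 l2)
qed

lemma kh_algebra_tensor: "kh_algebra (tensor A B)"
  unfolding tensor_def by (rule kh_algebra_quot[OF M.kh_algebra_axioms span_ideal])

lemma tensor_proj: "alg_hom M (tensor A B) ((+>\<^bsub>M\<^esub>) (bilinear_span A B))"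
  using kh_algebra_tensor unfolding tensor_def
  by (intro alg_homI rcos_alg_hom M.kh_algebra_axioms span_ideal)

sublocale T: kh_algebra "tensor A B" by (rule kh_algebra_tensor)

lemma tensor_elem_bilinear: "tensor_elem A B \<in> bilinear_maps A B (tensor A B)"
proof -
  interpret p: alg_hom M "tensor A B" "(+>\<^bsub>M\<^esub>) (bilinear_span A B)" by (rule tensor_proj)
  note [simp del] = monoid_alg_sel
  have eq: "bilinear_span A B +>\<^bsub>M\<^esub> x = bilinear_span A B +>\<^bsub>M\<^esub> y"
    if "x \<ominus>\<^bsub>M\<^esub> y \<in> bilinear_relators A B" "x \<in> carrier M" "y \<in> carrier M" for x y
    using that M.span_incl by (auto simp: M.rcos_eq_iff[OF span_ideal])
  have eq3: "bilinear_span A B +>\<^bsub>M\<^esub> single p = bilinear_span A B +>\<^bsub>M\<^esub> (single q \<oplus>\<^bsub>M\<^esub> single r)"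
    if "single p \<ominus>\<^bsub>M\<^esub> single q \<ominus>\<^bsub>M\<^esub> single r \<in> bilinear_relators A B"
      "p \<in> carrier (A \<times>\<times> B)" "q \<in> carrier (A \<times>\<times> B)" "r \<in> carrier (A \<times>\<times> B)" for p q r
  proof (rule eq)
    show "single p \<ominus>\<^bsub>M\<^esub> (single q \<oplus>\<^bsub>M\<^esub> single r) \<in> bilinear_relators A B"
      using that by (simp add: M.minus_eq M.minus_add M.a_assoc)
  qed (use that in simp_all)
  show ?thesis
  proof (intro bilinear_mapsI linear_mapsI)
    fix a a' b assume *: "a \<in> carrier A" "a' \<in> carrier A" "b \<in> carrier B"
    then have "single (a \<oplus>\<^bsub>A\<^esub> a', b) \<ominus>\<^bsub>M\<^esub> single (a, b) \<ominus>\<^bsub>M\<^esub> single (a', b) \<in> bilinear_relators A B"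
      by (rule bilinear_relatorsI)
    from eq3[OF this] * show "tensor_elem A B (a \<oplus>\<^bsub>A\<^esub> a') b = tensor_elem A B a b \<oplus>\<^bsub>tensor A B\<^esub> tensor_elem A B a' b"
      by (simp add: tensor_elem_def)
  next
    fix a b b' assume *: "a \<in> carrier A" "b \<in> carrier B" "b' \<in> carrier B"
    then have "single (a, b \<oplus>\<^bsub>B\<^esub> b') \<ominus>\<^bsub>M\<^esub> single (a, b) \<ominus>\<^bsub>M\<^esub> single (a, b') \<in> bilinear_relators A B"
      by (rule bilinear_relatorsI)
    from eq3[OF this] * show "tensor_elem A B a (b \<oplus>\<^bsub>B\<^esub> b') = tensor_elem A B a b \<oplus>\<^bsub>tensor A B\<^esub> tensor_elem A B a b'"
      by (simp add: tensor_elem_def)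
  next
    fix a b c assume *: "a \<in> carrier A" "b \<in> carrier B"
    then have "single (c \<odot>\<^bsub>A\<^esub> a, b) \<ominus>\<^bsub>M\<^esub> c \<odot>\<^bsub>M\<^esub> single (a, b) \<in> bilinear_relators A B"
      "single (a, c \<odot>\<^bsub>B\<^esub> b) \<ominus>\<^bsub>M\<^esub> c \<odot>\<^bsub>M\<^esub> single (a, b) \<in> bilinear_relators A B"
      by (rule bilinear_relatorsI; simp)+
    from this[THEN eq] * show "tensor_elem A B (c \<odot>\<^bsub>A\<^esub> a) b = c \<odot>\<^bsub>tensor A B\<^esub> tensor_elem A B a b"
      "tensor_elem A B a (c \<odot>\<^bsub>B\<^esub> b) = c \<odot>\<^bsub>tensor A B\<^esub> tensor_elem A B a b"
      by (simp_all add: tensor_elem_def)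
  qed (simp_all add: tensor_elem_def)
qed

lemma tensor_elem_mult:
  assumes "a \<in> carrier A" "a' \<in> carrier A" "b \<in> carrier B" "b' \<in> carrier B"
  shows "tensor_elem A B a b \<otimes>\<^bsub>tensor A B\<^esub> tensor_elem A B a' b' = tensor_elem A B (a \<otimes>\<^bsub>A\<^esub> a') (b \<otimes>\<^bsub>B\<^esub> b')"
proof -
  interpret p: alg_hom M "tensor A B" "(+>\<^bsub>M\<^esub>) (bilinear_span A B)" by (rule tensor_proj)
  show ?thesis unfolding tensor_elem_def
    using assms by (subst p.mult[symmetric]) (simp_all add: monoid_alg_single_mult)
qed

lemma tensor_elem_one: "tensor_elem A B \<one>\<^bsub>A\<^esub> \<one>\<^bsub>B\<^esub> = \<one>\<^bsub>tensor A B\<^esub>"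
proof -
  interpret p: alg_hom M "tensor A B" "(+>\<^bsub>M\<^esub>) (bilinear_span A B)" by (rule tensor_proj)
  show ?thesis using p.one by (simp add: tensor_elem_def)
qed

lemma linear_maps_tensor_eqI:
  assumes C: "kh_algebra C"
    and f: "f \<in> linear_maps (tensor A B) C" and g: "g \<in> linear_maps (tensor A B) C"
    and eq: "\<And>a b. a \<in> carrier A \<Longrightarrow> b \<in> carrier B \<Longrightarrow> f (tensor_elem A B a b) = g (tensor_elem A B a b)"
    and t: "t \<in> carrier (tensor A B)"
  shows "f t = g t"
proof -
  let ?p = "(+>\<^bsub>M\<^esub>) (bilinear_span A B)"
  interpret p: alg_hom M "tensor A B" ?p by (rule tensor_proj)
  obtain x where x: "x \<in> carrier M" "t = ?p x"
    using t rcos_surj[OF M.kh_algebra_axioms span_ideal] unfolding tensor_def by blast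
  have "f (?p x) = g (?p x)"
    by (rule linear_maps_monoid_alg_eqI[OF monoid_prod C linear_maps_comp[OF p.linear f]
          linear_maps_comp[OF p.linear g] _ x(1)]) (auto simp: eq simp flip: tensor_elem_def)
  then show ?thesis using x by simp
qed

lemma tensor_lift:
  assumes C: "kh_algebra C" and \<beta>: "\<beta> \<in> bilinear_maps A B C"
  obtains g where "g \<in> linear_maps (tensor A B) C"
    "\<And>a b. a \<in> carrier A \<Longrightarrow> b \<in> carrier B \<Longrightarrow> g (tensor_elem A B a b) = \<beta> a b"
proof -
  interpret C: kh_algebra C by fact
  let ?f = "lin_ext C (\<lambda>(a, b). \<beta> a b)"
  note b1 = bilinear_mapsD(1)[OF \<beta>] and b2 = bilinear_mapsD(2)[OF \<beta>]
  have \<rho>: "(case p of (a, b) \<Rightarrow> \<beta> a b) \<in> carrier C" if "p \<in> carrier (A \<times>\<times> B)" for p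
    using that linear_maps_closed[OF b1] by auto
  interpret f: linear_map M C ?f
    by (rule linear_mapI[OF M.kh_algebra_axioms C lin_ext_linear[OF C \<rho>]])
  have s: "?f (single (a, b)) = \<beta> a b" if "a \<in> carrier A" "b \<in> carrier B" for a b
    using lin_ext_single[where G = "A \<times>\<times> B" and x = "(a, b)", OF C \<rho>] that by simp
  have \<beta>c [simp]: "\<beta> a b \<in> carrier C" if "a \<in> carrier A" "b \<in> carrier B" for a b
    using \<rho>[of "(a, b)"] that by simp
  note [simp del] = monoid_alg_sel
  have "?f r = \<zero>\<^bsub>C\<^esub>" if "r \<in> bilinear_relators A B" for r
    using that
    by (cases rule: bilinear_relators_cases)
      (simp_all add: s linear_maps_add[OF b1] linear_maps_add[OF b2] linear_maps_smult[OF b1]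
        linear_maps_smult[OF b2] C.add_diff_diff)
  then have ker: "?f r = \<zero>\<^bsub>C\<^esub>" if "r \<in> bilinear_span A B" for r
    using M.span_minimal[OF submodule_vimage[OF f.linear_map_axioms C.submodule_zero]] that
      bilinear_relators_carrier by blast
  obtain g where "g \<in> linear_maps (tensor A B) C"
    "\<And>x. x \<in> carrier M \<Longrightarrow> g (bilinear_span A B +>\<^bsub>M\<^esub> x) = ?f x"
    using quot_alg_lift[OF M.kh_algebra_axioms C span_ideal f.linear ker] unfolding tensor_def by blast
  then show ?thesis using that s by (simp add: tensor_elem_def)
qed

section \<open>Completed tensor products and their universal property\<close>

lemma kh_algebra_ctensor: "kh_algebra (ctensor A B)"
  unfolding ctensor_def by (rule T.kh_algebra_completion)

lemma hadic_complete_ctensor: "hadic_complete (ctensor A B)"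
  unfolding ctensor_def by (rule T.hadic_complete_completion)

sublocale CT: kh_algebra "ctensor A B" by (rule kh_algebra_ctensor)

lemma to_ctensor: "to_completion (tensor A B) \<in> alg_homs (tensor A B) (ctensor A B)"
  unfolding ctensor_def by (rule T.to_completion_hom)

lemma ctensor_elem_bilinear: "ctensor_elem A B \<in> bilinear_maps A B (ctensor A B)"
  unfolding ctensor_elem_def
  by (rule bilinear_mapsI; rule linear_maps_comp[OF _ alg_homs_linear[OF to_ctensor]])
    (rule bilinear_mapsD[OF tensor_elem_bilinear], assumption)+

lemma tensor_elem_carrier:
  "a \<in> carrier A \<Longrightarrow> b \<in> carrier B \<Longrightarrow> tensor_elem A B a b \<in> carrier (tensor A B)"
  using linear_maps_closed[OF bilinear_mapsD(2)[OF tensor_elem_bilinear]] by blast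

lemma ctensor_elem_carrier [simp]:
  "a \<in> carrier A \<Longrightarrow> b \<in> carrier B \<Longrightarrow> ctensor_elem A B a b \<in> carrier (ctensor A B)"
  using linear_maps_closed[OF bilinear_mapsD(2)[OF ctensor_elem_bilinear]] by blast

lemma ctensor_elem_mult [simp]:
  assumes "a \<in> carrier A" "a' \<in> carrier A" "b \<in> carrier B" "b' \<in> carrier B"
  shows "ctensor_elem A B a b \<otimes>\<^bsub>ctensor A B\<^esub> ctensor_elem A B a' b'
    = ctensor_elem A B (a \<otimes>\<^bsub>A\<^esub> a') (b \<otimes>\<^bsub>B\<^esub> b')"
  unfolding ctensor_elem_def using assms
  by (simp add: alg_homs_mult[OF to_ctensor, symmetric] tensor_elem_carrier tensor_elem_mult)

lemma ctensor_elem_one: "ctensor_elem A B \<one>\<^bsub>A\<^esub> \<one>\<^bsub>B\<^esub> = \<one>\<^bsub>ctensor A B\<^esub>"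
  by (simp add: ctensor_elem_def tensor_elem_one alg_homs_one[OF to_ctensor])

lemma linear_maps_ctensor_eqI:
  assumes C: "kh_algebra C" "separated C"
    and f: "f \<in> linear_maps (ctensor A B) C" and g: "g \<in> linear_maps (ctensor A B) C"
    and eq: "\<And>a b. a \<in> carrier A \<Longrightarrow> b \<in> carrier B \<Longrightarrow> f (ctensor_elem A B a b) = g (ctensor_elem A B a b)"
    and t: "t \<in> carrier (ctensor A B)"
  shows "f t = g t"
proof (rule linear_maps_completion_eqI[OF kh_algebra_tensor C])
  show "f \<in> linear_maps (completion (tensor A B)) C" "g \<in> linear_maps (completion (tensor A B)) C"
    "t \<in> carrier (completion (tensor A B))"
    using f g t by (simp_all add: ctensor_def)
  fix x assume x: "x \<in> carrier (tensor A B)"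
  note toc = alg_homs_linear[OF to_ctensor]
  show "f (to_completion (tensor A B) x) = g (to_completion (tensor A B) x)"
    by (rule linear_maps_tensor_eqI[OF C(1) linear_maps_comp[OF toc f] linear_maps_comp[OF toc g] _ x])
      (simp add: eq flip: ctensor_elem_def)
qed

text \<open>This gives meaning to the definite description in \<open>ctensor_lift\<close>.
  Existence: lift to the algebraic tensor product, then to its completion. Uniqueness: pure tensors
  span a dense submodule; outside the carrier the value is fixed by extensionality, whence the
  restriction.\<close>

lemma
  assumes C: "kh_algebra C" "hadic_complete C" and \<beta>: "\<beta> \<in> bilinear_maps A B C"
  shows ctensor_lift_linear: "ctensor_lift A B C \<beta> \<in> linear_maps (ctensor A B) C"
    and ctensor_lift_elem: "\<And>a b. a \<in> carrier A \<Longrightarrow> b \<in> carrier B \<Longrightarrow>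
      ctensor_lift A B C \<beta> (ctensor_elem A B a b) = \<beta> a b"
proof -
  let ?P = "\<lambda>\<phi>. \<phi> \<in> linear_maps (ctensor A B) C \<and> \<phi> \<in> extensional (carrier (ctensor A B)) \<and>
        (\<forall>a\<in>carrier A. \<forall>b\<in>carrier B. \<phi> (ctensor_elem A B a b) = \<beta> a b)"
  obtain g where g: "g \<in> linear_maps (tensor A B) C"
    "\<And>a b. a \<in> carrier A \<Longrightarrow> b \<in> carrier B \<Longrightarrow> g (tensor_elem A B a b) = \<beta> a b"
    using tensor_lift[OF C(1) \<beta>] by blast
  obtain h where h: "h \<in> linear_maps (ctensor A B) C"
    "\<And>x. x \<in> carrier (tensor A B) \<Longrightarrow> h (to_completion (tensor A B) x) = g x"
    using completion_lift[OF kh_algebra_tensor C g(1)] unfolding ctensor_def by blast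
  have ex: "?P (restrict h (carrier (ctensor A B)))"
  proof (intro conjI ballI)
    show "restrict h (carrier (ctensor A B)) \<in> linear_maps (ctensor A B) C"
      by (rule linear_maps_cong[OF kh_algebra_ctensor h(1)]) simp
    fix a b assume ab: "a \<in> carrier A" "b \<in> carrier B"
    then show "restrict h (carrier (ctensor A B)) (ctensor_elem A B a b) = \<beta> a b"
      using ctensor_elem_carrier[OF ab] h(2)[OF tensor_elem_carrier[OF ab]] g(2)[OF ab]
      by (simp add: ctensor_elem_def)
  qed simp
  have uniq: "\<phi> = \<psi>" if \<phi>: "?P \<phi>" and \<psi>: "?P \<psi>" for \<phi> \<psi>
  proof (rule extensionalityI)
    fix t assume t: "t \<in> carrier (ctensor A B)"
    show "\<phi> t = \<psi> t"
      by (rule linear_maps_ctensor_eqI[OF C(1) kh_algebra.complete_separated[OF C]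
            conjunct1[OF \<phi>] conjunct1[OF \<psi>] _ t]) (use \<phi> \<psi> in simp)
  next
    show "\<phi> \<in> extensional (carrier (ctensor A B))" "\<psi> \<in> extensional (carrier (ctensor A B))"
      using \<phi> \<psi> by blast+
  qed
  have "\<exists>!\<phi>. ?P \<phi>" by (rule ex1I[of ?P, OF ex]) (rule uniq[OF _ ex])
  then have "?P (ctensor_lift A B C \<beta>)"
    unfolding ctensor_lift_def by (rule theI'[of ?P])
  then show "ctensor_lift A B C \<beta> \<in> linear_maps (ctensor A B) C"
    "\<And>a b. a \<in> carrier A \<Longrightarrow> b \<in> carrier B \<Longrightarrow> ctensor_lift A B C \<beta> (ctensor_elem A B a b) = \<beta> a b"
    by blast+
qed

text \<open>With one factor fixed, both sides of the multiplicativity law are linear in the other,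
  so density allows each factor in turn to be a pure tensor.\<close>

lemma ctensor_lift_alg_hom:
  assumes C: "kh_algebra C" "hadic_complete C" and \<beta>: "\<beta> \<in> bilinear_maps A B C"
    and mult: "\<And>a a' b b'. a \<in> carrier A \<Longrightarrow> a' \<in> carrier A \<Longrightarrow> b \<in> carrier B \<Longrightarrow> b' \<in> carrier B \<Longrightarrow>
      \<beta> (a \<otimes>\<^bsub>A\<^esub> a') (b \<otimes>\<^bsub>B\<^esub> b') = \<beta> a b \<otimes>\<^bsub>C\<^esub> \<beta> a' b'"
    and one: "\<beta> \<one>\<^bsub>A\<^esub> \<one>\<^bsub>B\<^esub> = \<one>\<^bsub>C\<^esub>"
  shows "ctensor_lift A B C \<beta> \<in> alg_homs (ctensor A B) C"
proof (rule alg_homsI)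
  interpret C: kh_algebra C by fact
  let ?L = "ctensor_lift A B C \<beta>"
  show lin: "?L \<in> linear_maps (ctensor A B) C" by (rule ctensor_lift_linear[OF C \<beta>])
  note val = ctensor_lift_elem[OF C \<beta>]
  note sep = C.complete_separated[OF C(2)]
  show "?L \<one>\<^bsub>ctensor A B\<^esub> = \<one>\<^bsub>C\<^esub>" using val one by (simp flip: ctensor_elem_one)
  have s: "?L (ctensor_elem A B a b \<otimes>\<^bsub>ctensor A B\<^esub> t) = \<beta> a b \<otimes>\<^bsub>C\<^esub> ?L t"
    if ab: "a \<in> carrier A" "b \<in> carrier B" and t: "t \<in> carrier (ctensor A B)" for a b t
  proof (rule linear_maps_ctensor_eqI[OF C(1) sep _ _ _ t])
    show "(\<lambda>t. ?L (ctensor_elem A B a b \<otimes>\<^bsub>ctensor A B\<^esub> t)) \<in> linear_maps (ctensor A B) C"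
      by (rule linear_maps_comp[OF CT.linear_mult_right lin]) (simp add: ab)
    show "(\<lambda>t. \<beta> a b \<otimes>\<^bsub>C\<^esub> ?L t) \<in> linear_maps (ctensor A B) C"
      by (rule linear_maps_comp[OF lin C.linear_mult_right]) (rule linear_maps_closed[OF bilinear_mapsD(2)[OF \<beta>]], simp_all add: ab)
  qed (use ab in \<open>simp add: val mult\<close>)
  show "?L (s \<otimes>\<^bsub>ctensor A B\<^esub> t) = ?L s \<otimes>\<^bsub>C\<^esub> ?L t"
    if s': "s \<in> carrier (ctensor A B)" and t: "t \<in> carrier (ctensor A B)" for s t
  proof (rule linear_maps_ctensor_eqI[OF C(1) sep _ _ _ s'])
    show "(\<lambda>s. ?L (s \<otimes>\<^bsub>ctensor A B\<^esub> t)) \<in> linear_maps (ctensor A B) C"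
      by (rule linear_maps_comp[OF CT.linear_mult_left lin]) (rule t)
    show "(\<lambda>s. ?L s \<otimes>\<^bsub>C\<^esub> ?L t) \<in> linear_maps (ctensor A B) C"
      by (rule linear_maps_comp[OF lin C.linear_mult_left]) (rule linear_maps_closed[OF lin t])
  qed (use t in \<open>simp add: s val\<close>)
qed

end

lemma tensor_prodI: "kh_algebra A \<Longrightarrow> kh_algebra B \<Longrightarrow> tensor_prod A B"
  by (rule tensor_prod.intro)

subsection \<open>Opposite algebras\<close>

definition op_alg :: "('k::field fps, 'a) module \<Rightarrow> ('k fps, 'a) module" where
  "op_alg A = A\<lparr>mult := \<lambda>x y. y \<otimes>\<^bsub>A\<^esub> x\<rparr>"

lemma op_alg_sel [simp]:
  "carrier (op_alg A) = carrier A" "mult (op_alg A) x y = y \<otimes>\<^bsub>A\<^esub> x" "one (op_alg A) = one A"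
  "zero (op_alg A) = zero A" "add (op_alg A) = add A" "smult (op_alg A) = smult A"
  by (simp_all add: op_alg_def)

lemma a_inv_op_alg [simp]: "a_inv (op_alg A) = a_inv A"
  by (simp add: a_inv_def fun_eq_iff)

lemma a_minus_op_alg [simp]: "x \<ominus>\<^bsub>op_alg A\<^esub> y = x \<ominus>\<^bsub>A\<^esub> y"
  by (simp add: a_minus_def)

lemma finsum_op_alg [simp]: "finsum (op_alg A) = finsum A"
  by (simp add: finsum_def fun_eq_iff)

lemma hpow_op_alg [simp]: "hpow (op_alg A) = hpow A"
  by (simp add: hpow_def fun_eq_iff)

lemma kh_algebra_op: assumes "kh_algebra A" shows "kh_algebra (op_alg A)"
proof -
  interpret kh_algebra A by fact
  show ?thesis by (rule kh_algebraI) (simp_all add: alg_simps)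
qed

lemma hadic_complete_op:
  assumes "kh_algebra A" "hadic_complete A" shows "hadic_complete (op_alg A)"
  using assms by (simp add: kh_algebra.hadic_complete_iff kh_algebra_op separated_def cauchy_seqs_def)

lemma linear_maps_op [simp]: "linear_maps A (op_alg B) = linear_maps A B"
  by (simp add: linear_maps_def)

lemma nat_pow_op:
  assumes "kh_algebra A" "x \<in> carrier A" shows "x [^]\<^bsub>op_alg A\<^esub> (n::nat) = x [^]\<^bsub>A\<^esub> n"
proof -
  interpret kh_algebra A by fact
  interpret O: kh_algebra "op_alg A" by (rule kh_algebra_op[OF assms(1)])
  show ?thesis 
  proof (induction n)
    case (Suc n)
    then show ?case using nat_pow_Suc2[OF assms(2), of n] by simp
  qed simp
qed

section \<open>Exponentials in complete algebras\<close>

locale complete_alg = kh_algebra A for A :: "('k::field_char_0 fps, 'a) module" (structure) +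
  assumes complete: "hadic_complete A"

lemma complete_algI: "kh_algebra A \<Longrightarrow> hadic_complete A \<Longrightarrow> complete_alg A"
  by (simp add: complete_alg.intro complete_alg_axioms.intro)

text \<open>A power series in \<hbar> with an arbitrary coefficient sequence. It converges in every
  complete algebra, and identities checked on coefficients remain valid in the presence of
  torsion.\<close>

definition hser :: "('k::field fps, 'a) module \<Rightarrow> (nat \<Rightarrow> 'a) \<Rightarrow> 'a" where
  "hser A u = hsum A (\<lambda>k. fps_X ^ k \<odot>\<^bsub>A\<^esub> u k)"

abbreviation hpart :: "('k::field fps, 'a) module \<Rightarrow> (nat \<Rightarrow> 'a) \<Rightarrow> nat \<Rightarrow> 'a" where
  "hpart A u m \<equiv> \<Oplus>\<^bsub>A\<^esub>k\<in>{..<m}. fps_X ^ k \<odot>\<^bsub>A\<^esub> u k"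

definition conv :: "('k::field fps, 'a) module \<Rightarrow> (nat \<Rightarrow> 'a) \<Rightarrow> (nat \<Rightarrow> 'a) \<Rightarrow> nat \<Rightarrow> 'a" where
  "conv A u v n = (\<Oplus>\<^bsub>A\<^esub>i\<in>{..n}. u i \<otimes>\<^bsub>A\<^esub> v (n - i))"

definition dpow :: "('k::field_char_0 fps, 'a) module \<Rightarrow> 'a \<Rightarrow> nat \<Rightarrow> 'a" where
  "dpow A x n = fps_const (1 / fact n) \<odot>\<^bsub>A\<^esub> (x [^]\<^bsub>A\<^esub> n)"

text \<open>\<open>hphi A x\<close> is \<open>(exp (\<hbar> x) - 1) / \<hbar>\<close>.\<close>

definition hphi :: "('k::field_char_0 fps, 'a) module \<Rightarrow> 'a \<Rightarrow> 'a" where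
  "hphi A x = hser A (\<lambda>k. dpow A x (Suc k))"

context kh_algebra
begin

lemma add_diff_add_left:
  assumes "x \<in> carrier A" "y \<in> carrier A" "z \<in> carrier A"
  shows "(x \<oplus> y) \<ominus> (x \<oplus> z) = y \<ominus> z"
  using diff_diff_cancel[of y z "\<ominus> x"] assms by (simp add: minus_eq a_comm)

lemma hpart_Suc: "(\<And>k. u k \<in> carrier A) \<Longrightarrow> hpart A u (Suc m) = hpart A u m \<oplus> fps_X ^ m \<odot> u m"
  by (simp add: lessThan_Suc Pi_def a_comm)

lemma hpart_shift:
  assumes "\<And>k. u k \<in> carrier A"
  shows "hpart A u (Suc m) = u 0 \<oplus> fps_X \<odot> hpart A (\<lambda>k. u (Suc k)) m"
proof (induction m)
  case 0
  then show ?case using assms by (simp add: lessThan_Suc)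
next
  case (Suc m)
  show ?case
    by (subst hpart_Suc, rule assms, subst Suc, subst hpart_Suc, rule assms)
      (use assms in \<open>simp add: smult_r smult_smult a_assoc\<close>)
qed

lemma conv_closed [simp]:
  "(\<And>k. u k \<in> carrier A) \<Longrightarrow> (\<And>k. v k \<in> carrier A) \<Longrightarrow> conv A u v n \<in> carrier A"
  unfolding conv_def by (intro finsum_closed) auto

lemma conv_0: "u 0 \<in> carrier A \<Longrightarrow> v 0 \<in> carrier A \<Longrightarrow> conv A u v 0 = u 0 \<otimes> v 0"
  by (simp add: conv_def)

lemma conv_Suc:
  assumes "\<And>k. u k \<in> carrier A" "\<And>k. v k \<in> carrier A"
  shows "conv A u v (Suc n) = u 0 \<otimes> v (Suc n) \<oplus> conv A (\<lambda>k. u (Suc k)) v n"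
  unfolding conv_def using assms by (subst finsum_Suc2) (auto simp: a_comm)

end

context complete_alg
begin

lemma separatedI:
  "x \<in> carrier A \<Longrightarrow> y \<in> carrier A \<Longrightarrow> (\<And>m. x \<ominus> y \<in> hpow A m) \<Longrightarrow> x = y"
  by (rule separatedD[OF complete_separated[OF complete] kh_algebra_axioms])

text \<open>\<open>hsum\<close> admits any modulus of convergence; for a power series the standard
  one, partial sum \<open>m\<close> correct modulo \<hbar>^m, suffices, and separatedness excludes a
  second limit.\<close>

lemma hser_eqI:
  assumes u: "\<And>k. u k \<in> carrier A" and s: "s \<in> carrier A" "\<And>m. s \<ominus> hpart A u m \<in> hpow A m"
  shows "hser A u = s"
  unfolding hser_def hsum_def
proof (rule the_equality)
  show "s \<in> carrier A \<and> (\<forall>N. \<exists>M. \<forall>m\<ge>M. s \<ominus> hpart A u m \<in> hpow A N)"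
    using s hpow_mono by blast
next
  fix t assume t: "t \<in> carrier A \<and> (\<forall>N. \<exists>M. \<forall>m\<ge>M. t \<ominus> hpart A u m \<in> hpow A N)"
  show "t = s"
  proof (rule separatedI)
    fix N
    obtain M where M: "\<And>m. m \<ge> M \<Longrightarrow> t \<ominus> hpart A u m \<in> hpow A N" using t by blast
    let ?m = "max M N"
    have "s \<ominus> hpart A u ?m \<in> hpow A N" by (rule hpow_mono[OF s(2)]) simp
    with M[of ?m] show "t \<ominus> s \<in> hpow A N"
      using t s u by (intro hpow_diff_trans[of t "hpart A u ?m" N s] hpow_diff_sym[of s]) auto
  qed (use t s in auto)
qed

lemma
  assumes u: "\<And>k. u k \<in> carrier A"
  shows hser_closed [simp]: "hser A u \<in> carrier A"
    and hser_approx: "hser A u \<ominus> hpart A u m \<in> hpow A m"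
proof -
  have "hpart A u (Suc m) \<ominus> hpart A u m = fps_X ^ m \<odot> u m" for m
    using diff_add_cancel[of "fps_X ^ m \<odot> u m" "\<ominus> hpart A u m"] u
    by (simp add: hpart_Suc[OF u] minus_eq a_ac r_neg2 r_neg1)
  then have "hpart A u \<in> cauchy_seqs A" using u by (simp add: cauchy_seqs_def hpowI)
  with complete have "\<exists>s\<in>carrier A. \<forall>m. s \<ominus> hpart A u m \<in> hpow A m"
    unfolding hadic_complete_iff by (elim conjE bspec)
  then obtain s where s: "s \<in> carrier A" "\<And>m. s \<ominus> hpart A u m \<in> hpow A m"
    by blast
  then have "hser A u = s" by (intro hser_eqI[OF u]) auto
  with s show "hser A u \<in> carrier A" "hser A u \<ominus> hpart A u m \<in> hpow A m" by auto
qed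

text \<open>The unfolding rule behind the coinductive proofs: it exhibits the factor \<hbar> in
  front of the shifted series.\<close>

lemma hser_rec:
  assumes u: "\<And>k. u k \<in> carrier A"
  shows "hser A u = u 0 \<oplus> fps_X \<odot> hser A (\<lambda>k. u (Suc k))"
proof (rule hser_eqI[OF u])
  let ?s = "hser A (\<lambda>k. u (Suc k))"
  show "u 0 \<oplus> fps_X \<odot> ?s \<in> carrier A" using u by simp
  show "u 0 \<oplus> fps_X \<odot> ?s \<ominus> hpart A u m \<in> hpow A m" for m
  proof (cases m)
    case (Suc n)
    let ?p = "hpart A (\<lambda>k. u (Suc k)) n"
    have "u 0 \<oplus> fps_X \<odot> ?s \<ominus> hpart A u m = fps_X \<odot> (?s \<ominus> ?p)"
      unfolding Suc hpart_shift[OF u] using u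
      by (simp add: minus_eq minus_add smult_r smult_neg_r a_ac r_neg1 r_neg2)
    then show ?thesis using hpow_smult_X[OF hser_approx[of "\<lambda>k. u (Suc k)" n], of 1] u Suc by simp
  qed (use u in simp)
qed

text \<open>A coinduction principle: an identity between power series in \<open>\<hbar>\<close> holds if its defect is \<open>\<hbar>\<close>
  times the defect for the shifted series.\<close>

lemma hzero_coinduct:
  assumes "P x" and step: "\<And>x. P x \<Longrightarrow> x \<in> carrier A \<and> (\<exists>y. P y \<and> x = fps_X \<odot> y)"
  shows "x = \<zero>"
proof -
  have "x \<in> hpow A m" if "P x" for m x using that
  proof (induction m arbitrary: x)
    case (Suc m)
    then obtain y where "P y" "x = fps_X \<odot> y" using step by blast
    then show ?case using hpow_smult_X[OF Suc.IH, of y 1] by simp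
  qed (use step in simp)
  then show ?thesis using assms complete_separated[OF complete] unfolding separated_def by blast
qed

text \<open>By coinduction, for all coefficient sequences at once, since the step replaces the given
  sequences by their shifts. The constant terms cancel.\<close>

lemma hser_add:
  assumes "\<And>k. u k \<in> carrier A" "\<And>k. v k \<in> carrier A"
  shows "hser A (\<lambda>k. u k \<oplus> v k) = hser A u \<oplus> hser A v"
proof -
  let ?D = "\<lambda>u v. hser A (\<lambda>k. u k \<oplus> v k) \<ominus> (hser A u \<oplus> hser A v)"
  let ?P = "\<lambda>x. \<exists>u v. (\<forall>k. u k \<in> carrier A) \<and> (\<forall>k. v k \<in> carrier A) \<and> x = ?D u v"
  have "?D u v = \<zero>"
  proof (rule hzero_coinduct[of ?P])
    fix x assume "?P x"
    then obtain u v where uv [simp]: "\<And>k. u k \<in> carrier A" "\<And>k. v k \<in> carrier A" and x: "x = ?D u v" by blast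
    have "x = fps_X \<odot> ?D (\<lambda>k. u (Suc k)) (\<lambda>k. v (Suc k))"
      unfolding x by (subst (1 2 3) hser_rec) (simp_all add: minus_eq minus_add smult_r smult_neg_r a_ac r_neg1 r_neg2)
    moreover have "?P (?D (\<lambda>k. u (Suc k)) (\<lambda>k. v (Suc k)))"
      by (rule exI[of _ "\<lambda>k. u (Suc k)"], rule exI[of _ "\<lambda>k. v (Suc k)"]) simp
    ultimately show "x \<in> carrier A \<and> (\<exists>y. ?P y \<and> x = fps_X \<odot> y)" using x by auto
  qed (use assms in blast)
  then show ?thesis using assms by simp
qed

end

lemma hser_linear:
  assumes "complete_alg A" "complete_alg B" and f: "f \<in> linear_maps A B"
    and u: "\<And>k. u k \<in> carrier A"
  shows "f (hser A u) = hser B (\<lambda>k. f (u k))"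
proof -
  interpret A: complete_alg A by fact
  interpret B: complete_alg B by fact
  interpret linear_map A B f by (rule linear_mapI[OF A.kh_algebra_axioms B.kh_algebra_axioms f])
  have "f (hpart A u m) = hpart B (\<lambda>k. f (u k)) m" for m
    using u by (subst finsum) auto
  then have "f (hser A u) \<ominus>\<^bsub>B\<^esub> hpart B (\<lambda>k. f (u k)) m \<in> hpow B m" for m
    using hpow[OF A.hser_approx[of u m]] u by simp
  then show ?thesis using u by (intro B.hser_eqI[symmetric]) auto
qed

context complete_alg
begin

lemma hser_mult_l:
  "(\<And>k. u k \<in> carrier A) \<Longrightarrow> e \<in> carrier A \<Longrightarrow> e \<otimes> hser A u = hser A (\<lambda>k. e \<otimes> u k)"
  by (rule hser_linear[OF complete_alg_axioms complete_alg_axioms linear_mult_right])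

lemma hser_mult_r:
  "(\<And>k. u k \<in> carrier A) \<Longrightarrow> e \<in> carrier A \<Longrightarrow> hser A u \<otimes> e = hser A (\<lambda>k. u k \<otimes> e)"
  by (rule hser_linear[OF complete_alg_axioms complete_alg_axioms linear_mult_left])

lemma hser_smult:
  assumes "\<And>k. u k \<in> carrier A" shows "c \<odot> hser A u = hser A (\<lambda>k. c \<odot> u k)"
  using assms by (intro hser_linear[OF complete_alg_axioms complete_alg_axioms linear_mapsI])
    (auto simp: smult_r smult_smult mult.commute)

lemma hser_diff:
  assumes "\<And>k. u k \<in> carrier A" "\<And>k. v k \<in> carrier A"
  shows "hser A (\<lambda>k. u k \<ominus> v k) = hser A u \<ominus> hser A v"
  using hser_add[of u "\<lambda>k. (-1) \<odot> v k"] hser_smult[of v "-1"] assms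
  by (simp add: minus_eq smult_neg_l)

text \<open>Only the first factor is shifted in the coinduction. Its constant term contributes
  \<open>u 0\<close> times the second series, and the remaining coefficients are the convolution of
  the shifted \<open>u\<close> with the unchanged \<open>v\<close>.\<close>

lemma hser_conv:
  assumes "\<And>k. u k \<in> carrier A" and v: "\<And>k. v k \<in> carrier A"
  shows "hser A (conv A u v) = hser A u \<otimes> hser A v"
proof -
  note [simp] = v
  let ?D = "\<lambda>u. hser A u \<otimes> hser A v \<ominus> hser A (conv A u v)"
  let ?P = "\<lambda>x. \<exists>u. (\<forall>k. u k \<in> carrier A) \<and> x = ?D u"
  have "?D u = \<zero>"
  proof (rule hzero_coinduct[of ?P])
    fix x assume "?P x"
    then obtain u where u [simp]: "\<And>k. u k \<in> carrier A" and x: "x = ?D u" by blast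
    let ?u = "\<lambda>k. u (Suc k)"
    have a: "hser A u \<otimes> hser A v = u 0 \<otimes> hser A v \<oplus> fps_X \<odot> (hser A ?u \<otimes> hser A v)"
      by (subst hser_rec[of u]) (simp_all add: l_distr smult_mult_left)
    have b: "u 0 \<otimes> hser A v = u 0 \<otimes> v 0 \<oplus> fps_X \<odot> (u 0 \<otimes> hser A (\<lambda>k. v (Suc k)))"
      by (subst hser_rec[of v]) (simp_all add: r_distr smult_mult_right)
    have "hser A (conv A u v) = u 0 \<otimes> v 0 \<oplus> fps_X \<odot> (u 0 \<otimes> hser A (\<lambda>k. v (Suc k)) \<oplus> hser A (conv A ?u v))"
      by (subst hser_rec) (simp_all add: conv_0 conv_Suc hser_add hser_mult_l)
    also have "\<dots> = u 0 \<otimes> hser A v \<oplus> fps_X \<odot> hser A (conv A ?u v)"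
      unfolding b by (simp add: smult_r a_assoc)
    finally have "x = fps_X \<odot> ?D ?u"
      unfolding x a by (simp add: add_diff_add_left smult_diff_r)
    moreover have "?P (?D ?u)" by (rule exI[of _ ?u]) simp
    ultimately show "x \<in> carrier A \<and> (\<exists>y. ?P y \<and> x = fps_X \<odot> y)" using x by auto
  qed (use assms in blast)
  then show ?thesis using assms by simp
qed

end

subsection \<open>Divided powers\<close>

context kh_algebra
begin

lemma nat_pow_commute:
  assumes "x \<in> carrier A" "x' \<in> carrier A" "e \<in> carrier A" "x \<otimes> e = e \<otimes> x'"
  shows "x [^] (n::nat) \<otimes> e = e \<otimes> x' [^] n"
proof (induction n)
  case (Suc n)
  have "x [^] Suc n \<otimes> e = x [^] n \<otimes> (x \<otimes> e)" using assms by (simp add: m_assoc)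
  also have "\<dots> = (x [^] n \<otimes> e) \<otimes> x'" using assms by (simp add: m_assoc)
  also have "\<dots> = e \<otimes> x' [^] Suc n" using assms by (simp add: Suc m_assoc)
  finally show ?case .
qed (use assms in simp)

end

lemma (in kh_algebra) finsum_neutral_Suc:
  assumes "f \<in> {..Suc n} \<rightarrow> carrier A" "f (Suc n) = \<zero>"
  shows "finsum A f {..Suc n} = finsum A f {..n}"
  using assms by (simp add: Pi_def)

locale kh_algebra_0 = kh_algebra A for A :: "('k::field_char_0 fps, 'a) module" (structure)
begin

lemma dpow_closed [simp]: "x \<in> carrier A \<Longrightarrow> dpow A x n \<in> carrier A"
  by (simp add: dpow_def)

lemma dpow_0 [simp]: "x \<in> carrier A \<Longrightarrow> dpow A x 0 = \<one>"
  by (simp add: dpow_def)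

lemma dpow_commute:
  "x \<in> carrier A \<Longrightarrow> x' \<in> carrier A \<Longrightarrow> e \<in> carrier A \<Longrightarrow> x \<otimes> e = e \<otimes> x' \<Longrightarrow>
    dpow A x n \<otimes> e = e \<otimes> dpow A x' n"
  by (simp add: dpow_def smult_mult_left smult_mult_right nat_pow_commute)

lemma dpow_Suc:
  assumes "x \<in> carrier A" shows "of_nat (Suc n) \<odot> dpow A x (Suc n) = x \<otimes> dpow A x n"
proof -
  have "of_nat (Suc n) * fps_const (1 / fact (Suc n) :: 'k) = fps_const (1 / fact n)"
    by (simp add: fps_of_nat[symmetric] del: of_nat_Suc)
  then show ?thesis
    using assms nat_pow_Suc2[OF assms, of n]
    by (simp add: dpow_def smult_smult smult_mult_right del: nat_pow_Suc of_nat_Suc)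
qed

text \<open>The binomial theorem for commuting elements, in divided powers. After multiplication by
  n + 1, the factor x raises the first index and contributes the coefficient i, while y raises the
  second and contributes n + 1 - i; the coefficients add up to n + 1, a unit in characteristic
  zero.\<close>

lemma dpow_add:
  assumes x: "x \<in> carrier A" and y: "y \<in> carrier A" and xy: "x \<otimes> y = y \<otimes> x"
  shows "dpow A (x \<oplus> y) n = conv A (dpow A x) (dpow A y) n"
proof (induction n)
  case 0 then show ?case using x y by (simp add: conv_0)
next
  case (Suc n)
  let ?a = "dpow A x" and ?b = "dpow A y"
  note [simp] = x y and [simp del] = of_nat_Suc
  have 1: "x \<otimes> conv A ?a ?b n = (\<Oplus>i\<in>{..Suc n}. of_nat i \<odot> (?a i \<otimes> ?b (Suc n - i)))"
  proof -
    have "x \<otimes> conv A ?a ?b n = (\<Oplus>i\<in>{..n}. x \<otimes> (?a i \<otimes> ?b (n - i)))"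
      unfolding conv_def by (rule finsum_rdistr) auto
    also have "\<dots> = (\<Oplus>i\<in>{..n}. of_nat (Suc i) \<odot> (?a (Suc i) \<otimes> ?b (n - i)))"
      by (rule finsum_cong') (auto simp: smult_mult_left[symmetric] dpow_Suc m_assoc)
    also have "\<dots> = (\<Oplus>i\<in>{..Suc n}. of_nat i \<odot> (?a i \<otimes> ?b (Suc n - i)))"
      by (subst finsum_Suc2) auto
    finally show ?thesis .
  qed
  have 2: "y \<otimes> conv A ?a ?b n = (\<Oplus>i\<in>{..Suc n}. of_nat (Suc n - i) \<odot> (?a i \<otimes> ?b (Suc n - i)))"
  proof -
    have e: "y \<otimes> (?a i \<otimes> ?b j) = of_nat (Suc j) \<odot> (?a i \<otimes> ?b (Suc j))" for i j
    proof -
      have "y \<otimes> (?a i \<otimes> ?b j) = ?a i \<otimes> (y \<otimes> ?b j)"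
        using dpow_commute[of x x y i] xy by (simp add: m_assoc[symmetric])
      then show ?thesis by (simp add: dpow_Suc[symmetric] smult_mult_right)
    qed
    have "y \<otimes> conv A ?a ?b n = (\<Oplus>i\<in>{..n}. y \<otimes> (?a i \<otimes> ?b (n - i)))"
      unfolding conv_def by (rule finsum_rdistr) auto
    also have "\<dots> = (\<Oplus>i\<in>{..n}. of_nat (Suc n - i) \<odot> (?a i \<otimes> ?b (Suc n - i)))"
      by (rule finsum_cong') (auto simp: e Suc_diff_le)
    also have "\<dots> = (\<Oplus>i\<in>{..Suc n}. of_nat (Suc n - i) \<odot> (?a i \<otimes> ?b (Suc n - i)))"
      by (rule finsum_neutral_Suc[symmetric]) auto
    finally show ?thesis .
  qed
  have "of_nat (Suc n) \<odot> dpow A (x \<oplus> y) (Suc n) = (x \<oplus> y) \<otimes> conv A ?a ?b n"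
    by (simp add: dpow_Suc Suc)
  also have "\<dots> = x \<otimes> conv A ?a ?b n \<oplus> y \<otimes> conv A ?a ?b n" by (simp add: l_distr)
  also have "\<dots> = (\<Oplus>i\<in>{..Suc n}. of_nat i \<odot> (?a i \<otimes> ?b (Suc n - i)) \<oplus> of_nat (Suc n - i) \<odot> (?a i \<otimes> ?b (Suc n - i)))"
    unfolding 1 2 by (rule finsum_addf[symmetric]) auto
  also have "\<dots> = (\<Oplus>i\<in>{..Suc n}. of_nat (Suc n) \<odot> (?a i \<otimes> ?b (Suc n - i)))"
    by (rule finsum_cong') (auto simp: smult_l[symmetric] simp flip: of_nat_add)
  also have "\<dots> = of_nat (Suc n) \<odot> conv A ?a ?b (Suc n)"
    unfolding conv_def by (rule smult_finsum[symmetric]) auto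
  finally have "fps_const (1 / of_nat (Suc n)) \<odot> (of_nat (Suc n) \<odot> dpow A (x \<oplus> y) (Suc n))
      = fps_const (1 / of_nat (Suc n)) \<odot> (of_nat (Suc n) \<odot> conv A ?a ?b (Suc n))" by simp
  moreover have "fps_const (1 / of_nat (Suc n) :: 'k) * of_nat (Suc n) = 1"
    by (simp add: fps_of_nat[symmetric])
  ultimately show ?case by (simp add: smult_smult)
qed

end

section \<open>Laws of the exponential and of its difference quotient\<close>

sublocale complete_alg \<subseteq> kh_algebra_0 ..

context complete_alg
begin

lemma hexp_eq: assumes "x \<in> carrier A" shows "hexp A x = hser A (dpow A x)"
  unfolding hexp_def hser_def using assms
  by (intro arg_cong[of _ _ "hsum A"] ext) (simp add: dpow_def smult_smult mult.commute)

lemma hphi_closed [simp]: "x \<in> carrier A \<Longrightarrow> hphi A x \<in> carrier A"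
  by (simp add: hphi_def)

lemma hexp_closed [simp]: "x \<in> carrier A \<Longrightarrow> hexp A x \<in> carrier A"
  by (simp add: hexp_eq)

lemma hexp_hphi: "x \<in> carrier A \<Longrightarrow> hexp A x = \<one> \<oplus> fps_X \<odot> hphi A x"
  by (simp add: hexp_eq hphi_def hser_rec[of "dpow A x"])

lemma hexp_diff_quot_eq:
  assumes "x \<in> carrier A" "y \<in> carrier A"
  shows "hexp_diff_quot A x y = hphi A x \<ominus> hphi A (\<ominus> y)"
proof -
  have "hexp_diff_quot A x y = hser A (\<lambda>k. dpow A x (Suc k) \<ominus> dpow A (\<ominus> y) (Suc k))"
    unfolding hexp_diff_quot_def hser_def using assms
    by (intro arg_cong[of _ _ "hsum A"] ext) (simp add: dpow_def smult_smult smult_diff_r mult.commute)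
  then show ?thesis using assms by (simp add: hser_diff hphi_def)
qed

lemma hexp_add:
  assumes "x \<in> carrier A" "y \<in> carrier A" "x \<otimes> y = y \<otimes> x"
  shows "hexp A (x \<oplus> y) = hexp A x \<otimes> hexp A y"
proof -
  have "dpow A (x \<oplus> y) = conv A (dpow A x) (dpow A y)" using dpow_add[OF assms] by blast
  then show ?thesis using assms by (simp add: hexp_eq hser_conv)
qed

text \<open>This is exp (x + y) - 1 = (exp y - 1) + (exp x - 1) exp y divided by \<hbar>, with
  \<hbar> suppressed in the exponents. On coefficients the division is a shift of index: the term i
  = 0 of the convolution becomes the first summand, the others the second.\<close>

lemma hphi_add:
  assumes "x \<in> carrier A" "y \<in> carrier A" "x \<otimes> y = y \<otimes> x"
  shows "hphi A (x \<oplus> y) = hphi A y \<oplus> hphi A x \<otimes> hexp A y"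
proof -
  have "(\<lambda>k. dpow A (x \<oplus> y) (Suc k)) =
      (\<lambda>k. dpow A y (Suc k) \<oplus> conv A (\<lambda>k. dpow A x (Suc k)) (dpow A y) k)"
    using assms by (simp add: dpow_add conv_Suc)
  then show ?thesis using assms by (simp add: hphi_def hexp_eq hser_add hser_conv)
qed

text \<open>Allowing two elements with \<open>x \<otimes> e = e \<otimes> x'\<close> covers
  commuting elements, \<open>x' = x\<close>, and eigenvectors of the commutator, where
  \<open>x'\<close> is \<open>x\<close> plus a scalar.\<close>

lemma hexp_commute:
  assumes "x \<in> carrier A" "x' \<in> carrier A" "e \<in> carrier A" "x \<otimes> e = e \<otimes> x'"
  shows "hexp A x \<otimes> e = e \<otimes> hexp A x'" and "hphi A x \<otimes> e = e \<otimes> hphi A x'"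
  using assms by (simp_all add: hexp_eq hphi_def hser_mult_l hser_mult_r dpow_commute[OF assms])

lemma hphi_zero: "hphi A \<zero> = \<zero>"
proof -
  have "dpow A \<zero> (Suc k) = \<zero>" for k by (simp add: dpow_def)
  then have "hphi A \<zero> = hser A (\<lambda>_. \<zero>)" by (simp add: hphi_def)
  also have "\<dots> = \<zero>" by (rule hser_eqI) (simp_all add: minus_eq)
  finally show ?thesis .
qed

lemma hexp_zero: "hexp A \<zero> = \<one>"
  by (simp add: hexp_hphi hphi_zero)

lemma hexp_neg:
  assumes "x \<in> carrier A" shows "hexp A x \<otimes> hexp A (\<ominus> x) = \<one>" "hexp A (\<ominus> x) \<otimes> hexp A x = \<one>"
  using hexp_add[of x "\<ominus> x"] hexp_add[of "\<ominus> x" x] assms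
  by (simp_all add: r_neg l_neg hexp_zero l_minus r_minus)

end

lemma
  assumes A: "complete_alg A" and B: "complete_alg B" and f: "f \<in> alg_homs A B" and x: "x \<in> carrier A"
  shows hexp_hom: "f (hexp A x) = hexp B (f x)" and hphi_hom: "f (hphi A x) = hphi B (f x)"
proof -
  interpret A: complete_alg A by fact
  interpret B: complete_alg B by fact
  interpret alg_hom A B f by (rule alg_homI[OF A.kh_algebra_axioms B.kh_algebra_axioms f])
  have "(\<lambda>k. f (dpow A x k)) = dpow B (f x)" using x by (simp add: dpow_def fun_eq_iff)
  then show "f (hexp A x) = hexp B (f x)" "f (hphi A x) = hphi B (f x)"
    using x by (simp_all add: A.hexp_eq B.hexp_eq hphi_def hser_linear[OF A B linear] fun_eq_iff)
qed

subsection \<open>Exponentials of scalars\<close>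

lemma hpow_kh_iff: "f \<in> hpow kh m \<longleftrightarrow> (\<forall>n<m. fps_nth f n = (0::'k::field))"
proof
  assume f: "\<forall>n<m. fps_nth f n = 0"
  have "f = fps_X ^ m * fps_shift m f" by (rule fps_ext) (simp add: fps_X_power_mult_nth f)
  then show "f \<in> hpow kh m" by (auto simp: hpow_def)
qed (auto simp: hpow_def fps_X_power_mult_nth)

lemma complete_alg_kh: "complete_alg (kh :: ('k::field_char_0 fps, 'k fps) module)"
proof (rule complete_algI[OF kh_algebra_kh])
  interpret kh_algebra kh by (rule kh_algebra_kh)
  show "hadic_complete (kh :: ('k fps, 'k fps) module)" unfolding hadic_complete_iff
  proof (intro conjI ballI)
    show "separated (kh :: ('k fps, 'k fps) module)"
      unfolding separated_def
    proof (intro ballI impI)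
      fix x :: "'k fps" assume "\<forall>m. x \<in> hpow kh m"
      then have "fps_nth x n = 0" for n using hpow_kh_iff[of x "Suc n"] by simp
      then show "x = \<zero>\<^bsub>kh\<^esub>" by (auto intro: fps_ext)
    qed
    fix x :: "nat \<Rightarrow> 'k fps" assume x: "x \<in> cauchy_seqs kh"
    have eq: "fps_nth (x m) n = fps_nth (x (Suc n)) n" if "n < m" for m n
      using cauchy_seqs_le[OF x, of "Suc n" m] that by (simp add: hpow_kh_iff)
    let ?c = "Abs_fps (\<lambda>n. fps_nth (x (Suc n)) n)"
    have "?c \<ominus>\<^bsub>kh\<^esub> x m \<in> hpow kh m" for m
      unfolding hpow_kh_iff
    proof (intro allI impI)
      fix n assume "n < m"
      from eq[OF this, symmetric] show "fps_nth (?c \<ominus>\<^bsub>kh\<^esub> x m) n = 0" by simp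
    qed
    then show "\<exists>c\<in>carrier kh. \<forall>m. c \<ominus>\<^bsub>kh\<^esub> x m \<in> hpow kh m" by auto
  qed
qed

text \<open>Scalars are treated as a complete algebra over themselves, so the laws of
  \<open>hexp\<close> apply to \<open>exph\<close>. The coefficient of index n sees only the terms
  of index at most n of the exponential series, so truncation at m > n does not change it.\<close>

lemma exph_eq_hexp: "exph a = hexp kh a"
proof -
  interpret complete_alg kh by (rule complete_alg_kh)
  have "exph a \<ominus>\<^bsub>kh\<^esub> hpart kh (dpow kh a) m \<in> hpow kh m" for m
  proof -
    have "fps_nth (exph a) n = fps_nth (hpart kh (dpow kh a) m) n" if "n < m" for n
    proof -
      have "fps_nth (exph a) n = (\<Sum>i\<in>{0..n}. fps_nth (fps_X ^ i * (fps_const (1 / fact i) * a ^ i)) n)"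
        unfolding exph_def fps_compose_nth
        by (intro sum.cong refl) (simp add: power_mult_distrib mult.left_commute[of _ "fps_const _"])
      also have "\<dots> = (\<Sum>i\<in>{..<m}. fps_nth (fps_X ^ i * (fps_const (1 / fact i) * a ^ i)) n)"
        using that by (intro sum.mono_neutral_left) (auto simp: fps_X_power_mult_nth)
      finally show ?thesis by (simp add: fps_sum_nth dpow_def)
    qed
    then show ?thesis by (simp add: hpow_kh_iff)
  qed
  then show ?thesis by (simp add: hexp_eq) (rule hser_eqI[symmetric]; simp)
qed

lemma exph_add: "exph (a + b) = exph a * exph b"
proof -
  interpret complete_alg kh by (rule complete_alg_kh)
  show ?thesis using hexp_add[of a b] by (simp add: exph_eq_hexp mult.commute)
qed

lemma exph_0 [simp]: "exph 0 = 1"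
  by (simp add: exph_def)

lemma exph_minus_cancel [simp]: "exph a * exph (- a) = 1" "exph (- a) * exph a = 1"
  by (simp_all flip: exph_add)

lemma exph_power: "exph a ^ n = exph (of_nat n * a)"
  by (induction n) (simp_all add: algebra_simps exph_add)

lemma exph_nth_0 [simp]: "fps_nth (exph a) 0 = 1"
  by (simp add: exph_def fps_compose_nth)

lemma inverse_exph: "inverse (exph a) = exph (- a)"
  by (rule fps_inverse_unique) simp

context complete_alg
begin

text \<open>The structure map c \<mapsto> c 1 is a homomorphism of complete algebras and hence
  commutes with the exponential.\<close>

lemma hexp_scalar: "hexp A (a \<odot> \<one>) = exph a \<odot> \<one>"
proof -
  have "(\<lambda>c. c \<odot> \<one>) \<in> alg_homs kh A"
    by (intro alg_homsI linear_mapsI) (simp_all add: smult_l smult_smult smult_mult_left)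
  from hexp_hom[OF complete_alg_kh complete_alg_axioms this, of a] show ?thesis
    by (simp add: exph_eq_hexp)
qed

text \<open>The commutator relation says x e = e (x + a), and the scalar a commutes with x, so the
  exponential of the sum splits.\<close>

lemma hexp_eigen:
  assumes x: "x \<in> carrier A" and e: "e \<in> carrier A" and eq: "x \<otimes> e \<ominus> e \<otimes> x = a \<odot> e"
  shows "hexp A x \<otimes> e = exph a \<odot> (e \<otimes> hexp A x)"
proof -
  have "x \<otimes> e = (x \<otimes> e \<ominus> e \<otimes> x) \<oplus> e \<otimes> x" using x e by (simp add: diff_add_cancel)
  also have "\<dots> = e \<otimes> (x \<oplus> a \<odot> \<one>)" using x e by (simp add: eq r_distr smult_mult_right a_comm)
  finally have "hexp A x \<otimes> e = e \<otimes> hexp A (x \<oplus> a \<odot> \<one>)"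
    by (intro hexp_commute) (use x e in simp_all)
  also have "hexp A (x \<oplus> a \<odot> \<one>) = hexp A x \<otimes> (exph a \<odot> \<one>)"
    using x by (subst hexp_add) (simp_all add: hexp_scalar smult_mult_left smult_mult_right)
  finally show ?thesis using x e by (simp add: smult_mult_right)
qed

end

section \<open>Quantum Serre sums\<close>

subsection \<open>Gaussian binomials\<close>

text \<open>The constant term 1 makes q invertible and gives the quantum integer of index n the
  constant term n, a unit for n > 0 in characteristic zero. The element q - 1/q itself may be
  divisible by \<hbar>; being nonzero in a domain it can still be cancelled.\<close>

locale qparam =
  fixes q :: "'k::field_char_0 fps"
  assumes q_nth_0 [simp]: "fps_nth q 0 = 1" and q_neq: "q \<noteq> inverse q"
begin

lemma q_inv [simp]: "q * inverse q = 1" "inverse q * q = 1"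
  by (simp_all add: inverse_mult_eq_1 inverse_mult_eq_1')

text \<open>A geometric sum shows that the division in \<open>qnum\<close> is exact; its n terms all
  have constant term 1.\<close>

lemma qnum_mult: "(q - inverse q) * qnum q n = q ^ n - inverse q ^ n"
  and qnum_nth_0: "fps_nth (qnum q n) 0 = of_nat n"
proof -
  let ?S = "\<Sum>i<n. inverse q ^ (n - Suc i) * q ^ i"
  have S: "q ^ n - inverse q ^ n = (q - inverse q) * ?S"
    by (rule power_diff_sumr2)
  then have "qnum q n = ?S" using q_neq by (simp add: qnum_def)
  then show "(q - inverse q) * qnum q n = q ^ n - inverse q ^ n"
    and "fps_nth (qnum q n) 0 = of_nat n"
    using S by (simp_all add: fps_sum_nth fps_power_zeroth_eq_one)
qed

lemma qfact_Suc: "qfact q (Suc n) = qfact q n * qnum q (Suc n)"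
  by (simp add: qfact_def)

lemma qfact_nth_0: "fps_nth (qfact q n) 0 \<noteq> 0"
  by (induction n) (simp_all add: qfact_def qnum_nth_0 del: of_nat_Suc)

lemma qbinom_mult: "qbinom q m k * (qfact q k * qfact q (m - k)) = qfact q m"
proof -
  have "fps_nth (qfact q k * qfact q (m - k)) 0 \<noteq> 0" by (simp add: qfact_nth_0)
  then show ?thesis
    unfolding qbinom_def by (simp add: fps_divide_unit mult.assoc inverse_mult_eq_1)
qed

lemma qbinom_0: "qbinom q m 0 = 1" and qbinom_self: "qbinom q m m = 1"
proof -
  have "qfact q m \<noteq> 0" "qfact q 0 = 1" using qfact_nth_0[of m] by (metis fps_zero_nth) (simp add: qfact_def)
  then show "qbinom q m 0 = 1" "qbinom q m m = 1"
    using qbinom_mult[of m 0] qbinom_mult[of m m] by simp_all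
qed

lemma qnum_split: "k \<le> n \<Longrightarrow> qnum q n = inverse q ^ k * qnum q (n - k) + q ^ (n - k) * qnum q k"
proof -
  assume "k \<le> n"
  then obtain j where n: "n = k + j" using le_Suc_ex by blast
  have "(q - inverse q) * (inverse q ^ k * qnum q j + q ^ j * qnum q k)
      = inverse q ^ k * ((q - inverse q) * qnum q j) + q ^ j * ((q - inverse q) * qnum q k)"
    by (simp add: algebra_simps)
  also have "\<dots> = (q - inverse q) * qnum q n"
    unfolding qnum_mult by (simp add: n algebra_simps power_add)
  finally show ?thesis using q_neq n by simp
qed

text \<open>A q-Pascal rule. After clearing the common denominator [k+1]! [m-k]! it is the splitting
  [m+1] = q^(-k-1) [m-k] + q^(m-k) [k+1].\<close>

lemma qbinom_Suc:
  assumes "k < m"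
  shows "qbinom q (Suc m) (Suc k) = inverse q ^ Suc k * qbinom q m (Suc k) + q ^ (m - k) * qbinom q m k"
proof -
  let ?F = "qfact q (Suc k) * qfact q (m - k)"
  have mk: "m - k = Suc (m - Suc k)" using assms by simp
  have "qbinom q (Suc m) (Suc k) * ?F = qfact q m * qnum q (Suc m)"
    using qbinom_mult[of "Suc m" "Suc k"] by (simp add: qfact_Suc)
  also have "\<dots> = inverse q ^ Suc k * (qfact q m * qnum q (m - k)) + q ^ (m - k) * (qfact q m * qnum q (Suc k))"
    using qnum_split[of "Suc k" "Suc m"] assms by (simp add: algebra_simps)
  also have "qfact q m * qnum q (m - k) = qbinom q m (Suc k) * ?F"
    unfolding qbinom_mult[of m "Suc k", symmetric] by (simp add: mk qfact_Suc mult_ac)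
  also have "qfact q m * qnum q (Suc k) = qbinom q m k * ?F"
    unfolding qbinom_mult[of m k, symmetric] by (simp add: qfact_Suc mult_ac)
  finally have "qbinom q (Suc m) (Suc k) * ?F =
      (inverse q ^ Suc k * qbinom q m (Suc k) + q ^ (m - k) * qbinom q m k) * ?F"
    by (simp add: algebra_simps)
  moreover have "?F \<noteq> 0" using qfact_nth_0 by (metis fps_zero_nth mult_eq_0_iff)
  ultimately show ?thesis by simp
qed

lemma qparam_inverse: "qparam (inverse q)"
  using q_neq by unfold_locales (simp_all add: fps_inverse_idempotent)

lemma qnum_inverse: "qnum (inverse q) n = qnum q n"
proof -
  interpret r: qparam "inverse q" by (rule qparam_inverse)
  have "(q - inverse q) * qnum (inverse q) n = - ((inverse q - q) * qnum (inverse q) n)"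
    by (simp add: algebra_simps)
  also have "\<dots> = (q - inverse q) * qnum q n"
    using r.qnum_mult[of n] by (simp add: fps_inverse_idempotent qnum_mult)
  finally have "(q - inverse q) * qnum (inverse q) n = (q - inverse q) * qnum q n" .
  then show ?thesis using q_neq by simp
qed

text \<open>This symmetry permits a second factorization of the same Serre sum, with q replaced by
  its inverse.\<close>

lemma qbinom_inverse: "qbinom (inverse q) m k = qbinom q m k"
  by (simp add: qbinom_def qfact_def qnum_inverse)

end

lemma qbinom_sym: "k \<le> m \<Longrightarrow> qbinom q m (m - k) = qbinom q m k"
  by (simp add: qbinom_def mult.commute)

text \<open>The coefficients of \<hbar> in q and its inverse are d and -d, which differ in
  characteristic zero.\<close>

lemma qparam_exph: assumes "d > 0" shows "qparam (exph (of_nat d :: 'k::field_char_0 fps))"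
proof
  have nth: "fps_nth (exph a) (Suc 0) = fps_nth a 0" for a :: "'k fps"
    by (simp add: exph_def fps_compose_nth)
  show "exph (of_nat d) \<noteq> inverse (exph (of_nat d :: 'k fps))"
  proof
    assume "exph (of_nat d) = inverse (exph (of_nat d :: 'k fps))"
    then have "exph (of_nat d) = exph (- of_nat d :: 'k fps)" by (simp add: inverse_exph)
    then have "fps_nth (exph (of_nat d)) (Suc 0) = fps_nth (exph (- of_nat d :: 'k fps)) (Suc 0)" by simp
    then show False using assms unfolding nth by (simp add: fps_of_nat[symmetric])
  qed
qed simp

subsection \<open>Iterated q-commutators\<close>

text \<open>The coefficients are a parameter because the same sum is needed with \<theta> and with
  its inverse, and also in the opposite algebra.\<close>

definition serre_sum :: "('k::field fps, 'a) module \<Rightarrow> (nat \<Rightarrow> 'k fps) \<Rightarrow> nat \<Rightarrow> 'a \<Rightarrow> 'a \<Rightarrow> 'a" where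
  "serre_sum A c m x z = (\<Oplus>\<^bsub>A\<^esub>k\<in>{..m}. c k \<odot>\<^bsub>A\<^esub> (x [^]\<^bsub>A\<^esub> (m - k) \<otimes>\<^bsub>A\<^esub> z \<otimes>\<^bsub>A\<^esub> x [^]\<^bsub>A\<^esub> k))"

fun qad :: "('k::field fps, 'a) module \<Rightarrow> (nat \<Rightarrow> 'k fps) \<Rightarrow> 'a \<Rightarrow> 'a \<Rightarrow> nat \<Rightarrow> 'a" where
  "qad A c x z 0 = z"
| "qad A c x z (Suc n) = x \<otimes>\<^bsub>A\<^esub> qad A c x z n \<ominus>\<^bsub>A\<^esub> c n \<odot>\<^bsub>A\<^esub> (qad A c x z n \<otimes>\<^bsub>A\<^esub> x)"

context kh_algebra
begin

lemma qad_closed [simp]: "x \<in> carrier A \<Longrightarrow> z \<in> carrier A \<Longrightarrow> qad A c x z n \<in> carrier A"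
  by (induction n) auto

lemma serre_sum_closed [simp]: "x \<in> carrier A \<Longrightarrow> z \<in> carrier A \<Longrightarrow> serre_sum A c m x z \<in> carrier A"
  unfolding serre_sum_def by (intro finsum_closed) auto

lemma serre_sum_add_right:
  assumes "x \<in> carrier A" "z \<in> carrier A" "w \<in> carrier A"
  shows "serre_sum A c m x (z \<oplus> w) = serre_sum A c m x z \<oplus> serre_sum A c m x w"
proof -
  have "serre_sum A c m x (z \<oplus> w) = (\<Oplus>k\<in>{..m}. c k \<odot> (x [^] (m - k) \<otimes> z \<otimes> x [^] k)
      \<oplus> c k \<odot> (x [^] (m - k) \<otimes> w \<otimes> x [^] k))"
    unfolding serre_sum_def using assms by (intro finsum_cong') (auto simp: l_distr r_distr smult_r)
  also have "\<dots> = serre_sum A c m x z \<oplus> serre_sum A c m x w"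
    unfolding serre_sum_def using assms by (intro finsum_addf) auto
  finally show ?thesis .
qed

text \<open>Let X and Y be left and right multiplication by x, which commute. A Serre sum is a
  homogeneous polynomial in X and Y applied to z; the conditions on \<open>c'\<close> say that it is
  multiplied by X - a Y.\<close>

lemma qad_serre_step:
  assumes x: "x \<in> carrier A" and z: "z \<in> carrier A"
    and c0: "c' 0 = c 0" and cs: "\<And>k. k < m \<Longrightarrow> c' (Suc k) = c (Suc k) - a * c k"
    and cm: "c' (Suc m) = - a * c m"
  shows "x \<otimes> serre_sum A c m x z \<ominus> a \<odot> (serre_sum A c m x z \<otimes> x) = serre_sum A c' (Suc m) x z"
proof -
  define t where "t k = x [^] (Suc m - k) \<otimes> z \<otimes> x [^] k" for k
  \<comment> \<open>\<open>u\<close> and \<open>v\<close> are the coefficient sequences of the two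
    products on the range up to \<open>Suc m\<close>: \<open>u\<close> is extended by zero at the
    top, while \<open>v\<close> is shifted by one and starts with zero.\<close>
  define u where "u k = (if k = Suc m then 0 else c k)" for k
  define v where "v k = (case k of 0 \<Rightarrow> 0 | Suc j \<Rightarrow> - (a * c j))" for k
  note [simp] = x z
  have [simp]: "t k \<in> carrier A" for k by (simp add: t_def)
  have x1: "x \<otimes> (x [^] (m - k) \<otimes> z \<otimes> x [^] k) = t k" if "k \<le> m" for k
    using that nat_pow_Suc2[OF x, of "m - k"] by (simp add: t_def Suc_diff_le m_assoc del: nat_pow_Suc)
  have x2: "x [^] (m - k) \<otimes> z \<otimes> x [^] k \<otimes> x = t (Suc k)" for k by (simp add: t_def m_assoc)
  have 1: "x \<otimes> serre_sum A c m x z = (\<Oplus>k\<in>{..Suc m}. u k \<odot> t k)"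
  proof -
    have "x \<otimes> serre_sum A c m x z = (\<Oplus>k\<in>{..m}. x \<otimes> (c k \<odot> (x [^] (m - k) \<otimes> z \<otimes> x [^] k)))"
      unfolding serre_sum_def by (rule finsum_rdistr) auto
    also have "\<dots> = (\<Oplus>k\<in>{..m}. u k \<odot> t k)"
      by (rule finsum_cong') (auto simp: smult_mult_right x1 u_def)
    also have "\<dots> = (\<Oplus>k\<in>{..Suc m}. u k \<odot> t k)"
      by (rule finsum_neutral_Suc[symmetric]) (auto simp: u_def)
    finally show ?thesis .
  qed
  have "serre_sum A c m x z \<otimes> x = (\<Oplus>k\<in>{..m}. c k \<odot> (x [^] (m - k) \<otimes> z \<otimes> x [^] k) \<otimes> x)"
    unfolding serre_sum_def by (rule finsum_ldistr) auto
  also have "\<dots> = (\<Oplus>k\<in>{..m}. c k \<odot> t (Suc k))"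
    by (rule finsum_cong') (auto simp: smult_mult_left x2)
  finally have "(- a) \<odot> (serre_sum A c m x z \<otimes> x) = (\<Oplus>k\<in>{..m}. (- a) \<odot> (c k \<odot> t (Suc k)))"
    by (simp add: smult_finsum)
  also have "\<dots> = (\<Oplus>k\<in>{..m}. v (Suc k) \<odot> t (Suc k))"
    by (rule finsum_cong') (auto simp: smult_smult v_def)
  also have "\<dots> = (\<Oplus>k\<in>{..Suc m}. v k \<odot> t k)"
    by (subst finsum_Suc2) (auto simp: v_def)
  finally have 2: "(- a) \<odot> (serre_sum A c m x z \<otimes> x) = (\<Oplus>k\<in>{..Suc m}. v k \<odot> t k)" .
  have "x \<otimes> serre_sum A c m x z \<ominus> a \<odot> (serre_sum A c m x z \<otimes> x)
      = (\<Oplus>k\<in>{..Suc m}. u k \<odot> t k) \<oplus> (\<Oplus>k\<in>{..Suc m}. v k \<odot> t k)"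
    using 1 2 by (simp add: minus_eq smult_neg_l)
  also have "\<dots> = (\<Oplus>k\<in>{..Suc m}. u k \<odot> t k \<oplus> v k \<odot> t k)"
    by (rule finsum_addf[symmetric]) auto
  also have "\<dots> = (\<Oplus>k\<in>{..Suc m}. c' k \<odot> t k)"
  proof (rule finsum_cong')
    fix k assume "k \<in> {..Suc m}"
    then have "u k + v k = c' k" using c0 cs cm by (cases k) (auto simp: u_def v_def)
    then show "u k \<odot> t k \<oplus> v k \<odot> t k = c' k \<odot> t k" by (simp flip: smult_l)
  qed auto
  finally show ?thesis by (simp add: serre_sum_def t_def)
qed

text \<open>Moving y past the iterate \<open>?v n\<close> costs exactly \<open>c n\<close>, the
  factor of the next q-commutator, so the contribution of y to that commutator vanishes. Each step
  puts one more x into the iterate and multiplies the cost by q^2, which forces the factors to be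
  geometric with this ratio.\<close>

lemma qad_add:
  assumes x: "x \<in> carrier A" and y: "y \<in> carrier A" and z: "z \<in> carrier A"
    and yx: "y \<otimes> x = q\<^sup>2 \<odot> (x \<otimes> y)" and yz: "y \<otimes> z = c 0 \<odot> (z \<otimes> y)"
    and c: "\<And>n. c (Suc n) = q\<^sup>2 * c n"
  shows "qad A c (x \<oplus> y) z n = qad A c x z n"
proof -
  let ?v = "qad A c x z"
  have com: "y \<otimes> ?v n = c n \<odot> (?v n \<otimes> y)" for n
  proof (induction n)
    case (Suc n)
    have "y \<otimes> ?v (Suc n) = (y \<otimes> x) \<otimes> ?v n \<ominus> c n \<odot> ((y \<otimes> ?v n) \<otimes> x)"
      using x y z by (simp add: r_diff_distr smult_mult_right m_assoc)
    also have "(y \<otimes> x) \<otimes> ?v n = c (Suc n) \<odot> (x \<otimes> ?v n \<otimes> y)"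
      using x y z by (simp add: yx smult_mult_left smult_mult_right m_assoc Suc smult_smult mult_ac c)
    also have "(y \<otimes> ?v n) \<otimes> x = c (Suc n) \<odot> (?v n \<otimes> x \<otimes> y)"
      using x y z by (simp add: yx smult_mult_left smult_mult_right m_assoc Suc smult_smult mult_ac c)
    finally show ?case
      using x y z by (simp add: l_diff_distr smult_diff_r smult_mult_left smult_smult mult_ac)
  qed (simp add: yz)
  show ?thesis
  proof (induction n)
    case (Suc n)
    have "qad A c (x \<oplus> y) z (Suc n) = (x \<otimes> ?v n \<oplus> y \<otimes> ?v n) \<ominus> (c n \<odot> (?v n \<otimes> x) \<oplus> c n \<odot> (?v n \<otimes> y))"
      using x y z by (simp add: Suc l_distr r_distr smult_r)
    also have "\<dots> = x \<otimes> ?v n \<ominus> c n \<odot> (?v n \<otimes> x)"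
      unfolding com using x y z add_diff_add_left[of "c n \<odot> (?v n \<otimes> y)" "x \<otimes> ?v n" "c n \<odot> (?v n \<otimes> x)"]
      by (simp add: a_comm)
    finally show ?case by simp
  qed simp
qed

end

text \<open>The Gaussian binomial theorem for the commuting operators of left and right multiplication
  by \<open>x\<close>: it factors the Serre sum into q-commutators.\<close>

lemma (in kh_algebra_0) serre_sum_eq_qad:
  assumes q: "qparam q" and x: "x \<in> carrier A" and z: "z \<in> carrier A"
  shows "serre_sum A (\<lambda>k. (- 1) ^ k * qbinom q m k * (\<mu> * q ^ m * inverse q) ^ k) m x z
    = qad A (\<lambda>s. \<mu> * q ^ (2 * s)) x z m"
proof (induction m)
  interpret qparam q by fact
  case 0
  then show ?case using x z by (simp add: serre_sum_def qbinom_0)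
next
  interpret qparam q by fact
  case (Suc m)
  show ?case
    unfolding qad.simps Suc.IH[symmetric]
  proof (rule qad_serre_step[symmetric, OF x z])
    fix k assume k: "k < m"
    have e: "\<mu> * q ^ Suc m * inverse q = \<mu> * q ^ m"
      using q_inv by (simp add: mult.assoc mult.left_commute[of q])
    have qk: "q ^ (m - k) = q ^ m * inverse q ^ k"
    proof -
      have "q ^ m * inverse q ^ k = q ^ (m - k) * (q * inverse q) ^ k"
        using k by (simp add: power_mult_distrib mult.assoc[symmetric] del: q_inv flip: power_add)
      then show ?thesis by simp
    qed
    \<comment> \<open>In the q-Pascal rule the weight q^(-k-1) turns (\<mu> q^m)^(k+1) into (\<mu>
      q^(m-1))^(k+1), and the weight q^(m-k) leaves over \<mu> q^(2m), the factor of the new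
      commutator.\<close>
    show "(- 1) ^ Suc k * qbinom q (Suc m) (Suc k) * (\<mu> * q ^ Suc m * inverse q) ^ Suc k =
      (- 1) ^ Suc k * qbinom q m (Suc k) * (\<mu> * q ^ m * inverse q) ^ Suc k -
      \<mu> * q ^ (2 * m) * ((- 1) ^ k * qbinom q m k * (\<mu> * q ^ m * inverse q) ^ k)"
      unfolding e qbinom_Suc[OF k] qk mult_2 power_add
      by (simp add: power_mult_distrib algebra_simps)
  next
    have e: "\<mu> * q ^ Suc m * inverse q = \<mu> * q ^ m"
      using q_inv by (simp add: mult.assoc mult.left_commute[of q])
    have "(q ^ m * inverse q ^ m) = 1" by (simp flip: power_mult_distrib)
    then have "\<mu> ^ m * (q ^ m) ^ m * q ^ m = \<mu> ^ m * (q ^ m) ^ m * q ^ m * (q ^ m * inverse q ^ m)"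
      by simp
    then have "\<mu> ^ m * (q ^ m) ^ m * q ^ m = (\<mu> * q ^ m * inverse q) ^ m * (q ^ m * q ^ m)"
      by (simp only: power_mult_distrib mult_ac)
    then have "(\<mu> * q ^ m) ^ Suc m = \<mu> * ((\<mu> * q ^ m * inverse q) ^ m * (q ^ m * q ^ m))"
      by (simp only: power_Suc power_mult_distrib mult_ac)
    then show "(- 1) ^ Suc m * qbinom q (Suc m) (Suc m) * (\<mu> * q ^ Suc m * inverse q) ^ Suc m =
      - (\<mu> * q ^ (2 * m)) * ((- 1) ^ m * qbinom q m m * (\<mu> * q ^ m * inverse q) ^ m)"
      unfolding e qbinom_self mult_2 power_add by (simp add: mult_ac)
  qed (simp add: qbinom_0)
qed

text \<open>The roles are x = E_i \<otimes> 1, y = K_i \<otimes> E_i, z = E_j \<otimes> 1, w = K_j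
  \<otimes> E_j. On z the factors are read as \<mu> q^(2s) and absorb y; on w they are read as \<nu>
  q^(-2s) and absorb x. The two equations for \<theta> say that both readings factor the same
  sum.\<close>

lemma (in kh_algebra_0) serre_sum_add:
  assumes q: "qparam q"
    and x: "x \<in> carrier A" and y: "y \<in> carrier A" and z: "z \<in> carrier A" and w: "w \<in> carrier A"
    and yx: "y \<otimes> x = q\<^sup>2 \<odot> (x \<otimes> y)" and yz: "y \<otimes> z = \<mu> \<odot> (z \<otimes> y)" and xw: "x \<otimes> w = \<nu> \<odot> (w \<otimes> x)"
    and \<mu>: "\<theta> = \<mu> * q ^ m * inverse q" and \<nu>: "\<theta> = \<nu> * inverse q ^ m * q"
  defines "c \<equiv> \<lambda>k. (- 1) ^ k * qbinom q m k * \<theta> ^ k"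
  shows "serre_sum A c m (x \<oplus> y) (z \<oplus> w) = serre_sum A c m x z \<oplus> serre_sum A c m y w"
proof -
  interpret qparam q by fact
  have 1: "serre_sum A c m x' z' = qad A (\<lambda>s. \<mu> * q ^ (2 * s)) x' z' m"
    if "x' \<in> carrier A" "z' \<in> carrier A" for x' z'
    unfolding c_def \<mu> by (rule serre_sum_eq_qad[OF q that])
  \<comment> \<open>The second reading is the factorization for the inverse of q; the Gaussian
    binomials do not change.\<close>
  have 2: "serre_sum A c m x' z' = qad A (\<lambda>s. \<nu> * inverse q ^ (2 * s)) x' z' m"
    if "x' \<in> carrier A" "z' \<in> carrier A" for x' z'
    using serre_sum_eq_qad[OF qparam_inverse that, of m \<nu>]
    unfolding c_def \<nu> qbinom_inverse by (simp add: fps_inverse_idempotent)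
  have "(inverse q)\<^sup>2 * q\<^sup>2 = 1" by (simp flip: power_mult_distrib)
  then have xy: "x \<otimes> y = (inverse q)\<^sup>2 \<odot> (y \<otimes> x)"
    unfolding yx using x y by (simp add: smult_smult)
  have "serre_sum A c m (x \<oplus> y) z = serre_sum A c m x z"
    using x y z qad_add[OF x y z yx, of "\<lambda>s. \<mu> * q ^ (2 * s)" m] yz by (simp add: 1 power2_eq_square mult_ac)
  moreover have "serre_sum A c m (x \<oplus> y) w = serre_sum A c m y w"
    using x y w qad_add[OF y x w xy, of "\<lambda>s. \<nu> * inverse q ^ (2 * s)" m] xw
    by (simp add: 2 a_comm power2_eq_square mult_ac)
  ultimately show ?thesis using x y z w by (simp add: serre_sum_add_right)
qed

subsection \<open>Twisted Serre sums\<close>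

context kh_algebra
begin

lemma qcomm_pow_left:
  assumes "x \<in> carrier A" "y \<in> carrier A" "x \<otimes> y = c \<odot> (y \<otimes> x)"
  shows "x [^] (n::nat) \<otimes> y = c ^ n \<odot> (y \<otimes> x [^] n)"
proof (induction n)
  case (Suc n)
  have "x [^] Suc n \<otimes> y = x [^] n \<otimes> (x \<otimes> y)" using assms by (simp add: m_assoc)
  also have "\<dots> = c \<odot> ((x [^] n \<otimes> y) \<otimes> x)" using assms by (simp add: smult_mult_right m_assoc)
  also have "\<dots> = c ^ Suc n \<odot> (y \<otimes> x [^] Suc n)"
    unfolding Suc using assms by (simp add: smult_mult_left smult_smult m_assoc)
  finally show ?case .
qed (use assms in simp)

lemma qcomm_pow_right:
  assumes "x \<in> carrier A" "y \<in> carrier A" "x \<otimes> y = c \<odot> (y \<otimes> x)"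
  shows "x \<otimes> y [^] (n::nat) = c ^ n \<odot> (y [^] n \<otimes> x)"
proof (induction n)
  case (Suc n)
  have "x \<otimes> y [^] Suc n = (x \<otimes> y [^] n) \<otimes> y" using assms by (simp add: m_assoc)
  also have "\<dots> = c ^ n \<odot> (y [^] n \<otimes> (x \<otimes> y))" unfolding Suc using assms by (simp add: smult_mult_left m_assoc)
  also have "\<dots> = c ^ Suc n \<odot> (y [^] Suc n \<otimes> x)"
    using assms by (simp add: smult_mult_right smult_smult m_assoc mult.commute)
  finally show ?case .
qed (use assms in simp)

lemma qcomm_pow_mult:
  assumes g: "g \<in> carrier A" and x: "x \<in> carrier A" and xg: "x \<otimes> g = \<alpha> \<odot> (g \<otimes> x)"
  shows "(g \<otimes> x) [^] n = \<alpha> ^ (n choose 2) \<odot> (g [^] n \<otimes> x [^] n)"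
proof (induction n)
  case (Suc n)
  have "(g \<otimes> x) [^] Suc n = \<alpha> ^ (n choose 2) \<odot> (g [^] n \<otimes> (x [^] n \<otimes> g) \<otimes> x)"
    using g x by (simp add: Suc smult_mult_left m_assoc)
  also have "\<dots> = \<alpha> ^ (Suc n choose 2) \<odot> (g [^] Suc n \<otimes> x [^] Suc n)"
    unfolding qcomm_pow_left[OF x g xg]
    using g x by (simp add: smult_mult_left smult_mult_right smult_smult m_assoc numeral_2_eq_2 power_add mult.commute)
  finally show ?case .
qed (use g x in \<open>simp add: numeral_2_eq_2\<close>)

text \<open>All g and h are moved to the left. The exchanges of x with g number a + b choose 2,
  which depends on a + b alone and hence is the same for every term of a Serre sum; only \<sigma>^a
  \<rho>^b varies.\<close>

lemma twisted_monomial: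
  assumes g: "g \<in> carrier A" and h: "h \<in> carrier A" and x: "x \<in> carrier A" and z: "z \<in> carrier A"
    and xg: "x \<otimes> g = \<alpha> \<odot> (g \<otimes> x)" and xh: "x \<otimes> h = \<sigma> \<odot> (h \<otimes> x)"
    and zg: "z \<otimes> g = \<rho> \<odot> (g \<otimes> z)" and hg: "h \<otimes> g = g \<otimes> h"
  shows "(g \<otimes> x) [^] (a::nat) \<otimes> (h \<otimes> z) \<otimes> (g \<otimes> x) [^] (b::nat)
    = (\<alpha> ^ (a + b choose 2) * \<sigma> ^ a * \<rho> ^ b) \<odot> (g [^] (a + b) \<otimes> h \<otimes> (x [^] a \<otimes> z \<otimes> x [^] b))"
proof -
  \<comment> \<open>Pairs of positions are split into pairs in the first block, pairs in the second
    block, and mixed pairs.\<close>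
  have ch: "(a + b choose 2) = (a choose 2) + (b choose 2) + b * a"
    by (induction b) (simp_all add: numeral_2_eq_2)
  have hg': "h \<otimes> g [^] b = g [^] b \<otimes> h"
    using qcomm_pow_right[OF h g, of 1] hg g h by simp
  note [simp] = g h x z
  have 1: "x [^] a \<otimes> (h \<otimes> z) \<otimes> g [^] b = (\<sigma> ^ a * \<rho> ^ b * \<alpha> ^ (b * a)) \<odot> (g [^] b \<otimes> h \<otimes> (x [^] a \<otimes> z))"
  proof -
    have "x [^] a \<otimes> (h \<otimes> z) \<otimes> g [^] b = (x [^] a \<otimes> h) \<otimes> (z \<otimes> g [^] b)" by (simp add: m_assoc)
    also have "\<dots> = (\<sigma> ^ a * \<rho> ^ b) \<odot> (h \<otimes> (x [^] a \<otimes> g [^] b) \<otimes> z)"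
      unfolding qcomm_pow_left[OF x h xh] qcomm_pow_right[OF z g zg]
      by (simp add: smult_mult_left smult_mult_right smult_smult m_assoc mult.commute)
    also have "x [^] a \<otimes> g [^] b = \<alpha> ^ (b * a) \<odot> (g [^] b \<otimes> x [^] a)"
      using qcomm_pow_left[OF x _ qcomm_pow_right[OF x g xg]] by (simp add: power_mult)
    also have "h \<otimes> (\<alpha> ^ (b * a) \<odot> (g [^] b \<otimes> x [^] a)) \<otimes> z = \<alpha> ^ (b * a) \<odot> ((h \<otimes> g [^] b) \<otimes> (x [^] a \<otimes> z))"
      by (simp add: smult_mult_left smult_mult_right m_assoc)
    finally show ?thesis unfolding hg' by (simp add: smult_smult)
  qed
  have "(g \<otimes> x) [^] a \<otimes> (h \<otimes> z) \<otimes> (g \<otimes> x) [^] b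
    = (\<alpha> ^ (a choose 2) * \<alpha> ^ (b choose 2)) \<odot> (g [^] a \<otimes> (x [^] a \<otimes> (h \<otimes> z) \<otimes> g [^] b) \<otimes> x [^] b)"
    unfolding qcomm_pow_mult[OF g x xg] by (simp add: smult_mult_left smult_mult_right smult_smult m_assoc mult.commute)
  also have "\<dots> = (\<alpha> ^ (a choose 2) * \<alpha> ^ (b choose 2) * (\<sigma> ^ a * \<rho> ^ b * \<alpha> ^ (b * a))) \<odot>
      (g [^] a \<otimes> g [^] b \<otimes> h \<otimes> (x [^] a \<otimes> z \<otimes> x [^] b))"
    unfolding 1 by (simp add: smult_mult_left smult_mult_right smult_smult m_assoc)
  finally show ?thesis by (simp add: ch power_add nat_pow_mult mult_ac)
qed

text \<open>Extracting group-like factors gives a Serre sum with twisted coefficients. For the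
  coproduct the factors lie in different legs and \<sigma> = \<rho> = 1; for the antipode the twist
  is nontrivial and changes \<open>c\<close> into a multiple of \<open>c'\<close>.\<close>

lemma serre_sum_twist:
  assumes g: "g \<in> carrier A" and h: "h \<in> carrier A" and x: "x \<in> carrier A" and z: "z \<in> carrier A"
    and xg: "x \<otimes> g = \<alpha> \<odot> (g \<otimes> x)" and xh: "x \<otimes> h = \<sigma> \<odot> (h \<otimes> x)"
    and zg: "z \<otimes> g = \<rho> \<odot> (g \<otimes> z)" and hg: "h \<otimes> g = g \<otimes> h"
    and c': "\<And>k. k \<le> m \<Longrightarrow> c k * \<sigma> ^ (m - k) * \<rho> ^ k = e * c' k"
  shows "serre_sum A c m (g \<otimes> x) (h \<otimes> z)
    = (\<alpha> ^ (m choose 2) * e) \<odot> (g [^] m \<otimes> h \<otimes> serre_sum A c' m x z)"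
proof -
  note [simp] = g h x z
  have "serre_sum A c m (g \<otimes> x) (h \<otimes> z) =
      (\<Oplus>k\<in>{..m}. (\<alpha> ^ (m choose 2) * e) \<odot> (g [^] m \<otimes> h \<otimes> (c' k \<odot> (x [^] (m - k) \<otimes> z \<otimes> x [^] k))))"
    unfolding serre_sum_def
  proof (rule finsum_cong')
    fix k assume "k \<in> {..m}"
    then have k: "k \<le> m" by simp
    have sc: "c k * (\<alpha> ^ (m choose 2) * \<sigma> ^ (m - k) * \<rho> ^ k) = \<alpha> ^ (m choose 2) * e * c' k"
      using arg_cong[OF c'[OF k], of "\<lambda>t. \<alpha> ^ (m choose 2) * t"] by (simp add: mult_ac)
    from k show "c k \<odot> ((g \<otimes> x) [^] (m - k) \<otimes> (h \<otimes> z) \<otimes> (g \<otimes> x) [^] k) =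
      (\<alpha> ^ (m choose 2) * e) \<odot> (g [^] m \<otimes> h \<otimes> (c' k \<odot> (x [^] (m - k) \<otimes> z \<otimes> x [^] k)))"
      unfolding twisted_monomial[OF g h x z xg xh zg hg]
      by (simp add: smult_smult smult_mult_right sc)
  qed auto
  also have "\<dots> = (\<alpha> ^ (m choose 2) * e) \<odot> (\<Oplus>k\<in>{..m}. g [^] m \<otimes> h \<otimes> (c' k \<odot> (x [^] (m - k) \<otimes> z \<otimes> x [^] k)))"
    by (rule smult_finsum[symmetric]) auto
  also have "(\<Oplus>k\<in>{..m}. g [^] m \<otimes> h \<otimes> (c' k \<odot> (x [^] (m - k) \<otimes> z \<otimes> x [^] k))) = g [^] m \<otimes> h \<otimes> serre_sum A c' m x z"
    unfolding serre_sum_def by (rule finsum_rdistr[symmetric]) auto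
  finally show ?thesis .
qed

text \<open>The substitution k \<mapsto> m - k. It treats both the relations of the F_i and the
  opposite algebra, where monomials appear in reverse order.\<close>

lemma serre_sum_reverse:
  assumes x: "x \<in> carrier A" and z: "z \<in> carrier A"
    and c': "\<And>k. k \<le> m \<Longrightarrow> c (m - k) = e * c' k"
  shows "(\<Oplus>k\<in>{..m}. c k \<odot> (x [^] k \<otimes> z \<otimes> x [^] (m - k))) = e \<odot> serre_sum A c' m x z"
proof -
  note [simp] = x z
  have im: "(\<lambda>k. m - k) ` {..m} = {..m}"
  proof (intro equalityI subsetI)
    show "k \<in> (\<lambda>k. m - k) ` {..m}" if "k \<in> {..m}" for k
      using that by (intro image_eqI[of _ _ "m - k"]) auto
  qed auto
  have "(\<Oplus>k\<in>(\<lambda>k. m - k) ` {..m}. c k \<odot> (x [^] k \<otimes> z \<otimes> x [^] (m - k)))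
      = (\<Oplus>k\<in>{..m}. c (m - k) \<odot> (x [^] (m - k) \<otimes> z \<otimes> x [^] (m - (m - k))))"
    by (rule finsum_reindex) (auto intro!: inj_onI)
  also have "\<dots> = (\<Oplus>k\<in>{..m}. e \<odot> (c' k \<odot> (x [^] (m - k) \<otimes> z \<otimes> x [^] k)))"
    by (rule finsum_cong') (auto simp: c' smult_smult)
  also have "\<dots> = e \<odot> serre_sum A c' m x z"
    unfolding serre_sum_def by (rule smult_finsum[symmetric]) auto
  finally show ?thesis unfolding im .
qed

end

section \<open>The defining relations\<close>

locale fomp =
  fixes A :: "int ^ 'n::finite ^ 'n" and d :: "'n \<Rightarrow> nat"
    and P :: "('k::field_char_0 fps) ^ 'n ^ 'n" and R :: "('k, 'n, 'h) triple"
  assumes gcm: "generalized_cartan_matrix A" and symm: "symmetrizer d A"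
    and ctype: "cartan_type P d A" and real: "realization P R"
begin

definition q :: "'n \<Rightarrow> 'k fps" where "q i = exph (of_nat (d i))"

definition m :: "'n \<Rightarrow> 'n \<Rightarrow> nat" where "m i j = nat (1 - A $ i $ j)"

text \<open>The scalar \<open>q_ij^(1/2) q_ji^(-1/2)\<close> whose powers occur in the Serre
  relations. Exchanging the indices inverts it.\<close>

definition th :: "'n \<Rightarrow> 'n \<Rightarrow> 'k fps" where
  "th i j = exph (fps_const (1 / 2) * P $ i $ j - fps_const (1 / 2) * P $ j $ i)"

text \<open>The scalar \<theta> is kept apart from the indices because \<open>th i j\<close> and its
  inverse \<open>th j i\<close> occur with the same binomials, those determined by
  \<open>(i, j)\<close>.\<close>

definition sc :: "'n \<Rightarrow> 'n \<Rightarrow> 'k fps \<Rightarrow> nat \<Rightarrow> 'k fps" where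
  "sc i j \<theta> k = (- 1) ^ k * qbinom (q i) (m i j) k * \<theta> ^ k"

lemma P_sum: "P $ i $ j + P $ j $ i = of_int (2 * (int (d i) * A $ i $ j))"
proof -
  have "(diag_matrix d ** A) $ i $ j = (\<Sum>k\<in>UNIV. if k = i then int (d i) * A $ k $ j else 0)"
    by (simp add: matrix_matrix_mult_def diag_matrix_def if_distrib[of "\<lambda>x. x * _"] eq_commute cong: if_cong)
  then have D: "(diag_matrix d ** A) $ i $ j = int (d i) * A $ i $ j" by simp
  have "(P + transpose P) $ i $ j = of_int (2 * (diag_matrix d ** A) $ i $ j)"
    using ctype unfolding cartan_type_def by simp
  then show ?thesis by (simp add: D transpose_def)
qed

lemma half_add [simp]: "fps_const (1 / 2) * x + fps_const (1 / 2) * x = (x :: 'k fps)"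
proof -
  have "fps_const (1 / 2) * x + fps_const (1 / 2) * x = fps_const (1 / 2 + 1 / 2) * x"
    by (simp only: distrib_right[symmetric] fps_const_add)
  then show ?thesis by simp
qed

lemma half_2 [simp]: "fps_const (1 / 2) * 2 = (1 :: 'k fps)" "2 * fps_const (1 / 2) = (1 :: 'k fps)"
  using half_add[of 1] by (simp_all add: mult_2 mult_2_right)

lemma d_pos: "d i > 0"
  using symm by (simp add: symmetrizer_def)

lemma qparam_q: "qparam (q i)"
  unfolding q_def by (rule qparam_exph[OF d_pos])

text \<open>The Cartan type condition on the diagonal, where a_ii = 2, reads p_ii = 2 d_i.\<close>

lemma q_square: "(q i)\<^sup>2 = exph (P $ i $ i)"
proof -
  have a: "A $ i $ i = 2" using gcm by (simp add: generalized_cartan_matrix_def)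
  have "P $ i $ i = fps_const (1 / 2) * (P $ i $ i + P $ i $ i)" by (simp add: distrib_left)
  also have "\<dots> = fps_const (1 / 2) * (2 * of_nat (d i) + 2 * of_nat (d i))"
    unfolding P_sum a by (simp add: algebra_simps)
  also have "\<dots> = 2 * of_nat (d i)" by (simp only: distrib_left half_add)
  finally show ?thesis by (simp add: q_def exph_power)
qed

lemma m_eq: "i \<noteq> j \<Longrightarrow> int (m i j) = 1 - A $ i $ j"
proof -
  assume "i \<noteq> j"
  then have "A $ i $ j \<le> 0" using gcm unfolding generalized_cartan_matrix_def by blast
  then show ?thesis by (simp add: m_def)
qed

text \<open>The Cartan type condition enters here: it says that the first and the last root of the
  q-binomial product are the factors by which \<open>K\<^sub>i\<close> commutes with \<open>E\<^sub>j\<close> and \<open>E\<^sub>i\<close> with \<open>K\<^sub>j\<close>.\<close>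

lemma th_eq:
  assumes "i \<noteq> j"
  shows "th i j = exph (P $ i $ j) * q i ^ m i j * inverse (q i)"
    and "th i j = exph (- P $ j $ i) * inverse (q i) ^ m i j * q i"
    and "th j i = exph (P $ j $ i) * q i ^ m i j * inverse (q i)"
    and "th j i = exph (- P $ i $ j) * inverse (q i) ^ m i j * q i"
proof -
  let ?a = "fps_const (1 / 2) * P $ i $ j" and ?b = "fps_const (1 / 2) * P $ j $ i"
  have "of_nat (m i j) * of_nat (d i) = (of_int (int (m i j) * int (d i)) :: 'k fps)" by simp
  also have "\<dots> = of_nat (d i) - of_int (int (d i) * A $ i $ j)"
    unfolding m_eq[OF assms] by (simp add: algebra_simps)
  also have "of_int (int (d i) * A $ i $ j) = (fps_const (1 / 2) + fps_const (1 / 2)) * (of_int (int (d i) * A $ i $ j) :: 'k fps)"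
    by (simp only: distrib_right half_add)
  also have "\<dots> = fps_const (1 / 2) * of_int (2 * (int (d i) * A $ i $ j))"
    by (simp add: algebra_simps)
  also have "\<dots> = ?a + ?b" unfolding P_sum[symmetric] by (simp add: distrib_left)
  finally have md: "of_nat (m i j) * of_nat (d i) = of_nat (d i) - (?a + ?b)" .
  \<comment> \<open>The subtracted sum \<open>?a + ?b\<close> is d_i (1 - m), so subtracting it in
    the exponent multiplies by q_i^(m-1).\<close>
  have e: "exph x = exph y * q i ^ m i j * inverse (q i)" if "x = y - (?a + ?b)" for x y
    unfolding q_def exph_power inverse_exph exph_add[symmetric] md that by (simp add: algebra_simps)
  have e': "exph x = exph y * inverse (q i) ^ m i j * q i" if "x = y + (?a + ?b)" for x y
    unfolding q_def inverse_exph exph_power exph_add[symmetric] that mult_minus_right md by simp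
  have "?a - ?b = (?a + ?a) - (?a + ?b)" "?b - ?a = (?b + ?b) - (?a + ?b)" by simp_all
  from this[unfolded half_add, THEN e]
  show "th i j = exph (P $ i $ j) * q i ^ m i j * inverse (q i)"
    "th j i = exph (P $ j $ i) * q i ^ m i j * inverse (q i)"
    by (simp_all add: th_def)
  have "?a - ?b = - (?b + ?b) + (?a + ?b)" "?b - ?a = - (?a + ?a) + (?a + ?b)" by simp_all
  from this[unfolded half_add, THEN e']
  show "th i j = exph (- P $ j $ i) * inverse (q i) ^ m i j * q i"
    "th j i = exph (- P $ i $ j) * inverse (q i) ^ m i j * q i"
    by (simp_all add: th_def)
qed

lemma serre_coeff_eq: "serre_coeff A d P i j = sc i j (th i j)"
  by (simp add: fun_eq_iff serre_coeff_def sc_def q_def m_def th_def diff_conv_add_uminus exph_add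
      power_mult_distrib mult.assoc del: add_uminus_conv_diff)

lemma th_inverse: "th i j * th j i = 1"
  by (simp add: th_def flip: exph_add)

text \<open>The Gaussian binomial is symmetric and \<theta>^(m-k) = \<theta>^m \<theta>^(-k). So
  reversing a Serre sum inverts \<theta>, up to a unit independent of k.\<close>

lemma sc_reverse:
  assumes "k \<le> m i j"
  shows "sc i j (th a b) (m i j - k) = ((- 1) ^ m i j * th a b ^ m i j) * sc i j (th b a) k"
proof -
  let ?n = "m i j - k"
  have mk: "m i j = ?n + k" using assms by simp
  have t: "th a b ^ m i j * th b a ^ k = th a b ^ ?n"
    by (subst mk) (simp add: power_add mult.assoc th_inverse flip: power_mult_distrib)
  have u: "(- 1 :: 'k fps) ^ m i j * (- 1) ^ k = (- 1) ^ ?n"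
    by (subst mk) (simp add: power_add mult.assoc flip: power_mult_distrib)
  have "((- 1) ^ m i j * th a b ^ m i j) * sc i j (th b a) k
      = ((- 1) ^ m i j * (- 1) ^ k) * qbinom (q i) (m i j) k * (th a b ^ m i j * th b a ^ k)"
    by (simp only: sc_def mult_ac)
  also have "\<dots> = sc i j (th a b) ?n"
    unfolding t u using assms by (simp add: sc_def qbinom_sym)
  finally show ?thesis ..
qed

text \<open>The exponents satisfy (p_ba - p_ab) / 2 + p_ab = p_ba + (p_ab - p_ba) / 2. Hence the
  twist produced by group-like factors also inverts \<theta>, and it compensates the inversion
  caused by reversal.\<close>

lemma sc_twist:
  assumes "k \<le> m i j"
  shows "sc i j (th b a) k * exph (P $ b $ a) ^ (m i j - k) * exph (P $ a $ b) ^ k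
    = exph (P $ b $ a) ^ m i j * sc i j (th a b) k"
proof -
  let ?n = "m i j - k"
  have mk: "m i j = ?n + k" using assms by simp
  have "th b a * exph (P $ a $ b) = exph (P $ b $ a) * th a b"
  proof -
    have ab: "P $ a $ b = fps_const (1 / 2) * P $ a $ b + fps_const (1 / 2) * P $ a $ b"
      "P $ b $ a = fps_const (1 / 2) * P $ b $ a + fps_const (1 / 2) * P $ b $ a" by simp_all
    show ?thesis unfolding th_def exph_add[symmetric]
      by (rule arg_cong[of _ _ exph], subst (2) ab(1), subst (2) ab(2)) (simp add: algebra_simps)
  qed
  then have "th b a ^ k * exph (P $ a $ b) ^ k = exph (P $ b $ a) ^ k * th a b ^ k"
    by (simp flip: power_mult_distrib)
  then have "exph (P $ b $ a) ^ ?n * (th b a ^ k * exph (P $ a $ b) ^ k) = exph (P $ b $ a) ^ m i j * th a b ^ k"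
    by (subst mk) (simp add: power_add mult_ac)
  then show ?thesis by (simp add: sc_def mult_ac)
qed

abbreviation "H \<equiv> carrier (cartan R)"

lemma H_closed: "x \<in> H \<Longrightarrow> y \<in> H \<Longrightarrow> a \<odot>\<^bsub>cartan R\<^esub> x \<oplus>\<^bsub>cartan R\<^esub> b \<odot>\<^bsub>cartan R\<^esub> y \<in> H"
proof -
  assume "x \<in> H" "y \<in> H"
  interpret Module.module kh "cartan R" using real by (simp add: realization_def free_finite_rank_def)
  show ?thesis using \<open>x \<in> H\<close> \<open>y \<in> H\<close> by simp
qed

lemma T_carrier [simp]: "Tplus R i \<in> H" "Tminus R i \<in> H"
  using real by (auto simp: realization_def)

lemma root_T [simp]: "root R j (Tplus R i) = P $ i $ j" "root R j (Tminus R i) = P $ j $ i"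
  using real by (auto simp: realization_def)

definition cc :: "'n \<Rightarrow> 'k fps" where
  "cc i = fps_X / (exph (of_nat (d i)) - inverse (exph (of_nat (d i))))"

end

text \<open>The commutator relation [t, y] = a y, written without subtraction so that it can serve
  as an exchange rule.\<close>

definition eig :: "('k::field fps, 'a) module \<Rightarrow> 'a \<Rightarrow> 'a \<Rightarrow> 'k fps \<Rightarrow> bool" where
  "eig A t y a \<longleftrightarrow> t \<otimes>\<^bsub>A\<^esub> y = y \<otimes>\<^bsub>A\<^esub> t \<oplus>\<^bsub>A\<^esub> a \<odot>\<^bsub>A\<^esub> y"

context kh_algebra
begin

lemma eq_diff_iff:
  assumes "x \<in> carrier A" "y \<in> carrier A" "z \<in> carrier A"
  shows "x \<ominus> y = z \<longleftrightarrow> x = y \<oplus> z"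
proof
  assume "x \<ominus> y = z"
  then show "x = y \<oplus> z" using diff_add_cancel[of x y] assms by (simp add: a_comm)
next
  assume "x = y \<oplus> z"
  then show "x \<ominus> y = z" using add_diff_add_left[of y z "\<zero>"] assms by (simp add: minus_eq)
qed

lemma eig_iff_diff:
  "t \<in> carrier A \<Longrightarrow> y \<in> carrier A \<Longrightarrow> eig A t y a \<longleftrightarrow> t \<otimes> y \<ominus> y \<otimes> t = a \<odot> y"
  by (simp add: eig_def eq_diff_iff)

lemma eig_0: "t \<in> carrier A \<Longrightarrow> y \<in> carrier A \<Longrightarrow> eig A t y 0 \<longleftrightarrow> t \<otimes> y = y \<otimes> t"
  by (simp add: eig_def)

lemma eig_add_left:
  assumes "eig A t y a" "eig A s y b" "t \<in> carrier A" "s \<in> carrier A" "y \<in> carrier A"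
  shows "eig A (t \<oplus> s) y (a + b)"
  using assms unfolding eig_def by (simp add: l_distr r_distr smult_l a_ac)

lemma eig_add_right:
  assumes "eig A t y a" "eig A t z a" "t \<in> carrier A" "y \<in> carrier A" "z \<in> carrier A"
  shows "eig A t (y \<oplus> z) a"
  using assms unfolding eig_def by (simp add: l_distr r_distr smult_r a_ac)

lemma eig_mult:
  assumes "eig A t y a" "eig A t z b" "t \<in> carrier A" "y \<in> carrier A" "z \<in> carrier A"
  shows "eig A t (y \<otimes> z) (a + b)"
proof -
  have "t \<otimes> (y \<otimes> z) = (t \<otimes> y) \<otimes> z" using assms by (simp add: m_assoc)
  also have "\<dots> = y \<otimes> (t \<otimes> z) \<oplus> a \<odot> (y \<otimes> z)"
    using assms(3-) unfolding assms(1)[unfolded eig_def] by (simp add: l_distr m_assoc smult_mult_left)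
  also have "\<dots> = (y \<otimes> z) \<otimes> t \<oplus> (a + b) \<odot> (y \<otimes> z)"
    using assms(3-) unfolding assms(2)[unfolded eig_def]
    by (simp add: r_distr m_assoc smult_mult_right smult_l a_ac)
  finally show ?thesis by (simp add: eig_def)
qed

lemma eig_smult: "eig A t y a \<Longrightarrow> t \<in> carrier A \<Longrightarrow> y \<in> carrier A \<Longrightarrow> eig A t (c \<odot> y) a"
  unfolding eig_def by (simp add: smult_mult_left smult_mult_right smult_r smult_smult mult.commute)

lemma eig_neg_right: "eig A t y a \<Longrightarrow> t \<in> carrier A \<Longrightarrow> y \<in> carrier A \<Longrightarrow> eig A t (\<ominus> y) a"
  using eig_smult[of t y a "-1"] by (simp add: smult_neg_l)

lemma eig_neg_left:
  assumes "eig A t y a" "t \<in> carrier A" "y \<in> carrier A" shows "eig A (\<ominus> t) y (- a)"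
  unfolding eig_def using assms(2,3) by (simp add: l_minus r_minus smult_neg_l minus_add assms(1)[unfolded eig_def])

end

lemma (in complete_alg) hexp_eig:
  assumes "eig A t y a" "t \<in> carrier A" "y \<in> carrier A"
  shows "hexp A t \<otimes> y = exph a \<odot> (y \<otimes> hexp A t)" "y \<otimes> hexp A t = exph (- a) \<odot> (hexp A t \<otimes> y)"
proof -
  show 1: "hexp A t \<otimes> y = exph a \<odot> (y \<otimes> hexp A t)"
    by (rule hexp_eigen) (use assms in \<open>simp_all add: eig_iff_diff\<close>)
  show "y \<otimes> hexp A t = exph (- a) \<odot> (hexp A t \<otimes> y)"
    unfolding 1 using assms by (simp add: smult_smult)
qed

text \<open>A solution of the defining relations in a complete algebra, in the form convenient for
  checking. Commutators are exchange rules, and the relation of the F_i is rewritten with the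
  monomial order of the E_i, at the price of replacing \<open>th i j\<close> by its inverse
  \<open>th j i\<close>.\<close>

locale mpq = fomp A d P R + complete_alg B
  for A :: "int ^ 'n::finite ^ 'n" and d and P :: "('k::field_char_0 fps) ^ 'n ^ 'n"
    and R :: "('k, 'n, 'h) triple" and B :: "('k fps, 'b) module" (structure) +
  fixes T :: "'h \<Rightarrow> 'b" and E F :: "'n \<Rightarrow> 'b"
  assumes T_closed [simp]: "x \<in> H \<Longrightarrow> T x \<in> carrier B"
    and E_closed [simp]: "E i \<in> carrier B" and F_closed [simp]: "F i \<in> carrier B"
    and T_lin: "x \<in> H \<Longrightarrow> y \<in> H \<Longrightarrow>
      T (a \<odot>\<^bsub>cartan R\<^esub> x \<oplus>\<^bsub>cartan R\<^esub> b \<odot>\<^bsub>cartan R\<^esub> y) = a \<odot> T x \<oplus> b \<odot> T y"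
    and TE: "x \<in> H \<Longrightarrow> eig B (T x) (E j) (root R j x)"
    and TF: "x \<in> H \<Longrightarrow> eig B (T x) (F j) (- root R j x)"
    and TT: "x \<in> H \<Longrightarrow> y \<in> H \<Longrightarrow> T x \<otimes> T y = T y \<otimes> T x"
    and EF: "E i \<otimes> F j = F j \<otimes> E i \<oplus>
      (if i = j then cc i \<odot> hexp_diff_quot B (T (Tplus R i)) (T (Tminus R i)) else \<zero>)"
    and SE: "i \<noteq> j \<Longrightarrow> serre_sum B (sc i j (th i j)) (m i j) (E i) (E j) = \<zero>"
    and SF: "i \<noteq> j \<Longrightarrow> serre_sum B (sc i j (th j i)) (m i j) (F i) (F j) = \<zero>"

lemma (in complete_alg) hdq_closed [simp]:
  "x \<in> carrier A \<Longrightarrow> y \<in> carrier A \<Longrightarrow> hexp_diff_quot A x y \<in> carrier A"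
  by (simp add: hexp_diff_quot_eq)

lemma (in fomp) serre_F_eq:
  assumes "kh_algebra B" "x \<in> carrier B" "z \<in> carrier B"
  shows "(\<Oplus>\<^bsub>B\<^esub>k\<in>{..m i j}. sc i j (th a b) k \<odot>\<^bsub>B\<^esub> (x [^]\<^bsub>B\<^esub> k \<otimes>\<^bsub>B\<^esub> z \<otimes>\<^bsub>B\<^esub> x [^]\<^bsub>B\<^esub> (m i j - k)))
    = ((- 1) ^ m i j * th a b ^ m i j) \<odot>\<^bsub>B\<^esub> serre_sum B (sc i j (th b a)) (m i j) x z"
  by (rule kh_algebra.serre_sum_reverse[OF assms]) (rule sc_reverse)

text \<open>The factor relating the two sums is a unit: exchanging \<open>a\<close> and
  \<open>b\<close> in it gives its inverse.\<close>

lemma (in fomp) serre_F_zero_iff: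
  assumes "kh_algebra B" "x \<in> carrier B" "z \<in> carrier B"
  shows "(\<Oplus>\<^bsub>B\<^esub>k\<in>{..m i j}. sc i j (th a b) k \<odot>\<^bsub>B\<^esub> (x [^]\<^bsub>B\<^esub> k \<otimes>\<^bsub>B\<^esub> z \<otimes>\<^bsub>B\<^esub> x [^]\<^bsub>B\<^esub> (m i j - k))) = \<zero>\<^bsub>B\<^esub>
    \<longleftrightarrow> serre_sum B (sc i j (th b a)) (m i j) x z = \<zero>\<^bsub>B\<^esub>" (is "?L = _ \<longleftrightarrow> ?S = _")
proof -
  interpret kh_algebra B by fact
  let ?e = "(- 1) ^ m i j * th a b ^ m i j" and ?e' = "(- 1) ^ m i j * th b a ^ m i j"
  have "?e' * ?e = ((- 1) * (- 1)) ^ m i j * (th b a * th a b) ^ m i j"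
    by (simp only: power_mult_distrib mult_ac)
  then have "?S = ?e' \<odot>\<^bsub>B\<^esub> (?e \<odot>\<^bsub>B\<^esub> ?S)" using assms(2,3) by (simp add: smult_smult th_inverse)
  moreover have "?L = ?e \<odot>\<^bsub>B\<^esub> ?S" by (rule serre_F_eq[OF assms])
  ultimately show ?thesis by (metis smult_0r)
qed

text \<open>The link between the presentation and \<open>mpq\<close>. Apart from the reversed
  F-Serre sum, which changes by a unit, each relator only has a term moved to the other
  side.\<close>

lemma (in fomp) relators_iff:
  fixes B :: "('k fps, 'b) module" (structure) and g :: "('n, 'h) generator \<Rightarrow> 'b"
  assumes B: "complete_alg B"
    and T: "\<And>x. x \<in> H \<Longrightarrow> g (GenT x) \<in> carrier B" and E: "\<And>i. g (GenE i) \<in> carrier B"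
    and F: "\<And>i. g (GenF i) \<in> carrier B"
  shows "relators A d P R B g \<subseteq> {\<zero>} \<longleftrightarrow>
    mpq A d P R B (\<lambda>x. g (GenT x)) (\<lambda>i. g (GenE i)) (\<lambda>i. g (GenF i))"
proof -
  interpret complete_alg B by fact
  note [simp] = T E F H_closed
  have SFe: "(\<Oplus>k\<in>{..m i j}. sc i j (th i j) k \<odot> (g (GenF i) [^] k \<otimes> g (GenF j) \<otimes> g (GenF i) [^] (m i j - k))) = \<zero>
    \<longleftrightarrow> serre_sum B (sc i j (th j i)) (m i j) (g (GenF i)) (g (GenF j)) = \<zero>" for i j
    by (rule serre_F_zero_iff[OF kh_algebra_axioms]) simp_all
  have rel: "relators A d P R B g \<subseteq> {\<zero>} \<longleftrightarrow>
    (\<forall>a b x y. x \<in> H \<and> y \<in> H \<longrightarrow> g (GenT (a \<odot>\<^bsub>cartan R\<^esub> x \<oplus>\<^bsub>cartan R\<^esub> b \<odot>\<^bsub>cartan R\<^esub> y)) = a \<odot> g (GenT x) \<oplus> b \<odot> g (GenT y)) \<and>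
    (\<forall>x j. x \<in> H \<longrightarrow> eig B (g (GenT x)) (g (GenE j)) (root R j x)) \<and>
    (\<forall>x j. x \<in> H \<longrightarrow> eig B (g (GenT x)) (g (GenF j)) (- root R j x)) \<and>
    (\<forall>x y. x \<in> H \<and> y \<in> H \<longrightarrow> g (GenT x) \<otimes> g (GenT y) = g (GenT y) \<otimes> g (GenT x)) \<and>
    (\<forall>i j. g (GenE i) \<otimes> g (GenF j) = g (GenF j) \<otimes> g (GenE i) \<oplus>
      (if i = j then cc i \<odot> hexp_diff_quot B (g (GenT (Tplus R i))) (g (GenT (Tminus R i))) else \<zero>)) \<and>
    (\<forall>i j. i \<noteq> j \<longrightarrow> serre_sum B (sc i j (th i j)) (m i j) (g (GenE i)) (g (GenE j)) = \<zero>) \<and>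
    (\<forall>i j. i \<noteq> j \<longrightarrow> serre_sum B (sc i j (th j i)) (m i j) (g (GenF i)) (g (GenF j)) = \<zero>)"
    (is "?S1 \<longleftrightarrow> ?S2")
  proof -
    have sub: "X \<union> Y \<subseteq> {\<zero>} \<longleftrightarrow> X \<subseteq> {\<zero>} \<and> Y \<subseteq> {\<zero>}" for X Y :: "'b set" by blast
    have c4: "{f a b x y |a b x y. Q x y} \<subseteq> {\<zero>} \<longleftrightarrow> (\<forall>a b x y. Q x y \<longrightarrow> f a b x y = \<zero>)"
      for f :: "'k fps \<Rightarrow> 'k fps \<Rightarrow> 'h \<Rightarrow> 'h \<Rightarrow> 'b" and Q by blast
    have c2: "{f x y |x y. Q x y} \<subseteq> {\<zero>} \<longleftrightarrow> (\<forall>x y. Q x y \<longrightarrow> f x y = \<zero>)"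
      for f :: "'x \<Rightarrow> 'y \<Rightarrow> 'b" and Q by blast
    show ?thesis
      unfolding relators_def Let_def sub conj_assoc serre_coeff_eq m_def[symmetric] cc_def[symmetric]
        serre_sum_def[symmetric] c4 SFe[symmetric]
      unfolding c2
      by (intro arg_cong2[of _ _ _ _ "(\<and>)"] all_cong1 imp_cong refl)
        (auto simp: eig_iff_diff eq_diff_iff[symmetric])
  qed
  show ?thesis unfolding rel
  proof
    assume "?S2"
    then show "mpq A d P R B (\<lambda>x. g (GenT x)) (\<lambda>i. g (GenE i)) (\<lambda>i. g (GenF i))"
      by (intro mpq.intro mpq_axioms.intro fomp_axioms B) auto
  next
    assume "mpq A d P R B (\<lambda>x. g (GenT x)) (\<lambda>i. g (GenE i)) (\<lambda>i. g (GenF i))"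
    then interpret M: mpq A d P R B "\<lambda>x. g (GenT x)" "\<lambda>i. g (GenE i)" "\<lambda>i. g (GenF i)" .
    show ?S2 using M.T_lin M.TE M.TF M.TT M.EF M.SE M.SF by blast
  qed
qed

section \<open>Group-like identities divided by \<hbar>\<close>

lemma (in complete_alg) hphi_commute2:
  assumes "x \<in> carrier A" "y \<in> carrier A" "x \<otimes> y = y \<otimes> x"
  shows "hexp A x \<otimes> hphi A y = hphi A y \<otimes> hexp A x"
    and "hphi A x \<otimes> hphi A y = hphi A y \<otimes> hphi A x"
    and "hexp A x \<otimes> hexp A y = hexp A y \<otimes> hexp A x"
proof -
  have "y \<otimes> hexp A x = hexp A x \<otimes> y" "y \<otimes> hphi A x = hphi A x \<otimes> y"
    using hexp_commute[of x x y] assms by simp_all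
  then show "hexp A x \<otimes> hphi A y = hphi A y \<otimes> hexp A x"
    "hphi A x \<otimes> hphi A y = hphi A y \<otimes> hphi A x"
    "hexp A x \<otimes> hexp A y = hexp A y \<otimes> hexp A x"
    using hexp_commute[of y y "hexp A x"] hexp_commute[of y y "hphi A x"] assms by simp_all
qed

text \<open>Here \<open>z\<close> will be the mixed term of order \<hbar>, which enters twice with
  opposite signs.\<close>

lemma (in kh_algebra) cancel_cross:
  assumes "a \<in> carrier A" "b \<in> carrier A" "c \<in> carrier A" "e \<in> carrier A" "z \<in> carrier A"
  shows "((a \<oplus> z) \<ominus> b) \<oplus> (c \<ominus> (e \<oplus> z)) = (a \<oplus> c) \<ominus> (e \<oplus> b)"
proof -
  have "((a \<oplus> z) \<ominus> b) \<oplus> (c \<ominus> (e \<oplus> z)) = (z \<oplus> (a \<oplus> c)) \<ominus> (z \<oplus> (e \<oplus> b))"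
    using assms by (simp add: minus_eq minus_add a_ac)
  then show ?thesis using assms by (simp add: add_diff_add_left)
qed

text \<open>This is \<open>(K - L) \<otimes> L + K \<otimes> (K - L) = K \<otimes> K - L \<otimes> L\<close> divided by \<open>\<hbar>\<close>; the division is
  carried out on power series because the algebra may have \<open>\<hbar>\<close>-torsion.\<close>

lemma (in complete_alg) hdq_add:
  assumes [simp]: "x1 \<in> carrier A" "x2 \<in> carrier A" "y1 \<in> carrier A" "y2 \<in> carrier A"
    and x: "x1 \<otimes> x2 = x2 \<otimes> x1" and y: "y1 \<otimes> y2 = y2 \<otimes> y1" and xy: "x1 \<otimes> y2 = y2 \<otimes> x1"
  shows "hexp_diff_quot A (x1 \<oplus> x2) (y1 \<oplus> y2)
    = hexp_diff_quot A x1 y1 \<otimes> hexp A (\<ominus> y2) \<oplus> hexp A x1 \<otimes> hexp_diff_quot A x2 y2"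
proof -
  let ?f1 = "hphi A x1" and ?f2 = "hphi A x2" and ?g1 = "hphi A (\<ominus> y1)" and ?g2 = "hphi A (\<ominus> y2)"
  let ?K = "hexp A x1" and ?L = "hexp A (\<ominus> y2)"
  let ?z = "fps_X \<odot> (?f1 \<otimes> ?g2)"
  have f: "hphi A (x1 \<oplus> x2) = ?f1 \<oplus> ?K \<otimes> ?f2"
    using hphi_add[of x2 x1] hphi_commute2(1)[of x1 x2] x by (simp add: a_comm)
  have g: "hphi A (\<ominus> (y1 \<oplus> y2)) = ?g2 \<oplus> ?g1 \<otimes> ?L"
    using hphi_add[of "\<ominus> y1" "\<ominus> y2"] y by (simp add: minus_add l_minus r_minus)
  have "x1 \<otimes> \<ominus> y2 = \<ominus> y2 \<otimes> x1" using xy by (simp add: l_minus r_minus)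
  then have fg: "?f1 \<otimes> ?g2 = ?g2 \<otimes> ?f1" by (intro hphi_commute2) simp_all
  \<comment> \<open>Expanding L as 1 + \<hbar> \<open>?g2\<close> here and K as 1 + \<hbar>
    \<open>?f1\<close> below produces the same mixed term \<open>?z\<close>, so it cancels with no
    division.\<close>
  have 1: "?f1 \<otimes> ?L = ?f1 \<oplus> ?z" by (simp add: hexp_hphi r_distr smult_mult_right)
  have 2: "?K \<otimes> ?g2 = ?g2 \<oplus> ?z" by (simp add: hexp_hphi l_distr smult_mult_left)
  have "hexp_diff_quot A x1 y1 \<otimes> ?L \<oplus> ?K \<otimes> hexp_diff_quot A x2 y2
      = ((?f1 \<oplus> ?z) \<ominus> ?g1 \<otimes> ?L) \<oplus> (?K \<otimes> ?f2 \<ominus> (?g2 \<oplus> ?z))"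
    by (simp add: hexp_diff_quot_eq l_diff_distr r_diff_distr 1 2)
  also have "\<dots> = (?f1 \<oplus> ?K \<otimes> ?f2) \<ominus> (?g2 \<oplus> ?g1 \<otimes> ?L)"
    by (rule cancel_cross) simp_all
  finally show ?thesis by (simp add: hexp_diff_quot_eq f g)
qed

lemma (in complete_alg) hphi_neg:
  assumes [simp]: "x \<in> carrier A"
  shows "hphi A x \<otimes> hexp A (\<ominus> x) = \<ominus> hphi A (\<ominus> x)"
proof -
  have "hphi A (x \<oplus> \<ominus> x) = hphi A (\<ominus> x) \<oplus> hphi A x \<otimes> hexp A (\<ominus> x)"
    by (rule hphi_add) (simp_all add: l_minus r_minus)
  then have "hphi A x \<otimes> hexp A (\<ominus> x) \<oplus> hphi A (\<ominus> x) = \<zero>"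
    by (simp add: r_neg hphi_zero a_comm)
  then show ?thesis using minus_equality[of "hphi A x \<otimes> hexp A (\<ominus> x)" "hphi A (\<ominus> x)"] by simp
qed

text \<open>For K = exp (\<hbar> x) and L = exp (- \<hbar> y) this is the negative of K^(-1) (K - L)
  L^(-1) = L^(-1) - K^(-1), divided by \<hbar>. It is the form taken by the E-F relation under the
  antipode.\<close>

lemma (in complete_alg) hdq_neg:
  assumes [simp]: "x \<in> carrier A" "y \<in> carrier A" and xy: "x \<otimes> y = y \<otimes> x"
  shows "\<ominus> (hexp A (\<ominus> x) \<otimes> hexp_diff_quot A x y \<otimes> hexp A y) = hexp_diff_quot A (\<ominus> x) (\<ominus> y)"
proof -
  let ?f = "hphi A (\<ominus> x)" and ?g = "hphi A y"
  let ?K = "hexp A (\<ominus> x)" and ?L = "hexp A y"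
  let ?z = "fps_X \<odot> (?f \<otimes> ?g)"
  have Kf: "?K \<otimes> hphi A x = \<ominus> ?f"
    using hphi_neg[of x] hphi_commute2(1)[of "\<ominus> x" x] by (simp add: l_minus r_minus)
  have gL: "hphi A (\<ominus> y) \<otimes> ?L = \<ominus> ?g" using hphi_neg[of "\<ominus> y"] by simp
  have 1: "?f \<otimes> ?L = ?f \<oplus> ?z" by (simp add: hexp_hphi r_distr smult_mult_right)
  have 2: "?K \<otimes> ?g = ?g \<oplus> ?z" by (simp add: hexp_hphi l_distr smult_mult_left)
  have "?K \<otimes> hexp_diff_quot A x y \<otimes> ?L = (?K \<otimes> hphi A x) \<otimes> ?L \<ominus> ?K \<otimes> (hphi A (\<ominus> y) \<otimes> ?L)"
    by (simp add: hexp_diff_quot_eq l_diff_distr r_diff_distr m_assoc)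
  \<comment> \<open>\<open>z\<close> abbreviates the mixed term of order \<hbar>, which occurs in
    both differences and drops out.\<close>
  also have "\<dots> = (z \<oplus> ?g) \<ominus> (z \<oplus> ?f)" if "z = ?z" for z
    unfolding Kf gL by (simp add: l_minus r_minus 1 2 that minus_eq a_ac)
  finally have "?K \<otimes> hexp_diff_quot A x y \<otimes> ?L = ?g \<ominus> ?f"
    by (simp add: add_diff_add_left)
  then show ?thesis by (simp add: hexp_diff_quot_eq minus_eq minus_add a_comm)
qed

section \<open>Commutation with the group-like elements\<close>

context mpq
begin

text \<open>K_i and L_i are the two exponentials in the E-F relation. The minus sign is part of L_i,
  and a prime denotes the inverse.\<close>

abbreviation "K i \<equiv> hexp B (T (Tplus R i))"
abbreviation "K' i \<equiv> hexp B (\<ominus> T (Tplus R i))"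
abbreviation "L i \<equiv> hexp B (\<ominus> T (Tminus R i))"
abbreviation "L' i \<equiv> hexp B (T (Tminus R i))"

lemma KE: "K i \<otimes> E j = exph (P $ i $ j) \<odot> (E j \<otimes> K i)" "E j \<otimes> K i = exph (- P $ i $ j) \<odot> (K i \<otimes> E j)"
  and KF: "K i \<otimes> F j = exph (- P $ i $ j) \<odot> (F j \<otimes> K i)" "F j \<otimes> K i = exph (P $ i $ j) \<odot> (K i \<otimes> F j)"
  and L'E: "L' i \<otimes> E j = exph (P $ j $ i) \<odot> (E j \<otimes> L' i)" "E j \<otimes> L' i = exph (- P $ j $ i) \<odot> (L' i \<otimes> E j)"
  and L'F: "L' i \<otimes> F j = exph (- P $ j $ i) \<odot> (F j \<otimes> L' i)" "F j \<otimes> L' i = exph (P $ j $ i) \<odot> (L' i \<otimes> F j)"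
  using hexp_eig[OF TE[of "Tplus R i" j]] hexp_eig[OF TF[of "Tplus R i" j]]
    hexp_eig[OF TE[of "Tminus R i" j]] hexp_eig[OF TF[of "Tminus R i" j]] by simp_all

lemma K'E: "K' i \<otimes> E j = exph (- P $ i $ j) \<odot> (E j \<otimes> K' i)" "E j \<otimes> K' i = exph (P $ i $ j) \<odot> (K' i \<otimes> E j)"
  and K'F: "K' i \<otimes> F j = exph (P $ i $ j) \<odot> (F j \<otimes> K' i)" "F j \<otimes> K' i = exph (- P $ i $ j) \<odot> (K' i \<otimes> F j)"
  and LE: "L i \<otimes> E j = exph (- P $ j $ i) \<odot> (E j \<otimes> L i)" "E j \<otimes> L i = exph (P $ j $ i) \<odot> (L i \<otimes> E j)"
  and LF: "L i \<otimes> F j = exph (P $ j $ i) \<odot> (F j \<otimes> L i)" "F j \<otimes> L i = exph (- P $ j $ i) \<odot> (L i \<otimes> F j)"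
  using hexp_eig[OF eig_neg_left[OF TE[of "Tplus R i" j]]] hexp_eig[OF eig_neg_left[OF TF[of "Tplus R i" j]]]
    hexp_eig[OF eig_neg_left[OF TE[of "Tminus R i" j]]] hexp_eig[OF eig_neg_left[OF TF[of "Tminus R i" j]]]
  by simp_all

lemma TT_neg:
  assumes "x \<in> H" "y \<in> H"
  shows "T x \<otimes> \<ominus> T y = \<ominus> T y \<otimes> T x" "\<ominus> T x \<otimes> T y = T y \<otimes> \<ominus> T x" "\<ominus> T x \<otimes> \<ominus> T y = \<ominus> T y \<otimes> \<ominus> T x"
  using TT[OF assms] assms by (simp_all add: l_minus r_minus)

lemma KK: "K i \<otimes> K j = K j \<otimes> K i" and LL: "L i \<otimes> L j = L j \<otimes> L i"
  and K'K': "K' i \<otimes> K' j = K' j \<otimes> K' i" and L'L': "L' i \<otimes> L' j = L' j \<otimes> L' i"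
  and K'L': "K' i \<otimes> L' j = L' j \<otimes> K' i"
  by (rule hphi_commute2(3); (rule TT | rule TT_neg | simp); simp)+

lemma eig_T_hexp:
  assumes "x \<in> H" "y \<in> H" shows "eig B (T x) (hexp B (T y)) 0" "eig B (T x) (hexp B (\<ominus> T y)) 0"
proof -
  have "T x \<otimes> hexp B (T y) = hexp B (T y) \<otimes> T x"
    by (rule hexp_commute(1)[symmetric]) (use assms in \<open>auto intro: TT\<close>)
  moreover have "T x \<otimes> hexp B (\<ominus> T y) = hexp B (\<ominus> T y) \<otimes> T x"
    by (rule hexp_commute(1)[symmetric]) (use assms in \<open>auto intro: TT_neg\<close>)
  ultimately show "eig B (T x) (hexp B (T y)) 0" "eig B (T x) (hexp B (\<ominus> T y)) 0"
    using assms by (simp_all add: eig_0)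
qed

end

subsection \<open>Compatibility with the coproduct\<close>

text \<open>Subscripts name the tensor leg. Of the four commutators, e_1 with f_1 l_2 gives w_1 l_2,
  k_1 e_2 with f_2 gives k_1 w_2, and e_1 with f_2 gives nothing. In the remaining one, the scalar
  for k_1 past f_1 cancels the scalar for e_2 past l_2.\<close>

lemma (in kh_algebra) cross_commutator:
  assumes [simp]: "e1 \<in> carrier A" "f1 \<in> carrier A" "k1 \<in> carrier A" "w1 \<in> carrier A"
      "e2 \<in> carrier A" "f2 \<in> carrier A" "l2 \<in> carrier A" "w2 \<in> carrier A"
    and w1: "e1 \<otimes> f1 = f1 \<otimes> e1 \<oplus> w1" and w2: "e2 \<otimes> f2 = f2 \<otimes> e2 \<oplus> w2"
    and kf: "k1 \<otimes> f1 = a \<odot> (f1 \<otimes> k1)" and el: "e2 \<otimes> l2 = b \<odot> (l2 \<otimes> e2)" and ab: "a * b = 1"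
    and com: "e1 \<otimes> l2 = l2 \<otimes> e1" "e1 \<otimes> f2 = f2 \<otimes> e1" "f1 \<otimes> e2 = e2 \<otimes> f1" "k1 \<otimes> l2 = l2 \<otimes> k1" "k1 \<otimes> f2 = f2 \<otimes> k1"
  shows "(e1 \<oplus> k1 \<otimes> e2) \<otimes> (f1 \<otimes> l2 \<oplus> f2) = (f1 \<otimes> l2 \<oplus> f2) \<otimes> (e1 \<oplus> k1 \<otimes> e2) \<oplus> (w1 \<otimes> l2 \<oplus> k1 \<otimes> w2)"
proof -
  have 1: "e1 \<otimes> (f1 \<otimes> l2) = (f1 \<otimes> l2) \<otimes> e1 \<oplus> w1 \<otimes> l2"
  proof -
    have "e1 \<otimes> (f1 \<otimes> l2) = (e1 \<otimes> f1) \<otimes> l2" by (simp add: m_assoc)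
    also have "\<dots> = f1 \<otimes> (e1 \<otimes> l2) \<oplus> w1 \<otimes> l2" unfolding w1 by (simp add: l_distr m_assoc)
    finally show ?thesis unfolding com by (simp add: m_assoc)
  qed
  have 2: "(k1 \<otimes> e2) \<otimes> f2 = f2 \<otimes> (k1 \<otimes> e2) \<oplus> k1 \<otimes> w2"
  proof -
    have "(k1 \<otimes> e2) \<otimes> f2 = k1 \<otimes> (e2 \<otimes> f2)" by (simp add: m_assoc)
    also have "\<dots> = (k1 \<otimes> f2) \<otimes> e2 \<oplus> k1 \<otimes> w2" unfolding w2 by (simp add: r_distr m_assoc)
    finally show ?thesis unfolding com by (simp add: m_assoc)
  qed
  have 3: "(k1 \<otimes> e2) \<otimes> (f1 \<otimes> l2) = (f1 \<otimes> l2) \<otimes> (k1 \<otimes> e2)"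
  proof -
    have "(k1 \<otimes> e2) \<otimes> (f1 \<otimes> l2) = k1 \<otimes> (e2 \<otimes> f1) \<otimes> l2" by (simp add: m_assoc)
    also have "\<dots> = (k1 \<otimes> f1) \<otimes> (e2 \<otimes> l2)" unfolding com(3)[symmetric] by (simp add: m_assoc)
    also have "\<dots> = f1 \<otimes> (k1 \<otimes> l2) \<otimes> e2"
      unfolding kf el by (simp add: smult_mult_left smult_mult_right smult_smult m_assoc ab mult.commute[of b a])
    finally show ?thesis unfolding com by (simp add: m_assoc)
  qed
  show ?thesis
    by (simp add: l_distr r_distr 1 2 3 com(2) a_ac)
qed

text \<open>The homomorphisms \<open>f1\<close> and \<open>f2\<close> stand for a \<mapsto> a
  \<otimes> 1 and b \<mapsto> 1 \<otimes> b. That their images commute is all that the relations for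
  the coproduct require of the tensor product.\<close>

locale mpq_comult = mpq A d P R U T E F + B: complete_alg B + f1: alg_hom U B f1 + f2: alg_hom U B f2
  for A :: "int ^ 'n::finite ^ 'n" and d and P :: "('k::field_char_0 fps) ^ 'n ^ 'n"
    and R :: "('k, 'n, 'h) triple" and U :: "('k fps, 'b) module" (structure) and T E F
    and B :: "('k fps, 'c) module" and f1 f2 +
  assumes com: "u \<in> carrier U \<Longrightarrow> v \<in> carrier U \<Longrightarrow> f1 u \<otimes>\<^bsub>B\<^esub> f2 v = f2 v \<otimes>\<^bsub>B\<^esub> f1 u"
begin

lemma comult_relations:
  "mpq A d P R B (\<lambda>x. f1 (T x) \<oplus>\<^bsub>B\<^esub> f2 (T x)) (\<lambda>i. f1 (E i) \<oplus>\<^bsub>B\<^esub> f1 (K i) \<otimes>\<^bsub>B\<^esub> f2 (E i))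
     (\<lambda>i. f1 (F i) \<otimes>\<^bsub>B\<^esub> f2 (L i) \<oplus>\<^bsub>B\<^esub> f2 (F i))"
proof -
  have e1: "eig B (f1 t) (f1 y) a" if "eig U t y a" "t \<in> carrier U" "y \<in> carrier U" for t y a
    using that(2,3) arg_cong[OF that(1)[unfolded eig_def], of f1] by (simp add: eig_def)
  have e2: "eig B (f2 t) (f2 y) a" if "eig U t y a" "t \<in> carrier U" "y \<in> carrier U" for t y a
    using that(2,3) arg_cong[OF that(1)[unfolded eig_def], of f2] by (simp add: eig_def)
  have e12: "eig B (f1 t) (f2 y) 0" "eig B (f2 t) (f1 y) 0" if "t \<in> carrier U" "y \<in> carrier U" for t y
    using that com[of t y] com[of y t] by (simp_all add: B.eig_0)
  have h1: "f1 (hexp U x) = hexp B (f1 x)" if "x \<in> carrier U" for x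
    by (rule hexp_hom[OF complete_alg_axioms B.complete_alg_axioms f1.hom that])
  have h2: "f2 (hexp U x) = hexp B (f2 x)" if "x \<in> carrier U" for x
    by (rule hexp_hom[OF complete_alg_axioms B.complete_alg_axioms f2.hom that])
  have q1: "f1 (hexp_diff_quot U x y) = hexp_diff_quot B (f1 x) (f1 y)"
    and q2: "f2 (hexp_diff_quot U x y) = hexp_diff_quot B (f2 x) (f2 y)"
    if "x \<in> carrier U" "y \<in> carrier U" for x y
    using that hphi_hom[OF complete_alg_axioms B.complete_alg_axioms f1.hom]
      hphi_hom[OF complete_alg_axioms B.complete_alg_axioms f2.hom]
    by (simp_all add: hexp_diff_quot_eq B.hexp_diff_quot_eq)
  have s1: "f1 (serre_sum U c n x z) = serre_sum B c n (f1 x) (f1 z)"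
    and s2: "f2 (serre_sum U c n x z) = serre_sum B c n (f2 x) (f2 z)"
    if "x \<in> carrier U" "z \<in> carrier U" for c n x z
    unfolding serre_sum_def using that by (subst f1.finsum f2.finsum; auto)+
  show ?thesis
  proof (intro mpq.intro mpq_axioms.intro fomp_axioms B.complete_alg_axioms)
    fix x y a b assume "x \<in> H" "y \<in> H"
    then show "f1 (T (a \<odot>\<^bsub>cartan R\<^esub> x \<oplus>\<^bsub>cartan R\<^esub> b \<odot>\<^bsub>cartan R\<^esub> y)) \<oplus>\<^bsub>B\<^esub> f2 (T (a \<odot>\<^bsub>cartan R\<^esub> x \<oplus>\<^bsub>cartan R\<^esub> b \<odot>\<^bsub>cartan R\<^esub> y))
      = a \<odot>\<^bsub>B\<^esub> (f1 (T x) \<oplus>\<^bsub>B\<^esub> f2 (T x)) \<oplus>\<^bsub>B\<^esub> b \<odot>\<^bsub>B\<^esub> (f1 (T y) \<oplus>\<^bsub>B\<^esub> f2 (T y))"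
      by (simp add: T_lin B.smult_r B.a_ac)
  next
    fix x j assume x: "x \<in> H"
    have t1: "eig B (f1 (T x) \<oplus>\<^bsub>B\<^esub> f2 (T x)) (f1 y) a" if "eig U (T x) y a" "y \<in> carrier U" for y a
      using B.eig_add_left[OF e1[OF that(1)] e12(2)] that x by simp
    have t2: "eig B (f1 (T x) \<oplus>\<^bsub>B\<^esub> f2 (T x)) (f2 y) a" if "eig U (T x) y a" "y \<in> carrier U" for y a
      using B.eig_add_left[OF e12(1) e2[OF that(1)]] that x by simp
    show "eig B (f1 (T x) \<oplus>\<^bsub>B\<^esub> f2 (T x)) (f1 (E j) \<oplus>\<^bsub>B\<^esub> f1 (K j) \<otimes>\<^bsub>B\<^esub> f2 (E j)) (root R j x)"
      using B.eig_add_right[OF t1[OF TE] B.eig_mult[OF t1[OF eig_T_hexp(1)] t2[OF TE], simplified]] x by simp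
    show "eig B (f1 (T x) \<oplus>\<^bsub>B\<^esub> f2 (T x)) (f1 (F j) \<otimes>\<^bsub>B\<^esub> f2 (L j) \<oplus>\<^bsub>B\<^esub> f2 (F j)) (- root R j x)"
      using B.eig_add_right[OF B.eig_mult[OF t1[OF TF] t2[OF eig_T_hexp(2)], simplified] t2[OF TF]] x by simp
  next
    fix x y assume xy: "x \<in> H" "y \<in> H"
    have "f1 (T x) \<otimes>\<^bsub>B\<^esub> f1 (T y) = f1 (T y) \<otimes>\<^bsub>B\<^esub> f1 (T x)" "f2 (T x) \<otimes>\<^bsub>B\<^esub> f2 (T y) = f2 (T y) \<otimes>\<^bsub>B\<^esub> f2 (T x)"
      using TT[OF xy] xy by (simp_all flip: f1.mult f2.mult)
    then show "(f1 (T x) \<oplus>\<^bsub>B\<^esub> f2 (T x)) \<otimes>\<^bsub>B\<^esub> (f1 (T y) \<oplus>\<^bsub>B\<^esub> f2 (T y)) = (f1 (T y) \<oplus>\<^bsub>B\<^esub> f2 (T y)) \<otimes>\<^bsub>B\<^esub> (f1 (T x) \<oplus>\<^bsub>B\<^esub> f2 (T x))"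
      using xy com[of "T x" "T y"] com[of "T y" "T x"] by (simp add: B.l_distr B.r_distr B.a_ac)
  next
    fix i j
    \<comment> \<open>The value of [E_i, F_j], zero off the diagonal, so that both cases are treated
      together.\<close>
    let ?w = "if i = j then cc i \<odot>\<^bsub>U\<^esub> hexp_diff_quot U (T (Tplus R i)) (T (Tminus R i)) else \<zero>\<^bsub>U\<^esub>"
    have [simp]: "?w \<in> carrier U" by simp
    have "(f1 (E i) \<oplus>\<^bsub>B\<^esub> f1 (K i) \<otimes>\<^bsub>B\<^esub> f2 (E i)) \<otimes>\<^bsub>B\<^esub> (f1 (F j) \<otimes>\<^bsub>B\<^esub> f2 (L j) \<oplus>\<^bsub>B\<^esub> f2 (F j)) =
      (f1 (F j) \<otimes>\<^bsub>B\<^esub> f2 (L j) \<oplus>\<^bsub>B\<^esub> f2 (F j)) \<otimes>\<^bsub>B\<^esub> (f1 (E i) \<oplus>\<^bsub>B\<^esub> f1 (K i) \<otimes>\<^bsub>B\<^esub> f2 (E i)) \<oplus>\<^bsub>B\<^esub>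
      (f1 ?w \<otimes>\<^bsub>B\<^esub> f2 (L j) \<oplus>\<^bsub>B\<^esub> f1 (K i) \<otimes>\<^bsub>B\<^esub> f2 ?w)"
    proof (rule B.cross_commutator)
      show "f1 (E i) \<otimes>\<^bsub>B\<^esub> f1 (F j) = f1 (F j) \<otimes>\<^bsub>B\<^esub> f1 (E i) \<oplus>\<^bsub>B\<^esub> f1 ?w"
        using arg_cong[OF EF[of i j], of f1] by (simp del: f1.zero)
      show "f2 (E i) \<otimes>\<^bsub>B\<^esub> f2 (F j) = f2 (F j) \<otimes>\<^bsub>B\<^esub> f2 (E i) \<oplus>\<^bsub>B\<^esub> f2 ?w"
        using arg_cong[OF EF[of i j], of f2] by (simp del: f2.zero)
      show "f1 (K i) \<otimes>\<^bsub>B\<^esub> f1 (F j) = exph (- P $ i $ j) \<odot>\<^bsub>B\<^esub> (f1 (F j) \<otimes>\<^bsub>B\<^esub> f1 (K i))"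
        using arg_cong[OF KF(1)[of i j], of f1] by simp
      show "f2 (E i) \<otimes>\<^bsub>B\<^esub> f2 (L j) = exph (P $ i $ j) \<odot>\<^bsub>B\<^esub> (f2 (L j) \<otimes>\<^bsub>B\<^esub> f2 (E i))"
        using arg_cong[OF LE(2)[of i j], of f2] by simp
    qed (simp_all add: com)
    \<comment> \<open>The commutator w \<otimes> L + K \<otimes> w is the difference quotient at the
      sums T \<otimes> 1 + 1 \<otimes> T.\<close>
    moreover have "f1 ?w \<otimes>\<^bsub>B\<^esub> f2 (L j) \<oplus>\<^bsub>B\<^esub> f1 (K i) \<otimes>\<^bsub>B\<^esub> f2 ?w =
      (if i = j then cc i \<odot>\<^bsub>B\<^esub> hexp_diff_quot B (f1 (T (Tplus R i)) \<oplus>\<^bsub>B\<^esub> f2 (T (Tplus R i)))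
         (f1 (T (Tminus R i)) \<oplus>\<^bsub>B\<^esub> f2 (T (Tminus R i))) else \<zero>\<^bsub>B\<^esub>)"
      by (simp add: B.hdq_add com q1 q2 h1 h2 B.smult_mult_left B.smult_mult_right B.smult_r)
    ultimately show "(f1 (E i) \<oplus>\<^bsub>B\<^esub> f1 (K i) \<otimes>\<^bsub>B\<^esub> f2 (E i)) \<otimes>\<^bsub>B\<^esub> (f1 (F j) \<otimes>\<^bsub>B\<^esub> f2 (L j) \<oplus>\<^bsub>B\<^esub> f2 (F j)) =
      (f1 (F j) \<otimes>\<^bsub>B\<^esub> f2 (L j) \<oplus>\<^bsub>B\<^esub> f2 (F j)) \<otimes>\<^bsub>B\<^esub> (f1 (E i) \<oplus>\<^bsub>B\<^esub> f1 (K i) \<otimes>\<^bsub>B\<^esub> f2 (E i)) \<oplus>\<^bsub>B\<^esub>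
      (if i = j then cc i \<odot>\<^bsub>B\<^esub> hexp_diff_quot B (f1 (T (Tplus R i)) \<oplus>\<^bsub>B\<^esub> f2 (T (Tplus R i)))
         (f1 (T (Tminus R i)) \<oplus>\<^bsub>B\<^esub> f2 (T (Tminus R i))) else \<zero>\<^bsub>B\<^esub>)" by (simp only:)
  next
    fix i j :: 'n assume ij: "i \<noteq> j"
    let ?c = "sc i j (th i j)"
    have "serre_sum B ?c (m i j) (f1 (E i) \<oplus>\<^bsub>B\<^esub> f1 (K i) \<otimes>\<^bsub>B\<^esub> f2 (E i)) (f1 (E j) \<oplus>\<^bsub>B\<^esub> f1 (K j) \<otimes>\<^bsub>B\<^esub> f2 (E j))
      = serre_sum B ?c (m i j) (f1 (E i)) (f1 (E j)) \<oplus>\<^bsub>B\<^esub>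
        serre_sum B ?c (m i j) (f1 (K i) \<otimes>\<^bsub>B\<^esub> f2 (E i)) (f1 (K j) \<otimes>\<^bsub>B\<^esub> f2 (E j))"
      unfolding sc_def
    proof (rule B.serre_sum_add[OF qparam_q])
      \<comment> \<open>Only K_i fails to commute with the first leg. The case j' = i gives the
        square of q_i, the case j' = j the scalar of the first q-commutator.\<close>
      have c: "(f1 (K i) \<otimes>\<^bsub>B\<^esub> f2 (E i)) \<otimes>\<^bsub>B\<^esub> f1 (E j') = exph (P $ i $ j') \<odot>\<^bsub>B\<^esub> (f1 (E j') \<otimes>\<^bsub>B\<^esub> (f1 (K i) \<otimes>\<^bsub>B\<^esub> f2 (E i)))" for j'
        using arg_cong[OF KE(1)[of i j'], of f1] com[of "E j'" "E i"]
        by (simp add: B.m_assoc B.smult_mult_left flip: com) (simp add: B.smult_mult_left flip: B.m_assoc)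
      show "(f1 (K i) \<otimes>\<^bsub>B\<^esub> f2 (E i)) \<otimes>\<^bsub>B\<^esub> f1 (E i) = (q i)\<^sup>2 \<odot>\<^bsub>B\<^esub> (f1 (E i) \<otimes>\<^bsub>B\<^esub> (f1 (K i) \<otimes>\<^bsub>B\<^esub> f2 (E i)))"
        unfolding q_square by (rule c)
      show "(f1 (K i) \<otimes>\<^bsub>B\<^esub> f2 (E i)) \<otimes>\<^bsub>B\<^esub> f1 (E j) = exph (P $ i $ j) \<odot>\<^bsub>B\<^esub> (f1 (E j) \<otimes>\<^bsub>B\<^esub> (f1 (K i) \<otimes>\<^bsub>B\<^esub> f2 (E i)))"
        by (rule c)
      show "f1 (E i) \<otimes>\<^bsub>B\<^esub> (f1 (K j) \<otimes>\<^bsub>B\<^esub> f2 (E j)) = exph (- P $ j $ i) \<odot>\<^bsub>B\<^esub> (f1 (K j) \<otimes>\<^bsub>B\<^esub> f2 (E j) \<otimes>\<^bsub>B\<^esub> f1 (E i))"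
        using arg_cong[OF KE(2)[of i j], of f1] com[of "E i" "E j"]
        by (simp add: B.m_assoc flip: com) (simp add: B.smult_mult_left flip: B.m_assoc)
    qed (use th_eq[OF ij] in simp_all)
    also have "serre_sum B ?c (m i j) (f1 (E i)) (f1 (E j)) = \<zero>\<^bsub>B\<^esub>"
      using SE[OF ij] s1[of "E i" "E j" ?c "m i j"] by simp
    \<comment> \<open>The group-like factors live in the other leg and commute with everything
      there, so they come out with trivial twist and leave the Serre relation of the second
      leg.\<close>
    also have "serre_sum B ?c (m i j) (f1 (K i) \<otimes>\<^bsub>B\<^esub> f2 (E i)) (f1 (K j) \<otimes>\<^bsub>B\<^esub> f2 (E j))
      = (1 ^ (m i j choose 2) * 1) \<odot>\<^bsub>B\<^esub> (f1 (K i) [^]\<^bsub>B\<^esub> m i j \<otimes>\<^bsub>B\<^esub> f1 (K j) \<otimes>\<^bsub>B\<^esub> serre_sum B ?c (m i j) (f2 (E i)) (f2 (E j)))"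
      by (rule B.serre_sum_twist[where \<sigma> = 1 and \<rho> = 1])
        (simp_all add: com KK[of j i] flip: f1.mult)
    also have "serre_sum B ?c (m i j) (f2 (E i)) (f2 (E j)) = \<zero>\<^bsub>B\<^esub>"
      using SE[OF ij] s2[of "E i" "E j" ?c "m i j"] by simp
    finally show "serre_sum B ?c (m i j) (f1 (E i) \<oplus>\<^bsub>B\<^esub> f1 (K i) \<otimes>\<^bsub>B\<^esub> f2 (E i)) (f1 (E j) \<oplus>\<^bsub>B\<^esub> f1 (K j) \<otimes>\<^bsub>B\<^esub> f2 (E j)) = \<zero>\<^bsub>B\<^esub>"
      by simp
  next
    fix i j :: 'n assume ij: "i \<noteq> j"
    let ?c = "sc i j (th j i)"
    \<comment> \<open>For F the legs exchange roles: 1 \<otimes> F_i takes the place of E_i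
      \<otimes> 1, and F_i \<otimes> L_i is written with L_i in front.\<close>
    have "serre_sum B ?c (m i j) (f2 (F i) \<oplus>\<^bsub>B\<^esub> f2 (L i) \<otimes>\<^bsub>B\<^esub> f1 (F i)) (f2 (F j) \<oplus>\<^bsub>B\<^esub> f2 (L j) \<otimes>\<^bsub>B\<^esub> f1 (F j))
      = serre_sum B ?c (m i j) (f2 (F i)) (f2 (F j)) \<oplus>\<^bsub>B\<^esub>
        serre_sum B ?c (m i j) (f2 (L i) \<otimes>\<^bsub>B\<^esub> f1 (F i)) (f2 (L j) \<otimes>\<^bsub>B\<^esub> f1 (F j))"
      unfolding sc_def
    proof (rule B.serre_sum_add[OF qparam_q])
      have c: "(f2 (L i) \<otimes>\<^bsub>B\<^esub> f1 (F i)) \<otimes>\<^bsub>B\<^esub> f2 (F j') = exph (P $ j' $ i) \<odot>\<^bsub>B\<^esub> (f2 (F j') \<otimes>\<^bsub>B\<^esub> (f2 (L i) \<otimes>\<^bsub>B\<^esub> f1 (F i)))" for j'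
        using arg_cong[OF LF(1)[of i j'], of f2] com[of "F i" "F j'"]
        by (simp add: B.m_assoc B.smult_mult_left) (simp add: B.smult_mult_left flip: B.m_assoc)
      show "(f2 (L i) \<otimes>\<^bsub>B\<^esub> f1 (F i)) \<otimes>\<^bsub>B\<^esub> f2 (F i) = (q i)\<^sup>2 \<odot>\<^bsub>B\<^esub> (f2 (F i) \<otimes>\<^bsub>B\<^esub> (f2 (L i) \<otimes>\<^bsub>B\<^esub> f1 (F i)))"
        unfolding q_square by (rule c)
      show "(f2 (L i) \<otimes>\<^bsub>B\<^esub> f1 (F i)) \<otimes>\<^bsub>B\<^esub> f2 (F j) = exph (P $ j $ i) \<odot>\<^bsub>B\<^esub> (f2 (F j) \<otimes>\<^bsub>B\<^esub> (f2 (L i) \<otimes>\<^bsub>B\<^esub> f1 (F i)))"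
        by (rule c)
      show "f2 (F i) \<otimes>\<^bsub>B\<^esub> (f2 (L j) \<otimes>\<^bsub>B\<^esub> f1 (F j)) = exph (- P $ i $ j) \<odot>\<^bsub>B\<^esub> (f2 (L j) \<otimes>\<^bsub>B\<^esub> f1 (F j) \<otimes>\<^bsub>B\<^esub> f2 (F i))"
        using arg_cong[OF LF(2)[of i j], of f2] com[of "F j" "F i"]
        by (simp add: B.m_assoc) (simp add: B.smult_mult_left flip: B.m_assoc)
    qed (use th_eq[OF ij] in simp_all)
    also have "serre_sum B ?c (m i j) (f2 (F i)) (f2 (F j)) = \<zero>\<^bsub>B\<^esub>"
      using SF[OF ij] s2[of "F i" "F j" ?c "m i j"] by simp
    also have "serre_sum B ?c (m i j) (f2 (L i) \<otimes>\<^bsub>B\<^esub> f1 (F i)) (f2 (L j) \<otimes>\<^bsub>B\<^esub> f1 (F j))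
      = (1 ^ (m i j choose 2) * 1) \<odot>\<^bsub>B\<^esub> (f2 (L i) [^]\<^bsub>B\<^esub> m i j \<otimes>\<^bsub>B\<^esub> f2 (L j) \<otimes>\<^bsub>B\<^esub> serre_sum B ?c (m i j) (f1 (F i)) (f1 (F j)))"
      by (rule B.serre_sum_twist[where \<sigma> = 1 and \<rho> = 1])
        (simp_all add: com LL[of j i] flip: f2.mult)
    also have "serre_sum B ?c (m i j) (f1 (F i)) (f1 (F j)) = \<zero>\<^bsub>B\<^esub>"
      using SF[OF ij] s1[of "F i" "F j" ?c "m i j"] by simp
    finally show "serre_sum B ?c (m i j) (f1 (F i) \<otimes>\<^bsub>B\<^esub> f2 (L i) \<oplus>\<^bsub>B\<^esub> f2 (F i)) (f1 (F j) \<otimes>\<^bsub>B\<^esub> f2 (L j) \<oplus>\<^bsub>B\<^esub> f2 (F j)) = \<zero>\<^bsub>B\<^esub>"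
      by (simp add: com B.a_comm)
  qed simp_all
qed

end

subsection \<open>Compatibility with the antipode and the counit\<close>

lemma hsum_op [simp]: "hsum (op_alg A) = hsum A"
  by (simp add: hsum_def fun_eq_iff)

lemma hexp_op: "kh_algebra A \<Longrightarrow> x \<in> carrier A \<Longrightarrow> hexp (op_alg A) x = hexp A x"
  by (simp add: hexp_def nat_pow_op)

lemma hexp_diff_quot_op:
  assumes "kh_algebra A" "x \<in> carrier A" "y \<in> carrier A"
  shows "hexp_diff_quot (op_alg A) x y = hexp_diff_quot A x y"
proof -
  interpret kh_algebra A by fact
  show ?thesis
    by (simp only: hexp_diff_quot_def hsum_op op_alg_sel a_minus_op_alg a_inv_op_alg
        nat_pow_op[OF assms(1,2)] nat_pow_op[OF assms(1) a_inv_closed[OF assms(3)]])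
qed

lemma complete_alg_op: "complete_alg A \<Longrightarrow> complete_alg (op_alg A)"
  by (simp add: complete_alg_def complete_alg_axioms_def kh_algebra_op hadic_complete_op)

lemma serre_sum_op:
  assumes "kh_algebra A" "x \<in> carrier A" "z \<in> carrier A"
  shows "serre_sum (op_alg A) c n x z =
    (\<Oplus>\<^bsub>A\<^esub>k\<in>{..n}. c k \<odot>\<^bsub>A\<^esub> (x [^]\<^bsub>A\<^esub> k \<otimes>\<^bsub>A\<^esub> z \<otimes>\<^bsub>A\<^esub> x [^]\<^bsub>A\<^esub> (n - k)))"
proof -
  interpret kh_algebra A by fact
  show ?thesis using assms by (simp add: serre_sum_def nat_pow_op m_assoc)
qed

lemma (in kh_algebra) eig_op:
  assumes "eig A t y a" "t \<in> carrier A" "y \<in> carrier A" shows "eig (op_alg A) (\<ominus> t) y a"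
  unfolding eig_def using assms(2,3)
  by (simp add: l_minus r_minus assms(1)[unfolded eig_def] minus_add a_assoc l_neg)

context mpq
begin

text \<open>In the opposite algebra a Serre sum is read backwards, which replaces \<theta> by its
  inverse. Pulling the group-like factors out to the left inverts it again by
  \<open>sc_twist\<close>, so the original Serre sum remains.\<close>

lemma antipode_relations:
  "mpq A d P R (op_alg B) (\<lambda>x. \<ominus> T x) (\<lambda>i. \<ominus> (K' i \<otimes> E i)) (\<lambda>i. \<ominus> (F i \<otimes> L' i))"
proof -
  have SE': "serre_sum (op_alg B) (sc i j (th i j)) (m i j) (\<ominus> (K' i \<otimes> E i)) (\<ominus> (K' j \<otimes> E j)) = \<zero>"
    if ij: "i \<noteq> j" for i j
  proof -
    have "serre_sum B (sc i j (th j i)) (m i j) (\<ominus> K' i \<otimes> E i) (\<ominus> K' j \<otimes> E j)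
      = (exph (P $ i $ i) ^ (m i j choose 2) * exph (P $ j $ i) ^ m i j) \<odot>
        ((\<ominus> K' i) [^] m i j \<otimes> \<ominus> K' j \<otimes> serre_sum B (sc i j (th i j)) (m i j) (E i) (E j))"
      by (rule serre_sum_twist[OF _ _ _ _ _ _ _ _ sc_twist])
        (simp_all add: K'E(2) K'K'[of j i] l_minus r_minus smult_neg_r)
    then have "serre_sum B (sc i j (th j i)) (m i j) (\<ominus> (K' i \<otimes> E i)) (\<ominus> (K' j \<otimes> E j)) = \<zero>"
      by (simp add: SE[OF ij] l_minus)
    then show ?thesis
      by (simp add: serre_sum_op kh_algebra_axioms serre_F_eq)
  qed
  have SF': "serre_sum (op_alg B) (sc i j (th j i)) (m i j) (\<ominus> (F i \<otimes> L' i)) (\<ominus> (F j \<otimes> L' j)) = \<zero>"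
    if ij: "i \<noteq> j" for i j
  proof -
    \<comment> \<open>Needed to put the group-like factor on the left: F_i L_i^(-1) equals exp
      (\<hbar> p_ii) L_i^(-1) F_i. The scalar and the sign are absorbed into
      \<open>g\<close>.\<close>
    define g where "g i = \<ominus> (exph (P $ i $ i) \<odot> L' i)" for i
    have g [simp]: "g i \<in> carrier B" for i by (simp add: g_def)
    have Fg: "F i \<otimes> g j = exph (P $ i $ j) \<odot> (g j \<otimes> F i)" for i j
      by (simp add: g_def L'F(2)[of i j] l_minus r_minus smult_neg_r smult_mult_left smult_mult_right smult_smult mult.commute)
    have gg: "g j \<otimes> g i = g i \<otimes> g j" for i j
      by (simp add: g_def l_minus r_minus smult_mult_left smult_mult_right smult_smult smult_neg_r mult.commute L'L'[of i j])
    have gF: "\<ominus> (F i \<otimes> L' i) = g i \<otimes> F i" for i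
      by (simp add: g_def L'F(2)[of i i] l_minus smult_mult_left)
    have "serre_sum B (sc i j (th i j)) (m i j) (g i \<otimes> F i) (g j \<otimes> F j)
      = (exph (P $ i $ i) ^ (m i j choose 2) * exph (P $ i $ j) ^ m i j) \<odot>
        (g i [^] m i j \<otimes> g j \<otimes> serre_sum B (sc i j (th j i)) (m i j) (F i) (F j))"
      by (rule serre_sum_twist[OF _ _ _ _ Fg Fg Fg gg sc_twist]) simp_all
    then have "serre_sum B (sc i j (th i j)) (m i j) (g i \<otimes> F i) (g j \<otimes> F j) = \<zero>"
      by (simp add: SF[OF ij])
    then show ?thesis
      by (simp add: gF serre_sum_op kh_algebra_axioms serre_F_eq)
  qed
  \<comment> \<open>The signs of the two antipode values cancel in every product, so they are
    omitted here.\<close>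
  have EF': "(F j \<otimes> L' j) \<otimes> (K' i \<otimes> E i) = (K' i \<otimes> E i) \<otimes> (F j \<otimes> L' j) \<oplus>
      (if i = j then cc i \<odot> hexp_diff_quot B (\<ominus> T (Tplus R i)) (\<ominus> T (Tminus R i)) else \<zero>)" for i j
  proof -
    let ?w = "if i = j then cc i \<odot> hexp_diff_quot B (T (Tplus R i)) (T (Tminus R i)) else \<zero>"
    let ?y = "K' i \<otimes> ?w \<otimes> L' j"
    have [simp]: "?w \<in> carrier B" by simp
    have "(F j \<otimes> L' j) \<otimes> (K' i \<otimes> E i) = F j \<otimes> (L' j \<otimes> K' i) \<otimes> E i" by (simp add: m_assoc)
    also have "\<dots> = (F j \<otimes> K' i) \<otimes> (L' j \<otimes> E i)" unfolding K'L'[of i j, symmetric] by (simp add: m_assoc)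
    \<comment> \<open>The scalars exp (- \<hbar> p_ij), from moving K_i^(-1) past F_j, and exp
      (\<hbar> p_ij), from moving L_j^(-1) past E_i, cancel.\<close>
    also have "\<dots> = K' i \<otimes> (F j \<otimes> E i) \<otimes> L' j"
      unfolding K'F(2) L'E(1) by (simp add: smult_mult_left smult_mult_right smult_smult m_assoc)
    finally have 1: "(F j \<otimes> L' j) \<otimes> (K' i \<otimes> E i) = K' i \<otimes> (F j \<otimes> E i) \<otimes> L' j" .
    have "(K' i \<otimes> E i) \<otimes> (F j \<otimes> L' j) = K' i \<otimes> (E i \<otimes> F j) \<otimes> L' j" by (simp add: m_assoc)
    also have "\<dots> = (F j \<otimes> L' j) \<otimes> (K' i \<otimes> E i) \<oplus> ?y"
      unfolding 1 EF[of i j] by (simp only: r_distr l_distr m_closed E_closed F_closed hexp_closed a_inv_closed T_closed T_carrier \<open>?w \<in> carrier B\<close>)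
    finally have 2: "(K' i \<otimes> E i) \<otimes> (F j \<otimes> L' j) = (F j \<otimes> L' j) \<otimes> (K' i \<otimes> E i) \<oplus> ?y" .
    have W: "\<ominus> ?y = (if i = j then cc i \<odot> hexp_diff_quot B (\<ominus> T (Tplus R i)) (\<ominus> T (Tminus R i)) else \<zero>)"
      using hdq_neg[of "T (Tplus R j)" "T (Tminus R j)", symmetric]
      by (simp add: TT smult_mult_left smult_mult_right smult_neg_r)
    have "u = (u \<oplus> ?y) \<oplus> \<ominus> ?y" if "u \<in> carrier B" for u
      using that by (simp only: a_assoc r_neg m_closed hexp_closed a_inv_closed T_closed T_carrier r_zero \<open>?w \<in> carrier B\<close>)
    then have "(F j \<otimes> L' j) \<otimes> (K' i \<otimes> E i) = ((F j \<otimes> L' j) \<otimes> (K' i \<otimes> E i) \<oplus> ?y) \<oplus> \<ominus> ?y"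
      by (simp only: m_closed E_closed F_closed hexp_closed a_inv_closed T_closed T_carrier)
    then show ?thesis unfolding 2[symmetric] W .
  qed
  show ?thesis
  proof (intro mpq.intro mpq_axioms.intro fomp_axioms complete_alg_op complete_alg_axioms)
    fix x y a b assume "x \<in> H" "y \<in> H"
    then show "\<ominus> T (a \<odot>\<^bsub>cartan R\<^esub> x \<oplus>\<^bsub>cartan R\<^esub> b \<odot>\<^bsub>cartan R\<^esub> y) =
       a \<odot>\<^bsub>op_alg B\<^esub> (\<ominus> T x) \<oplus>\<^bsub>op_alg B\<^esub> b \<odot>\<^bsub>op_alg B\<^esub> (\<ominus> T y)"
      by (simp add: T_lin smult_neg_r minus_add)
  next
    fix x j assume x: "x \<in> H"
    show "eig (op_alg B) (\<ominus> T x) (\<ominus> (K' j \<otimes> E j)) (root R j x)"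
      using eig_op[OF eig_neg_right[OF eig_mult[OF eig_T_hexp(2)[OF x] TE[OF x]]]] x by simp
    show "eig (op_alg B) (\<ominus> T x) (\<ominus> (F j \<otimes> L' j)) (- root R j x)"
      using eig_op[OF eig_neg_right[OF eig_mult[OF TF[OF x] eig_T_hexp(1)[OF x]]]] x by simp
  next
    fix x y assume "x \<in> H" "y \<in> H"
    then show "(\<ominus> T x) \<otimes>\<^bsub>op_alg B\<^esub> (\<ominus> T y) = (\<ominus> T y) \<otimes>\<^bsub>op_alg B\<^esub> (\<ominus> T x)"
      using TT_neg(3) by simp
  next
    fix i j
    show "\<ominus> (K' i \<otimes> E i) \<otimes>\<^bsub>op_alg B\<^esub> \<ominus> (F j \<otimes> L' j) = \<ominus> (F j \<otimes> L' j) \<otimes>\<^bsub>op_alg B\<^esub> \<ominus> (K' i \<otimes> E i) \<oplus>\<^bsub>op_alg B\<^esub>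
      (if i = j then cc i \<odot>\<^bsub>op_alg B\<^esub> hexp_diff_quot (op_alg B) (\<ominus> T (Tplus R i)) (\<ominus> T (Tminus R i)) else \<zero>\<^bsub>op_alg B\<^esub>)"
      using EF'[of j i] by (simp add: l_minus r_minus hexp_diff_quot_op kh_algebra_axioms)
  qed (use SE' SF' in simp_all)
qed

end

lemma (in fomp) counit_relations: "mpq A d P R kh (\<lambda>_. 0) (\<lambda>_. 0) (\<lambda>_. 0)"
proof -
  interpret complete_alg "kh :: ('k fps, 'k fps) module" by (rule complete_alg_kh)
  have hdq: "hexp_diff_quot kh 0 0 = (0 :: 'k fps)"
    using hexp_diff_quot_eq[of 0 0] hphi_zero by simp
  show ?thesis
    by (intro mpq.intro mpq_axioms.intro fomp_axioms complete_alg_kh)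
      (simp_all add: eig_def hdq serre_sum_def)
qed

text \<open>A map obtained from the universal property is known on \<hh> only, while
  \<open>T\<close> is a total function.\<close>

lemma (in fomp) mpq_cong:
  assumes "mpq A d P R B T E F" "\<And>x. x \<in> H \<Longrightarrow> T x = T' x"
  shows "mpq A d P R B T' E F"
proof -
  interpret mpq A d P R B T E F by fact
  note [simp] = assms(2)[symmetric] H_closed
  show ?thesis
    by (intro mpq.intro mpq_axioms.intro fomp_axioms complete_alg_axioms)
      (simp_all add: T_lin TE TF TT SE SF, simp add: EF)
qed

subsection \<open>Naturality of the relators\<close>

text \<open>Algebra homomorphisms between complete algebras are automatically continuous, so they
  preserve the power series in the E-F relator; the other relators are algebraic
  expressions.\<close>

lemma (in fomp) relators_hom:
  fixes C :: "('k fps, 'c) module" and B :: "('k fps, 'b) module" and g :: "('n, 'h) generator \<Rightarrow> 'c"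
  assumes C: "complete_alg C" and B: "complete_alg B" and f: "f \<in> alg_homs C B"
    and T: "\<And>x. x \<in> H \<Longrightarrow> g (GenT x) \<in> carrier C" and E: "\<And>i. g (GenE i) \<in> carrier C"
    and F: "\<And>i. g (GenF i) \<in> carrier C"
  shows "f ` relators A d P R C g = relators A d P R B (\<lambda>x. f (g x))" and "relators A d P R C g \<subseteq> carrier C"
proof -
  interpret C: complete_alg C by fact
  interpret B: complete_alg B by fact
  interpret alg_hom C B f by (rule alg_homI[OF C.kh_algebra_axioms B.kh_algebra_axioms f])
  note [simp] = T E F H_closed
  have hdq [simp]: "f (hexp_diff_quot C (g (GenT (Tplus R i))) (g (GenT (Tminus R i))))
    = hexp_diff_quot B (f (g (GenT (Tplus R i)))) (f (g (GenT (Tminus R i))))" for i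
    using hphi_hom[OF C B f] by (simp add: C.hexp_diff_quot_eq B.hexp_diff_quot_eq)
  have s1: "f (\<Oplus>\<^bsub>C\<^esub>k\<in>{..n}. c k \<odot>\<^bsub>C\<^esub> (x [^]\<^bsub>C\<^esub> u k \<otimes>\<^bsub>C\<^esub> y \<otimes>\<^bsub>C\<^esub> x [^]\<^bsub>C\<^esub> v k))
    = (\<Oplus>\<^bsub>B\<^esub>k\<in>{..n}. c k \<odot>\<^bsub>B\<^esub> (f x [^]\<^bsub>B\<^esub> u k \<otimes>\<^bsub>B\<^esub> f y \<otimes>\<^bsub>B\<^esub> f x [^]\<^bsub>B\<^esub> v k))"
    if "x \<in> carrier C" "y \<in> carrier C" for c and n :: nat and u v :: "nat \<Rightarrow> nat" and x y
    using that by (subst finsum) auto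
  have s2: "(\<Oplus>\<^bsub>C\<^esub>k\<in>{..n}. c k \<odot>\<^bsub>C\<^esub> (x [^]\<^bsub>C\<^esub> u k \<otimes>\<^bsub>C\<^esub> y \<otimes>\<^bsub>C\<^esub> x [^]\<^bsub>C\<^esub> v k)) \<in> carrier C"
    if "x \<in> carrier C" "y \<in> carrier C" for c and n :: nat and u v :: "nat \<Rightarrow> nat" and x y
    using that by (intro C.finsum_closed) auto
  have i4: "f ` {t a b x y |a b x y. Q x y} = {t' a b x y |a b x y. Q x y}"
    if "\<And>a b x y. Q x y \<Longrightarrow> f (t a b x y) = t' a b x y"
    for t :: "'k fps \<Rightarrow> 'k fps \<Rightarrow> 'h \<Rightarrow> 'h \<Rightarrow> 'c" and t' Q
  proof -
    have "f ` {t a b x y |a b x y. Q x y} = {f (t a b x y) |a b x y. Q x y}" by blast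
    also have "\<dots> = {t' a b x y |a b x y. Q x y}"
      using that by (intro Collect_cong ex_cong1 rev_conj_cong) simp_all
    finally show ?thesis .
  qed
  have i2: "f ` {t x y |x y. Q x y} = {t' x y |x y. Q x y}"
    if "\<And>x y. Q x y \<Longrightarrow> f (t x y) = t' x y" for t :: "'x \<Rightarrow> 'y \<Rightarrow> 'c" and t' Q
  proof -
    have "f ` {t x y |x y. Q x y} = {f (t x y) |x y. Q x y}" by blast
    also have "\<dots> = {t' x y |x y. Q x y}"
      using that by (intro Collect_cong ex_cong1 rev_conj_cong) simp_all
    finally show ?thesis .
  qed
  show "f ` relators A d P R C g = relators A d P R B (\<lambda>x. f (g x))"
    unfolding relators_def Let_def image_Un
    by (intro arg_cong2[of _ _ _ _ "(\<union>)"] i4 i2) (simp_all add: s1)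
  show "relators A d P R C g \<subseteq> carrier C"
    unfolding relators_def Let_def
    by (intro Un_least subsetI; elim CollectE exE conjE; hypsubst) (simp_all add: s2)
qed

subsection \<open>Closed quotients of complete algebras\<close>

text \<open>Closedness of the ideal is separatedness of the quotient. For limits, a Cauchy sequence
  is lifted to a Cauchy sequence: each increment is \<hbar>^k times a class, and the class, not the
  increment, is lifted.\<close>

lemma (in complete_alg) complete_quot:
  assumes I: "ideal I A" and cl: "hclosed A I"
  shows "complete_alg (quot_alg A I)"
proof (rule complete_algI)
  let ?Q = "quot_alg A I" and ?p = "(+>) I"
  show Q: "kh_algebra ?Q" by (rule kh_algebra_quot[OF kh_algebra_axioms I])
  interpret Q: kh_algebra ?Q by fact
  interpret p: alg_hom A ?Q ?p by (rule alg_homI[OF kh_algebra_axioms Q rcos_alg_hom[OF kh_algebra_axioms I]])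
  have surj: "\<exists>x\<in>carrier A. D = ?p x" if "D \<in> carrier ?Q" for D
    using that rcos_surj[OF kh_algebra_axioms I] by blast
  have hp: "\<exists>y\<in>carrier A. D = ?p (fps_X ^ k \<odot> y)" if "D \<in> hpow ?Q k" for D k
  proof -
    obtain D' where "D' \<in> carrier ?Q" "D = fps_X ^ k \<odot>\<^bsub>?Q\<^esub> D'" using \<open>D \<in> hpow ?Q k\<close> by (auto simp: Q.hpow_iff)
    with surj[of D'] show ?thesis by (metis p.smult)
  qed
  show "hadic_complete ?Q" unfolding Q.hadic_complete_iff
  proof (intro conjI ballI)
    show "separated ?Q" unfolding separated_def
    proof (intro ballI impI)
      fix D assume D: "D \<in> carrier ?Q" "\<forall>k. D \<in> hpow ?Q k"
      obtain x where x: "x \<in> carrier A" "D = ?p x" using surj[OF D(1)] by blast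
      have "\<exists>y\<in>I. x \<ominus> y \<in> hpow A k" for k
      proof -
        obtain y where y: "y \<in> carrier A" "?p x = ?p (fps_X ^ k \<odot> y)" using hp[of D k] D(2) x by blast
        then have "x \<ominus> fps_X ^ k \<odot> y \<in> I" 
          using x(1) rcos_eq_iff[OF I x(1), of "fps_X ^ k \<odot> y"] by (simp del: p.smult)
        moreover have "x \<ominus> (x \<ominus> fps_X ^ k \<odot> y) = fps_X ^ k \<odot> y"
          using x(1) y(1) add_diff_add_left[of x \<zero> "\<ominus> (fps_X ^ k \<odot> y)"] by (simp add: minus_eq)
        ultimately show ?thesis using hpowI[OF y(1), of k] by metis
      qed
      then have "x \<in> I" using cl x(1) unfolding hclosed_def by blast
      then have "?p x = ?p \<zero>"
        using rcos_eq_iff[OF I x(1) zero_closed] x(1) by (simp add: minus_eq del: p.zero)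
      then show "D = \<zero>\<^bsub>?Q\<^esub>" using x by simp
    qed
  next
    fix D assume D: "D \<in> cauchy_seqs ?Q"
    obtain x0 where x0: "x0 \<in> carrier A" "D 0 = ?p x0" using surj[OF Q.cauchy_seqsD(1)[OF D]] by blast
    have "\<forall>k. \<exists>y. y \<in> carrier A \<and> D (Suc k) \<ominus>\<^bsub>?Q\<^esub> D k = ?p (fps_X ^ k \<odot> y)"
      using hp[OF Q.cauchy_seqsD(2)[OF D]] by blast
    then obtain y where y: "\<And>k. y k \<in> carrier A" "\<And>k. D (Suc k) \<ominus>\<^bsub>?Q\<^esub> D k = ?p (fps_X ^ k \<odot> y k)" by metis
    \<comment> \<open>The lift sums the increments \<hbar>^k \<open>y k\<close>, starting from a
      representative of \<open>D 0\<close>.\<close>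
    define x where "x = rec_nat x0 (\<lambda>k xk. fps_X ^ k \<odot> y k \<oplus> xk)"
    have xs: "x 0 = x0" "x (Suc k) = fps_X ^ k \<odot> y k \<oplus> x k" for k by (simp_all add: x_def)
    have xc [simp]: "x k \<in> carrier A" for k by (induction k) (simp_all add: xs x0 y)
    have "x (Suc k) \<ominus> x k = fps_X ^ k \<odot> y k" for k
      using y(1)[of k] by (simp add: eq_diff_iff xs a_comm)
    then have "x \<in> cauchy_seqs A" using y(1) by (simp add: cauchy_seqs_def hpowI)
    with complete have "\<exists>c\<in>carrier A. \<forall>k. c \<ominus> x k \<in> hpow A k"
      unfolding hadic_complete_iff by (elim conjE bspec)
    then obtain c where c: "c \<in> carrier A" "\<And>k. c \<ominus> x k \<in> hpow A k" by blast
    have px: "?p (x k) = D k" for k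
    proof (induction k)
      case (Suc k)
      have "?p (x (Suc k)) = (D (Suc k) \<ominus>\<^bsub>?Q\<^esub> D k) \<oplus>\<^bsub>?Q\<^esub> D k"
        using y(1)[of k] unfolding y(2) xs by (simp add: Suc[symmetric] del: p.smult)
      then show ?case using Q.cauchy_seqsD(1)[OF D] by (simp add: Q.diff_add_cancel)
    qed (simp add: xs x0)
    have "?p c \<ominus>\<^bsub>?Q\<^esub> D k \<in> hpow ?Q k" for k
      using p.hpow[OF c(2)[of k]] c(1) by (simp add: px[symmetric])
    then show "\<exists>c\<in>carrier ?Q. \<forall>k. c \<ominus>\<^bsub>?Q\<^esub> D k \<in> hpow ?Q k" using c(1) p.closed by blast
  qed
qed

section \<open>The universal property\<close>

lemma hclosed_Inter: "(\<And>I. I \<in> \<I> \<Longrightarrow> hclosed A I) \<Longrightarrow> hclosed A (\<Inter>\<I>)"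
  unfolding hclosed_def by blast

lemma
  assumes A: "kh_algebra A" and S: "S \<subseteq> carrier A"
  shows closed_ideal_gen_ideal: "ideal (closed_ideal_gen A S) A"
    and closed_ideal_gen_hclosed: "hclosed A (closed_ideal_gen A S)"
    and closed_ideal_gen_incl: "S \<subseteq> closed_ideal_gen A S"
proof -
  interpret kh_algebra A by fact
  \<comment> \<open>The family being intersected is nonempty, as the whole algebra belongs to
    it.\<close>
  have "carrier A \<in> {I. ideal I A \<and> hclosed A I \<and> S \<subseteq> I}"
    using oneideal S by (simp add: hclosed_def)
  then show "ideal (closed_ideal_gen A S) A"
    unfolding closed_ideal_gen_def by (intro i_Intersect) auto
  show "hclosed A (closed_ideal_gen A S)" unfolding closed_ideal_gen_def by (rule hclosed_Inter) auto
  show "S \<subseteq> closed_ideal_gen A S" unfolding closed_ideal_gen_def by blast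
qed

lemma (in alg_hom) kernel_ideal: "ideal {x \<in> carrier A. f x = \<zero>\<^bsub>B\<^esub>} A"
proof (rule idealI[OF A.ring_axioms])
  show "subgroup {x \<in> carrier A. f x = \<zero>\<^bsub>B\<^esub>} (add_monoid A)"
    by (rule A.add.subgroupI) (auto simp flip: a_inv_def)
qed auto

lemma (in alg_hom) kernel_hclosed:
  assumes "separated B" shows "hclosed A {x \<in> carrier A. f x = \<zero>\<^bsub>B\<^esub>}"
  unfolding hclosed_def
proof (intro ballI impI)
  fix x assume x: "x \<in> carrier A" "\<forall>m. \<exists>y\<in>{x \<in> carrier A. f x = \<zero>\<^bsub>B\<^esub>}. x \<ominus>\<^bsub>A\<^esub> y \<in> hpow A m"
  have "f x \<in> hpow B m" for m
  proof -
    obtain y where y: "y \<in> carrier A" "f y = \<zero>\<^bsub>B\<^esub>" "x \<ominus>\<^bsub>A\<^esub> y \<in> hpow A m" using x(2) by blast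
    then show ?thesis using hpow[OF y(3)] x(1) by (simp add: B.minus_eq)
  qed
  then show "x \<in> {x \<in> carrier A. f x = \<zero>\<^bsub>B\<^esub>}" using assms x(1) unfolding separated_def by simp
qed

section \<open>The presented algebra as an initial object\<close>

context fomp
begin

abbreviation gens :: "('n, 'h) generator set" where "gens \<equiv> GenT ` H \<union> range GenE \<union> range GenF"
abbreviation "FM \<equiv> free_monoid gens"
abbreviation "Fr \<equiv> free_alg R"
abbreviation "CF \<equiv> completion Fr"
abbreviation "J \<equiv> fompquea_ideal A d P R"
abbreviation "U \<equiv> fompquea A d P R"
abbreviation "gen \<equiv> fompquea_gen A d P R"

lemma monoid_FM: "monoid FM"
  by (rule monoidI) (auto simp: free_monoid_def)

lemma kh_algebra_Fr: "kh_algebra Fr"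
  unfolding free_alg_def by (rule kh_algebra_monoid_alg[OF monoid_FM])

sublocale Fr: kh_algebra Fr by (rule kh_algebra_Fr)

sublocale CF: complete_alg CF
  by (rule complete_algI[OF Fr.kh_algebra_completion Fr.hadic_complete_completion])

lemma single_Fr: "w \<in> lists gens \<Longrightarrow> single w \<in> carrier Fr"
  by (simp add: free_alg_def free_monoid_def)

lemma free_gen_closed: "x \<in> gens \<Longrightarrow> free_gen R x \<in> carrier CF"
  unfolding free_gen_def
  by (rule linear_maps_closed[OF alg_homs_linear[OF Fr.to_completion_hom] single_Fr]) simp

lemma relators_carrier: "relators A d P R CF (free_gen R) \<subseteq> carrier CF"
  by (rule relators_hom(2)[OF CF.complete_alg_axioms CF.complete_alg_axioms alg_homs_id])
    (auto intro: free_gen_closed)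

lemma J_ideal: "ideal J CF" and J_hclosed: "hclosed CF J" and relators_J: "relators A d P R CF (free_gen R) \<subseteq> J"
  unfolding fompquea_ideal_def
  by (rule closed_ideal_gen_ideal closed_ideal_gen_hclosed closed_ideal_gen_incl,
      rule CF.kh_algebra_axioms, rule relators_carrier)+

sublocale U: complete_alg U
  unfolding fompquea_def by (rule CF.complete_quot[OF J_ideal J_hclosed])

lemma proj_alg_hom: "alg_hom CF U ((+>\<^bsub>CF\<^esub>) J)"
  using rcos_alg_hom[OF CF.kh_algebra_axioms J_ideal]
  by (intro alg_homI CF.kh_algebra_axioms U.kh_algebra_axioms) (simp add: fompquea_def)

sublocale proj: alg_hom CF U "(+>\<^bsub>CF\<^esub>) J" by (rule proj_alg_hom)

lemma gen_closed [simp]: "x \<in> gens \<Longrightarrow> gen x \<in> carrier U"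
  unfolding fompquea_gen_def by (rule proj.closed[OF free_gen_closed])

lemma gens_relations: "mpq A d P R U (\<lambda>x. gen (GenT x)) (\<lambda>i. gen (GenE i)) (\<lambda>i. gen (GenF i))"
proof -
  have "relators A d P R U gen = (+>\<^bsub>CF\<^esub>) J ` relators A d P R CF (free_gen R)"
    unfolding fompquea_gen_def[abs_def]
    by (rule relators_hom(1)[symmetric, OF CF.complete_alg_axioms U.complete_alg_axioms proj.hom])
      (auto intro: free_gen_closed)
  also have "\<dots> \<subseteq> {\<zero>\<^bsub>U\<^esub>}"
  proof
    fix y assume "y \<in> (+>\<^bsub>CF\<^esub>) J ` relators A d P R CF (free_gen R)"
    then obtain r where r: "r \<in> J" "r \<in> carrier CF" "y = J +>\<^bsub>CF\<^esub> r"
      using relators_J relators_carrier by blast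
    then have "J +>\<^bsub>CF\<^esub> r = J +>\<^bsub>CF\<^esub> \<zero>\<^bsub>CF\<^esub>"
      using CF.rcos_eq_iff[OF J_ideal r(2) CF.zero_closed] by (simp add: CF.minus_eq del: proj.zero)
    then show "y \<in> {\<zero>\<^bsub>U\<^esub>}" using r by simp
  qed
  finally show ?thesis
    by (subst relators_iff[OF U.complete_alg_axioms, symmetric]) auto
qed

sublocale UR: mpq A d P R U "\<lambda>x. gen (GenT x)" "\<lambda>i. gen (GenE i)" "\<lambda>i. gen (GenF i)"
  by (rule gens_relations)

text \<open>A map on words extends successively to the free algebra, its completion, and the
  quotient. The last step works because the target is separated: the kernel is then a closed ideal
  and contains the closed ideal generated by the relators as soon as it contains the
  relators.\<close>

lemma U_lift:
  assumes "mpq A d P R B T E F"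
  obtains f where "f \<in> alg_homs U B" "\<And>x. x \<in> H \<Longrightarrow> f (gen (GenT x)) = T x"
    "\<And>i. f (gen (GenE i)) = E i" "\<And>i. f (gen (GenF i)) = F i"
proof -
  interpret M: mpq A d P R B T E F by fact
  define g where "g = case_generator T E F"
  have g [simp]: "g x \<in> carrier B" if "x \<in> gens" for x using that by (auto simp: g_def)
  define \<rho> where "\<rho> w = foldr (\<lambda>x y. g x \<otimes>\<^bsub>B\<^esub> y) w \<one>\<^bsub>B\<^esub>" for w
  have \<rho>: "\<rho> w \<in> carrier B" if "w \<in> lists gens" for w
    using that by (induction w) (auto simp: \<rho>_def)
  have \<rho>_app: "\<rho> (v @ w) = \<rho> v \<otimes>\<^bsub>B\<^esub> \<rho> w" if "v \<in> lists gens" "w \<in> lists gens" for v w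
    using that(1)
  proof (induction v)
    case (Cons x v)
    then have "\<rho> (x # v @ w) = g x \<otimes>\<^bsub>B\<^esub> (\<rho> v \<otimes>\<^bsub>B\<^esub> \<rho> w)" by (simp add: \<rho>_def)
    then show ?case using Cons \<rho>[of v] \<rho>[OF that(2)] by (simp add: \<rho>_def M.m_assoc)
  qed (use \<rho>[OF that(2)] in \<open>simp add: \<rho>_def\<close>)
  have \<rho>FM: "\<rho> w \<in> carrier B" if "w \<in> carrier FM" for w using that \<rho> by (simp add: free_monoid_def)
  have h: "lin_ext B \<rho> \<in> alg_homs Fr B"
    unfolding free_alg_def
    by (rule lin_ext_alg_hom[OF monoid_FM M.kh_algebra_axioms \<rho>FM])
      (simp_all add: free_monoid_def \<rho>_app, simp add: \<rho>_def)
  have hs: "lin_ext B \<rho> (single [x]) = g x" if "x \<in> gens" for x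
    using lin_ext_single[where G = FM and \<rho> = \<rho> and x = "[x]", OF M.kh_algebra_axioms \<rho>FM] that g[OF that]
    by (simp add: free_monoid_def) (simp add: \<rho>_def)
  obtain f where f: "f \<in> alg_homs CF B" "\<And>x. x \<in> carrier Fr \<Longrightarrow> f (to_completion Fr x) = lin_ext B \<rho> x"
    using completion_lift[OF kh_algebra_Fr M.kh_algebra_axioms M.complete alg_homs_linear[OF h]] h by blast
  interpret f: alg_hom CF B f by (rule alg_homI[OF CF.kh_algebra_axioms M.kh_algebra_axioms f(1)])
  have fg: "f (free_gen R x) = g x" if "x \<in> gens" for x
    unfolding free_gen_def using that by (simp add: f(2) single_Fr hs)
  have "f ` relators A d P R CF (free_gen R) = relators A d P R B (\<lambda>x. f (free_gen R x))"
    by (rule relators_hom(1)[OF CF.complete_alg_axioms M.complete_alg_axioms f(1)])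
      (auto intro: free_gen_closed)
  also have "\<dots> \<subseteq> {\<zero>\<^bsub>B\<^esub>}"
  proof (subst relators_iff[OF M.complete_alg_axioms])
    have "(\<lambda>i. f (free_gen R (GenE i))) = E" "(\<lambda>i. f (free_gen R (GenF i))) = F"
      by (simp_all add: fg g_def)
    then show "mpq A d P R B (\<lambda>x. f (free_gen R (GenT x))) (\<lambda>i. f (free_gen R (GenE i))) (\<lambda>i. f (free_gen R (GenF i)))"
      by (simp only:) (rule mpq_cong[OF assms], simp add: fg g_def)
  qed (simp_all add: fg)
  finally have "J \<subseteq> {x \<in> carrier CF. f x = \<zero>\<^bsub>B\<^esub>}"
    unfolding fompquea_ideal_def closed_ideal_gen_def
    using f.kernel_ideal f.kernel_hclosed[OF M.complete_separated[OF M.complete]] relators_carrier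
    by (intro Inter_lower) auto
  then have ker: "f x = \<zero>\<^bsub>B\<^esub>" if "x \<in> J" for x using that by blast
  obtain F' where F': "F' \<in> alg_homs U B" "\<And>x. x \<in> carrier CF \<Longrightarrow> F' (J +>\<^bsub>CF\<^esub> x) = f x"
    using quot_alg_lift[OF CF.kh_algebra_axioms M.kh_algebra_axioms J_ideal f.linear ker] f(1)
    unfolding fompquea_def by blast
  have "F' (gen x) = g x" if "x \<in> gens" for x
    unfolding fompquea_gen_def using that by (simp add: F'(2) free_gen_closed fg)
  then show ?thesis using that[OF F'(1)] by (simp add: g_def)
qed

text \<open>Words in the generators span a dense submodule, and a word is built by multiplying
  generators on the left. The maps are only required to be linear, because the two sides of the
  antipode axioms are not compared as algebra homomorphisms.\<close>

lemma U_eqI: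
  assumes B: "kh_algebra B" "separated B" and f: "f \<in> linear_maps U B" and g: "g \<in> linear_maps U B"
    and one: "f \<one>\<^bsub>U\<^esub> = g \<one>\<^bsub>U\<^esub>"
    and step: "\<And>x u. x \<in> gens \<Longrightarrow> u \<in> carrier U \<Longrightarrow> f u = g u \<Longrightarrow> f (gen x \<otimes>\<^bsub>U\<^esub> u) = g (gen x \<otimes>\<^bsub>U\<^esub> u)"
    and u: "u \<in> carrier U"
  shows "f u = g u"
proof -
  let ?p = "(+>\<^bsub>CF\<^esub>) J"
  note toc = Fr.to_completion_hom
  have words: "f (?p (to_completion Fr (single w))) = g (?p (to_completion Fr (single w)))" if "w \<in> lists gens" for w
    using that
  proof (induction w)
    case Nil
    have "single [] = \<one>\<^bsub>Fr\<^esub>" by (simp add: free_alg_def free_monoid_def)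
    then show ?case using alg_homs_one[OF toc] one by simp
  next
    case (Cons x w)
    then have w: "w \<in> lists gens" and x: "x \<in> gens" by auto
    have s: "single (x # w) = single [x] \<otimes>\<^bsub>Fr\<^esub> (single w :: _ \<Rightarrow> 'k fps)"
      by (simp add: free_alg_def monoid_alg_single_mult free_monoid_def)
    note cl = linear_maps_closed[OF alg_homs_linear[OF toc] single_Fr[OF w]]
    have "?p (to_completion Fr (single (x # w))) = gen x \<otimes>\<^bsub>U\<^esub> ?p (to_completion Fr (single w))"
      unfolding s fompquea_gen_def free_gen_def
      using cl free_gen_closed[OF x, unfolded free_gen_def] x w
      by (subst alg_homs_mult[OF toc]) (auto intro: single_Fr)
    then show ?case using step[OF x proj.closed[OF cl]] Cons.IH by simp
  qed
  obtain c where c: "c \<in> carrier CF" "u = ?p c"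
    using u rcos_surj[OF CF.kh_algebra_axioms J_ideal] unfolding fompquea_def by blast
  have fp: "(\<lambda>c. f (?p c)) \<in> linear_maps CF B" "(\<lambda>c. g (?p c)) \<in> linear_maps CF B"
    by (rule linear_maps_comp[OF proj.linear f] linear_maps_comp[OF proj.linear g])+
  have "f (?p c) = g (?p c)"
  proof (rule linear_maps_completion_eqI[OF kh_algebra_Fr B fp _ c(1)])
    fix y assume y: "y \<in> carrier Fr"
    have y': "y \<in> carrier (monoid_alg FM)" using y by (simp only: free_alg_def)
    have l: "(\<lambda>y. f (?p (to_completion Fr y))) \<in> linear_maps (monoid_alg FM) B"
      "(\<lambda>y. g (?p (to_completion Fr y))) \<in> linear_maps (monoid_alg FM) B"
      using linear_maps_comp[OF alg_homs_linear[OF toc] fp(1)] linear_maps_comp[OF alg_homs_linear[OF toc] fp(2)]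
      by (simp_all only: free_alg_def)
    show "f (?p (to_completion Fr y)) = g (?p (to_completion Fr y))"
      by (rule linear_maps_monoid_alg_eqI[OF monoid_FM B(1) l _ y'])
        (rule words, simp add: free_monoid_def)
  qed
  then show ?thesis using c by simp
qed

lemma U_hom_eqI:
  assumes B: "kh_algebra B" "separated B" and f: "f \<in> alg_homs U B" and g: "g \<in> alg_homs U B"
    and eq: "\<And>x. x \<in> H \<Longrightarrow> f (gen (GenT x)) = g (gen (GenT x))" "\<And>i. f (gen (GenE i)) = g (gen (GenE i))"
      "\<And>i. f (gen (GenF i)) = g (gen (GenF i))"
    and u: "u \<in> carrier U"
  shows "f u = g u"
proof (rule U_eqI[OF B alg_homs_linear[OF f] alg_homs_linear[OF g] _ _ u])
  show "f \<one>\<^bsub>U\<^esub> = g \<one>\<^bsub>U\<^esub>" by (simp add: alg_homs_one[OF f] alg_homs_one[OF g])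
  fix x u assume x: "x \<in> gens" and "u \<in> carrier U" "f u = g u"
  moreover have "f (gen x) = g (gen x)" using x eq by auto
  ultimately show "f (gen x \<otimes>\<^bsub>U\<^esub> u) = g (gen x \<otimes>\<^bsub>U\<^esub> u)"
    by (simp add: alg_homs_mult[OF f] alg_homs_mult[OF g])
qed

end

section \<open>Maps between completed tensor products\<close>

context tensor_prod
begin

lemma ctensor_elem_add [simp]:
  "a \<in> carrier A \<Longrightarrow> a' \<in> carrier A \<Longrightarrow> b \<in> carrier B \<Longrightarrow>
    ctensor_elem A B (a \<oplus>\<^bsub>A\<^esub> a') b = ctensor_elem A B a b \<oplus>\<^bsub>ctensor A B\<^esub> ctensor_elem A B a' b"
  "a \<in> carrier A \<Longrightarrow> b \<in> carrier B \<Longrightarrow> b' \<in> carrier B \<Longrightarrow>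
    ctensor_elem A B a (b \<oplus>\<^bsub>B\<^esub> b') = ctensor_elem A B a b \<oplus>\<^bsub>ctensor A B\<^esub> ctensor_elem A B a b'"
  using linear_maps_add[OF bilinear_mapsD(1)[OF ctensor_elem_bilinear]]
    linear_maps_add[OF bilinear_mapsD(2)[OF ctensor_elem_bilinear]] by auto

lemma ctensor_left_hom: "(\<lambda>a. ctensor_elem A B a \<one>\<^bsub>B\<^esub>) \<in> alg_homs A (ctensor A B)"
  by (rule alg_homsI[OF bilinear_mapsD(1)[OF ctensor_elem_bilinear]]) (simp_all add: ctensor_elem_one)

lemma ctensor_right_hom: "(\<lambda>b. ctensor_elem A B \<one>\<^bsub>A\<^esub> b) \<in> alg_homs B (ctensor A B)"
  by (rule alg_homsI[OF bilinear_mapsD(2)[OF ctensor_elem_bilinear]]) (simp_all add: ctensor_elem_one)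

end

lemma
  assumes AB: "tensor_prod A B" and CD: "tensor_prod C D"
    and f: "f \<in> alg_homs A C" and g: "g \<in> alg_homs B D"
  shows ctensor_map_hom: "ctensor_map A B C D f g \<in> alg_homs (ctensor A B) (ctensor C D)"
    and ctensor_map_elem: "\<And>a b. a \<in> carrier A \<Longrightarrow> b \<in> carrier B \<Longrightarrow>
      ctensor_map A B C D f g (ctensor_elem A B a b) = ctensor_elem C D (f a) (g b)"
proof -
  interpret AB: tensor_prod A B by fact
  interpret CD: tensor_prod C D by fact
  interpret f: alg_hom A C f by (rule alg_homI[OF AB.A.kh_algebra_axioms CD.A.kh_algebra_axioms f])
  interpret g: alg_hom B D g by (rule alg_homI[OF AB.B.kh_algebra_axioms CD.B.kh_algebra_axioms g])
  have \<beta>: "(\<lambda>a b. ctensor_elem C D (f a) (g b)) \<in> bilinear_maps A B (ctensor C D)"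
    by (rule bilinear_mapsI)
      (auto intro: linear_maps_comp[OF f.linear bilinear_mapsD(1)[OF CD.ctensor_elem_bilinear]]
        linear_maps_comp[OF g.linear bilinear_mapsD(2)[OF CD.ctensor_elem_bilinear]])
  note cmp = CD.kh_algebra_ctensor CD.hadic_complete_ctensor
  show "ctensor_map A B C D f g \<in> alg_homs (ctensor A B) (ctensor C D)"
    unfolding ctensor_map_def
    by (rule AB.ctensor_lift_alg_hom[OF cmp \<beta>]) (simp_all add: CD.ctensor_elem_one)
  show "ctensor_map A B C D f g (ctensor_elem A B a b) = ctensor_elem C D (f a) (g b)"
    if "a \<in> carrier A" "b \<in> carrier B" for a b
    unfolding ctensor_map_def by (rule AB.ctensor_lift_elem[OF cmp \<beta> that])
qed

text \<open>The inner lift is a separate definite description for each \<open>c\<close>. Its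
  linearity in \<open>c\<close>, and the multiplicativity of the result, therefore have to be
  recovered by comparing values on pure tensors and using density.\<close>

lemma
  assumes A: "kh_algebra A" and B: "kh_algebra B" and C: "kh_algebra C"
  shows ctensor_assoc_hom: "ctensor_assoc A B C \<in> alg_homs (ctensor (ctensor A B) C) (ctensor A (ctensor B C))"
    and ctensor_assoc_elem: "\<And>a b c. a \<in> carrier A \<Longrightarrow> b \<in> carrier B \<Longrightarrow> c \<in> carrier C \<Longrightarrow>
      ctensor_assoc A B C (ctensor_elem (ctensor A B) C (ctensor_elem A B a b) c)
        = ctensor_elem A (ctensor B C) a (ctensor_elem B C b c)"
proof -
  interpret AB: tensor_prod A B by (rule tensor_prodI[OF A B])
  interpret BC: tensor_prod B C by (rule tensor_prodI[OF B C])
  interpret ABC: tensor_prod "ctensor A B" C by (rule tensor_prodI[OF AB.kh_algebra_ctensor C])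
  interpret A_BC: tensor_prod A "ctensor B C" by (rule tensor_prodI[OF A BC.kh_algebra_ctensor])
  let ?W = "ctensor A (ctensor B C)"
  note cmp = A_BC.kh_algebra_ctensor A_BC.hadic_complete_ctensor
  note sep = A_BC.CT.complete_separated[OF cmp(2)]
  let ?b = "\<lambda>c a b. ctensor_elem A (ctensor B C) a (ctensor_elem B C b c)"
  have b: "?b c \<in> bilinear_maps A B ?W" if c: "c \<in> carrier C" for c
  proof (rule bilinear_mapsI)
    show "(\<lambda>a. ?b c a b) \<in> linear_maps A ?W" if "b \<in> carrier B" for b
      by (rule bilinear_mapsD(1)[OF A_BC.ctensor_elem_bilinear]) (simp add: that c)
    show "(\<lambda>b. ?b c a b) \<in> linear_maps B ?W" if "a \<in> carrier A" for a
      by (rule linear_maps_comp[OF bilinear_mapsD(1)[OF BC.ctensor_elem_bilinear c]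
            bilinear_mapsD(2)[OF A_BC.ctensor_elem_bilinear that]])
  qed
  let ?L = "\<lambda>t c. ctensor_lift A B ?W (?b c) t"
  note Llin = AB.ctensor_lift_linear[OF cmp b]
  note Lel = AB.ctensor_lift_elem[OF cmp b]
  note Lcl = linear_maps_closed[OF Llin]
  have Ladd: "?L t (c \<oplus>\<^bsub>C\<^esub> c') = ?L t c \<oplus>\<^bsub>?W\<^esub> ?L t c'"
    if c: "c \<in> carrier C" "c' \<in> carrier C" and t: "t \<in> carrier (ctensor A B)" for c c' t
  proof (rule AB.linear_maps_ctensor_eqI[OF cmp(1) sep Llin _ _ t])
    show "(\<lambda>t. ?L t c \<oplus>\<^bsub>?W\<^esub> ?L t c') \<in> linear_maps (ctensor A B) ?W"
      by (rule linear_mapsI) (use c in \<open>simp_all add: Lcl linear_maps_add[OF Llin] linear_maps_smult[OF Llin]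
          A_BC.CT.smult_r A_BC.CT.a_ac\<close>)
  qed (use c in \<open>simp_all add: Lel\<close>)
  have Lsm: "?L t (k \<odot>\<^bsub>C\<^esub> c) = k \<odot>\<^bsub>?W\<^esub> ?L t c"
    if c: "c \<in> carrier C" and t: "t \<in> carrier (ctensor A B)" for c k t
  proof (rule AB.linear_maps_ctensor_eqI[OF cmp(1) sep Llin _ _ t])
    show "(\<lambda>t. k \<odot>\<^bsub>?W\<^esub> ?L t c) \<in> linear_maps (ctensor A B) ?W"
      by (rule linear_mapsI) (use c in \<open>simp_all add: Lcl linear_maps_add[OF Llin] linear_maps_smult[OF Llin]
          A_BC.CT.smult_r A_BC.CT.smult_smult mult.commute\<close>)
  qed (use c in \<open>simp_all add: Lel linear_maps_smult[OF bilinear_mapsD(2)[OF BC.ctensor_elem_bilinear]]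
      linear_maps_smult[OF bilinear_mapsD(2)[OF A_BC.ctensor_elem_bilinear]]\<close>)
  have L: "?L \<in> bilinear_maps (ctensor A B) C ?W"
    by (rule bilinear_mapsI) (auto intro!: linear_mapsI simp: Lcl Ladd Lsm linear_maps_add[OF Llin] linear_maps_smult[OF Llin])
  have m1: "?L (ctensor_elem A B a b' \<otimes>\<^bsub>ctensor A B\<^esub> t) (c \<otimes>\<^bsub>C\<^esub> c') = ?b c a b' \<otimes>\<^bsub>?W\<^esub> ?L t c'"
    if *: "a \<in> carrier A" "b' \<in> carrier B" "c \<in> carrier C" "c' \<in> carrier C" and t: "t \<in> carrier (ctensor A B)"
    for a b' c c' t
    by (rule AB.linear_maps_ctensor_eqI[OF cmp(1) sep
          linear_maps_comp[OF AB.CT.linear_mult_right Llin] linear_maps_comp[OF Llin A_BC.CT.linear_mult_right] _ t])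
      (use * in \<open>simp_all add: Lel\<close>)
  have m2: "?L (s \<otimes>\<^bsub>ctensor A B\<^esub> t) (c \<otimes>\<^bsub>C\<^esub> c') = ?L s c \<otimes>\<^bsub>?W\<^esub> ?L t c'"
    if *: "c \<in> carrier C" "c' \<in> carrier C" and s: "s \<in> carrier (ctensor A B)" and t: "t \<in> carrier (ctensor A B)"
    for c c' s t
    by (rule AB.linear_maps_ctensor_eqI[OF cmp(1) sep
          linear_maps_comp[OF AB.CT.linear_mult_left Llin] linear_maps_comp[OF Llin A_BC.CT.linear_mult_left] _ s])
      (use * t in \<open>simp_all add: Lel Lcl m1\<close>)
  show "ctensor_assoc A B C \<in> alg_homs (ctensor (ctensor A B) C) ?W"
    unfolding ctensor_assoc_def
    by (rule ABC.ctensor_lift_alg_hom[OF cmp L])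
      (simp_all add: m2 Lel BC.ctensor_elem_one A_BC.ctensor_elem_one flip: AB.ctensor_elem_one)
  show "ctensor_assoc A B C (ctensor_elem (ctensor A B) C (ctensor_elem A B a b') c)
        = ctensor_elem A (ctensor B C) a (ctensor_elem B C b' c)"
    if "a \<in> carrier A" "b' \<in> carrier B" "c \<in> carrier C" for a b' c
    unfolding ctensor_assoc_def using that
    by (subst ABC.ctensor_lift_elem[OF cmp L]) (simp_all add: Lel)
qed

section \<open>The Hopf structure\<close>

lemma (in kh_algebra) bilinear_maps_mult:
  assumes B: "kh_algebra B" "kh_algebra C" and f: "f \<in> linear_maps B A" and g: "g \<in> linear_maps C A"
  shows "(\<lambda>a b. f a \<otimes> g b) \<in> bilinear_maps B C A"
proof (rule bilinear_mapsI)
  show "(\<lambda>a. f a \<otimes> g b) \<in> linear_maps B A" if "b \<in> carrier C" for b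
    by (rule linear_maps_comp[OF f linear_mult_left]) (rule linear_maps_closed[OF g that])
  show "(\<lambda>b. f a \<otimes> g b) \<in> linear_maps C A" if "a \<in> carrier B" for a
    by (rule linear_maps_comp[OF g linear_mult_right]) (rule linear_maps_closed[OF f that])
qed

context fomp
begin

abbreviation "UU \<equiv> ctensor U U"
abbreviation "tens \<equiv> ctensor_elem U U"

sublocale UU: tensor_prod U U by (rule tensor_prodI[OF U.kh_algebra_axioms U.kh_algebra_axioms])

lemma complete_UU: "complete_alg UU"
  by (rule complete_algI[OF UU.kh_algebra_ctensor UU.hadic_complete_ctensor])

abbreviation "gT x \<equiv> gen (GenT x)"
abbreviation "gE i \<equiv> gen (GenE i)"
abbreviation "gF i \<equiv> gen (GenF i)"

lemma mpq_comult_U: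
  "mpq_comult A d P R U gT gE gF UU (\<lambda>a. tens a \<one>\<^bsub>U\<^esub>) (\<lambda>b. tens \<one>\<^bsub>U\<^esub> b)"
  by (intro mpq_comult.intro mpq_comult_axioms.intro gens_relations complete_UU alg_homI
      U.kh_algebra_axioms UU.kh_algebra_ctensor UU.ctensor_left_hom UU.ctensor_right_hom) simp

lemma comult_exists:
  "\<exists>\<Delta>. \<Delta> \<in> alg_homs U UU \<and>
    (\<forall>x\<in>H. \<Delta> (gT x) = tens (gT x) \<one>\<^bsub>U\<^esub> \<oplus>\<^bsub>UU\<^esub> tens \<one>\<^bsub>U\<^esub> (gT x)) \<and>
    (\<forall>i. \<Delta> (gE i) = tens (gE i) \<one>\<^bsub>U\<^esub> \<oplus>\<^bsub>UU\<^esub> tens (UR.K i) (gE i)) \<and>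
    (\<forall>i. \<Delta> (gF i) = tens (gF i) (UR.L i) \<oplus>\<^bsub>UU\<^esub> tens \<one>\<^bsub>U\<^esub> (gF i))"
proof (rule U_lift[OF mpq_comult.comult_relations[OF mpq_comult_U]])
  fix f
  assume "f \<in> alg_homs U UU"
    and "\<And>x. x \<in> H \<Longrightarrow> f (gT x) = tens (gT x) \<one>\<^bsub>U\<^esub> \<oplus>\<^bsub>UU\<^esub> tens \<one>\<^bsub>U\<^esub> (gT x)"
    and "\<And>i. f (gE i) = tens (gE i) \<one>\<^bsub>U\<^esub> \<oplus>\<^bsub>UU\<^esub> tens (UR.K i) \<one>\<^bsub>U\<^esub> \<otimes>\<^bsub>UU\<^esub> tens \<one>\<^bsub>U\<^esub> (gE i)"
    and "\<And>i. f (gF i) = tens (gF i) \<one>\<^bsub>U\<^esub> \<otimes>\<^bsub>UU\<^esub> tens \<one>\<^bsub>U\<^esub> (UR.L i) \<oplus>\<^bsub>UU\<^esub> tens \<one>\<^bsub>U\<^esub> (gF i)"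
  then show ?thesis by (intro exI[of _ f]) simp
qed

lemma counit_exists:
  "\<exists>\<epsilon>. \<epsilon> \<in> alg_homs U kh \<and> (\<forall>x\<in>H. \<epsilon> (gT x) = 0) \<and> (\<forall>i. \<epsilon> (gE i) = 0) \<and> (\<forall>i. \<epsilon> (gF i) = 0)"
  by (rule U_lift[OF counit_relations]) blast

lemma antipode_exists:
  "\<exists>S. S \<in> alg_homs U (op_alg U) \<and> (\<forall>x\<in>H. S (gT x) = \<ominus>\<^bsub>U\<^esub> gT x) \<and>
    (\<forall>i. S (gE i) = \<ominus>\<^bsub>U\<^esub> (UR.K' i \<otimes>\<^bsub>U\<^esub> gE i)) \<and> (\<forall>i. S (gF i) = \<ominus>\<^bsub>U\<^esub> (gF i \<otimes>\<^bsub>U\<^esub> UR.L' i))"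
  by (rule U_lift[OF UR.antipode_relations]) blast

end

section \<open>Verification of the Hopf axioms\<close>

locale fomp_hopf = fomp A d P R
  for A :: "int ^ 'n::finite ^ 'n" and d and P :: "('k::field_char_0 fps) ^ 'n ^ 'n"
    and R :: "('k, 'n, 'h) triple" +
  fixes \<Delta> \<epsilon> S
  assumes \<Delta>: "\<Delta> \<in> alg_homs U UU" and \<epsilon>: "\<epsilon> \<in> alg_homs U kh" and S: "S \<in> alg_homs U (op_alg U)"
    and \<Delta>_T: "\<And>x. x \<in> H \<Longrightarrow> \<Delta> (gT x) = tens (gT x) \<one>\<^bsub>U\<^esub> \<oplus>\<^bsub>UU\<^esub> tens \<one>\<^bsub>U\<^esub> (gT x)"
    and \<Delta>_E: "\<And>i. \<Delta> (gE i) = tens (gE i) \<one>\<^bsub>U\<^esub> \<oplus>\<^bsub>UU\<^esub> tens (UR.K i) (gE i)"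
    and \<Delta>_F: "\<And>i. \<Delta> (gF i) = tens (gF i) (UR.L i) \<oplus>\<^bsub>UU\<^esub> tens \<one>\<^bsub>U\<^esub> (gF i)"
    and \<epsilon>_T: "\<And>x. x \<in> H \<Longrightarrow> \<epsilon> (gT x) = 0" and \<epsilon>_E: "\<And>i. \<epsilon> (gE i) = 0" and \<epsilon>_F: "\<And>i. \<epsilon> (gF i) = 0"
    and S_T: "\<And>x. x \<in> H \<Longrightarrow> S (gT x) = \<ominus>\<^bsub>U\<^esub> gT x"
    and S_E: "\<And>i. S (gE i) = \<ominus>\<^bsub>U\<^esub> (UR.K' i \<otimes>\<^bsub>U\<^esub> gE i)"
    and S_F: "\<And>i. S (gF i) = \<ominus>\<^bsub>U\<^esub> (gF i \<otimes>\<^bsub>U\<^esub> UR.L' i)"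
begin

sublocale \<Delta>: alg_hom U UU \<Delta>
  by (rule alg_homI[OF U.kh_algebra_axioms UU.kh_algebra_ctensor \<Delta>])

sublocale \<epsilon>: alg_hom U kh \<epsilon>
  by (rule alg_homI[OF U.kh_algebra_axioms kh_algebra_kh \<epsilon>])

lemma S_linear: "S \<in> linear_maps U U"
  using alg_homs_linear[OF S] by simp

sublocale S: linear_map U U S
  by (rule linear_mapI[OF U.kh_algebra_axioms U.kh_algebra_axioms S_linear])

lemma S_mult: "x \<in> carrier U \<Longrightarrow> y \<in> carrier U \<Longrightarrow> S (x \<otimes>\<^bsub>U\<^esub> y) = S y \<otimes>\<^bsub>U\<^esub> S x"
  using alg_homs_mult[OF S] by simp

lemma S_one [simp]: "S \<one>\<^bsub>U\<^esub> = \<one>\<^bsub>U\<^esub>"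
  using alg_homs_one[OF S] by simp

lemma S_hexp: "x \<in> carrier U \<Longrightarrow> S (hexp U x) = hexp U (S x)"
  using hexp_hom[OF U.complete_alg_axioms complete_alg_op[OF U.complete_alg_axioms] S]
  by (simp add: hexp_op U.kh_algebra_axioms)

lemma \<epsilon>_hexp: "x \<in> carrier U \<Longrightarrow> \<epsilon> x = 0 \<Longrightarrow> \<epsilon> (hexp U x) = 1"
  using hexp_hom[OF U.complete_alg_axioms complete_alg_kh \<epsilon>, of x] complete_alg.hexp_zero[OF complete_alg_kh]
  by simp

text \<open>The exponential of a primitive element is group-like: x \<otimes> 1 and 1 \<otimes> x
  commute, so the exponential of their sum factors.\<close>

lemma \<Delta>_hexp:
  assumes x: "x \<in> carrier U" and p: "\<Delta> x = tens x \<one>\<^bsub>U\<^esub> \<oplus>\<^bsub>UU\<^esub> tens \<one>\<^bsub>U\<^esub> x"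
  shows "\<Delta> (hexp U x) = tens (hexp U x) (hexp U x)"
proof -
  have "\<Delta> (hexp U x) = hexp UU (tens x \<one>\<^bsub>U\<^esub> \<oplus>\<^bsub>UU\<^esub> tens \<one>\<^bsub>U\<^esub> x)"
    using hexp_hom[OF U.complete_alg_axioms complete_UU \<Delta> x] p by simp
  also have "\<dots> = hexp UU (tens x \<one>\<^bsub>U\<^esub>) \<otimes>\<^bsub>UU\<^esub> hexp UU (tens \<one>\<^bsub>U\<^esub> x)"
    by (rule complete_alg.hexp_add[OF complete_UU]) (use x in simp_all)
  also have "\<dots> = tens (hexp U x) \<one>\<^bsub>U\<^esub> \<otimes>\<^bsub>UU\<^esub> tens \<one>\<^bsub>U\<^esub> (hexp U x)"
    using hexp_hom[OF U.complete_alg_axioms complete_UU UU.ctensor_left_hom x]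
      hexp_hom[OF U.complete_alg_axioms complete_UU UU.ctensor_right_hom x] by simp
  finally show ?thesis using x by simp
qed

lemma \<Delta>_K: "\<Delta> (UR.K i) = tens (UR.K i) (UR.K i)"
  by (rule \<Delta>_hexp) (simp_all add: \<Delta>_T)

lemma tens_neg:
  "a \<in> carrier U \<Longrightarrow> b \<in> carrier U \<Longrightarrow> tens (\<ominus>\<^bsub>U\<^esub> a) b = \<ominus>\<^bsub>UU\<^esub> tens a b"
  "a \<in> carrier U \<Longrightarrow> b \<in> carrier U \<Longrightarrow> tens a (\<ominus>\<^bsub>U\<^esub> b) = \<ominus>\<^bsub>UU\<^esub> tens a b"
  using linear_map.neg[OF linear_mapI[OF U.kh_algebra_axioms UU.kh_algebra_ctensor bilinear_mapsD(1)[OF UU.ctensor_elem_bilinear]]]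
    linear_map.neg[OF linear_mapI[OF U.kh_algebra_axioms UU.kh_algebra_ctensor bilinear_mapsD(2)[OF UU.ctensor_elem_bilinear]]]
  by auto

lemma \<Delta>_L: "\<Delta> (UR.L i) = tens (UR.L i) (UR.L i)"
  by (rule \<Delta>_hexp) (simp_all add: \<Delta>_T tens_neg UU.CT.minus_add)

lemma \<epsilon>_K: "\<epsilon> (UR.K i) = 1" and \<epsilon>_L: "\<epsilon> (UR.L i) = 1"
  by (rule \<epsilon>_hexp; simp add: \<epsilon>_T)+

lemma S_K: "S (UR.K i) = UR.K' i" and S_L: "S (UR.L i) = UR.L' i"
  by (simp_all add: S_hexp S_T)

sublocale UU_U: tensor_prod UU U by (rule tensor_prodI[OF UU.kh_algebra_ctensor U.kh_algebra_axioms])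
sublocale U_UU: tensor_prod U UU by (rule tensor_prodI[OF U.kh_algebra_axioms UU.kh_algebra_ctensor])

lemma coassoc:
  assumes x: "x \<in> carrier U"
  shows "ctensor_assoc U U U (ctensor_map U U UU U \<Delta> (\<lambda>a. a) (\<Delta> x)) = ctensor_map U U U UU (\<lambda>a. a) \<Delta> (\<Delta> x)"
proof -
  let ?W = "ctensor U UU"
  note cmp = U_UU.kh_algebra_ctensor U_UU.hadic_complete_ctensor
  note m1 = ctensor_map_hom[OF UU.tensor_prod_axioms UU_U.tensor_prod_axioms \<Delta> alg_homs_id]
    and m2 = ctensor_map_hom[OF UU.tensor_prod_axioms U_UU.tensor_prod_axioms alg_homs_id \<Delta>]
    and as = ctensor_assoc_hom[OF U.kh_algebra_axioms U.kh_algebra_axioms U.kh_algebra_axioms]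
  interpret M1: alg_hom UU "ctensor UU U" "ctensor_map U U UU U \<Delta> (\<lambda>a. a)"
    by (rule alg_homI[OF UU.kh_algebra_ctensor UU_U.kh_algebra_ctensor m1])
  interpret M2: alg_hom UU ?W "ctensor_map U U U UU (\<lambda>a. a) \<Delta>"
    by (rule alg_homI[OF UU.kh_algebra_ctensor U_UU.kh_algebra_ctensor m2])
  interpret AS: alg_hom "ctensor UU U" ?W "ctensor_assoc U U U"
    by (rule alg_homI[OF UU_U.kh_algebra_ctensor U_UU.kh_algebra_ctensor as])
  note el = ctensor_map_elem[OF UU.tensor_prod_axioms UU_U.tensor_prod_axioms \<Delta> alg_homs_id]
    ctensor_map_elem[OF UU.tensor_prod_axioms U_UU.tensor_prod_axioms alg_homs_id \<Delta>]
    ctensor_assoc_elem[OF U.kh_algebra_axioms U.kh_algebra_axioms U.kh_algebra_axioms]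
  show ?thesis
    by (rule U_hom_eqI[OF cmp(1) U_UU.CT.complete_separated[OF cmp(2)]
          alg_homs_comp[OF alg_homs_comp[OF \<Delta> m1] as] alg_homs_comp[OF \<Delta> m2] _ _ _ x])
      (simp_all add: \<Delta>_T \<Delta>_E \<Delta>_F \<Delta>_K \<Delta>_L el U_UU.CT.a_ac flip: UU.ctensor_elem_one)
qed

lemma counit_left_bilinear: "(\<lambda>a b. \<epsilon> a \<odot>\<^bsub>U\<^esub> b) \<in> bilinear_maps U U U"
  and counit_right_bilinear: "(\<lambda>a b. \<epsilon> b \<odot>\<^bsub>U\<^esub> a) \<in> bilinear_maps U U U"
  by (auto intro!: bilinear_mapsI linear_mapsI simp: U.smult_l U.smult_r U.smult_smult mult.commute)

lemma counit:
  assumes x: "x \<in> carrier U"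
  shows "ctensor_lift U U U (\<lambda>a b. \<epsilon> a \<odot>\<^bsub>U\<^esub> b) (\<Delta> x) = x" (is ?l)
    and "ctensor_lift U U U (\<lambda>a b. \<epsilon> b \<odot>\<^bsub>U\<^esub> a) (\<Delta> x) = x" (is ?r)
proof -
  note cmp = U.kh_algebra_axioms U.complete and sep = U.complete_separated[OF U.complete]
  note el = UU.ctensor_lift_elem[OF cmp counit_left_bilinear] UU.ctensor_lift_elem[OF cmp counit_right_bilinear]
  have h1: "ctensor_lift U U U (\<lambda>a b. \<epsilon> a \<odot>\<^bsub>U\<^esub> b) \<in> alg_homs UU U"
    by (rule UU.ctensor_lift_alg_hom[OF cmp counit_left_bilinear])
      (simp_all add: U.smult_mult_left U.smult_mult_right U.smult_smult mult.commute)
  have h2: "ctensor_lift U U U (\<lambda>a b. \<epsilon> b \<odot>\<^bsub>U\<^esub> a) \<in> alg_homs UU U"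
    by (rule UU.ctensor_lift_alg_hom[OF cmp counit_right_bilinear])
      (simp_all add: U.smult_mult_left U.smult_mult_right U.smult_smult mult.commute)
  note add = linear_maps_add[OF alg_homs_linear[OF h1]] linear_maps_add[OF alg_homs_linear[OF h2]]
  note simps = \<Delta>_T \<Delta>_E \<Delta>_F \<epsilon>_T \<epsilon>_E \<epsilon>_F \<epsilon>_K \<epsilon>_L el add
  show ?l by (rule U_hom_eqI[OF cmp(1) sep alg_homs_comp[OF \<Delta> h1] alg_homs_id _ _ _ x]) (simp_all add: simps)
  show ?r by (rule U_hom_eqI[OF cmp(1) sep alg_homs_comp[OF \<Delta> h2] alg_homs_id _ _ _ x]) (simp_all add: simps)
qed

text \<open>The antipode axioms are not multiplicative; instead \<open>m (S \<otimes> id)\<close> is a right module map up to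
  the twist \<open>s (c \<otimes> e) \<mapsto> S c m(s) e\<close>, so the elements satisfying them form a subalgebra.\<close>

lemma
  assumes x: "x \<in> carrier U"
  shows antipode_left: "ctensor_lift U U U (\<lambda>a b. S a \<otimes>\<^bsub>U\<^esub> b) (\<Delta> x) = \<epsilon> x \<odot>\<^bsub>U\<^esub> \<one>\<^bsub>U\<^esub>"
    and antipode_right: "ctensor_lift U U U (\<lambda>a b. a \<otimes>\<^bsub>U\<^esub> S b) (\<Delta> x) = \<epsilon> x \<odot>\<^bsub>U\<^esub> \<one>\<^bsub>U\<^esub>"
proof -
  note cmp = U.kh_algebra_axioms U.complete and sep = U.complete_separated[OF U.complete]
  note bl = U.bilinear_maps_mult[OF U.kh_algebra_axioms U.kh_algebra_axioms S_linear linear_maps_id]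
    and br = U.bilinear_maps_mult[OF U.kh_algebra_axioms U.kh_algebra_axioms linear_maps_id S_linear]
  let ?L = "ctensor_lift U U U (\<lambda>a b. S a \<otimes>\<^bsub>U\<^esub> b)" and ?R = "ctensor_lift U U U (\<lambda>a b. a \<otimes>\<^bsub>U\<^esub> S b)"
  note Ll = UU.ctensor_lift_linear[OF cmp bl] and Rl = UU.ctensor_lift_linear[OF cmp br]
  note el = UU.ctensor_lift_elem[OF cmp bl] UU.ctensor_lift_elem[OF cmp br]
  interpret L: linear_map UU U ?L by (rule linear_mapI[OF UU.kh_algebra_ctensor cmp(1) Ll])
  interpret R: linear_map UU U ?R by (rule linear_mapI[OF UU.kh_algebra_ctensor cmp(1) Rl])
  have eone: "(\<lambda>x. \<epsilon> x \<odot>\<^bsub>U\<^esub> \<one>\<^bsub>U\<^esub>) \<in> linear_maps U U"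
    by (rule linear_mapsI) (simp_all add: U.smult_l U.smult_smult)
  have esm: "(\<lambda>t. c \<odot>\<^bsub>U\<^esub> h t) \<in> linear_maps UU U" if "h \<in> linear_maps UU U" for h c
    by (rule linear_mapsI) (simp_all add: linear_maps_simps[OF that] U.smult_r U.smult_smult mult.commute)
  have Ltw: "?L (s \<otimes>\<^bsub>UU\<^esub> tens c e) = S c \<otimes>\<^bsub>U\<^esub> ?L s \<otimes>\<^bsub>U\<^esub> e"
    if ce: "c \<in> carrier U" "e \<in> carrier U" and s: "s \<in> carrier UU" for s c e
    by (rule UU.linear_maps_ctensor_eqI[OF cmp(1) sep linear_maps_comp[OF UU.CT.linear_mult_left Ll]
          linear_maps_comp[OF linear_maps_comp[OF Ll U.linear_mult_right] U.linear_mult_left] _ s])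
      (use ce in \<open>simp_all add: el S_mult U.m_assoc\<close>)
  have Rtw: "?R (tens c e \<otimes>\<^bsub>UU\<^esub> s) = c \<otimes>\<^bsub>U\<^esub> ?R s \<otimes>\<^bsub>U\<^esub> S e"
    if ce: "c \<in> carrier U" "e \<in> carrier U" and s: "s \<in> carrier UU" for s c e
    by (rule UU.linear_maps_ctensor_eqI[OF cmp(1) sep linear_maps_comp[OF UU.CT.linear_mult_right Rl]
          linear_maps_comp[OF linear_maps_comp[OF Rl U.linear_mult_right] U.linear_mult_left] _ s])
      (use ce in \<open>simp_all add: el S_mult U.m_assoc\<close>)
  \<comment> \<open>Take t = c \<otimes> e: by \<open>Ltw\<close> the value is S c m((S \<otimes>
    id) \<Delta> y) e, and the middle factor is the scalar \<epsilon> y. General t follows by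
    density.\<close>
  have Lgood: "?L (\<Delta> y \<otimes>\<^bsub>UU\<^esub> t) = \<epsilon> y \<odot>\<^bsub>U\<^esub> ?L t"
    if y: "y \<in> carrier U" "?L (\<Delta> y) = \<epsilon> y \<odot>\<^bsub>U\<^esub> \<one>\<^bsub>U\<^esub>" and t: "t \<in> carrier UU" for y t
    by (rule UU.linear_maps_ctensor_eqI[OF cmp(1) sep linear_maps_comp[OF UU.CT.linear_mult_right Ll] esm[OF Ll] _ t])
      (use y in \<open>simp_all add: Ltw el U.smult_mult_left U.smult_mult_right\<close>)
  \<comment> \<open>The sides are exchanged, since S reverses products in the second leg. In the
    induction on words \<open>Lgood\<close> is applied with \<open>y\<close> the new generator,
    \<open>Rgood\<close> with \<open>y\<close> the remaining word.\<close>
  have Rgood: "?R (t \<otimes>\<^bsub>UU\<^esub> \<Delta> y) = \<epsilon> y \<odot>\<^bsub>U\<^esub> ?R t"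
    if y: "y \<in> carrier U" "?R (\<Delta> y) = \<epsilon> y \<odot>\<^bsub>U\<^esub> \<one>\<^bsub>U\<^esub>" and t: "t \<in> carrier UU" for y t
    by (rule UU.linear_maps_ctensor_eqI[OF cmp(1) sep linear_maps_comp[OF UU.CT.linear_mult_left Rl] esm[OF Rl] _ t])
      (use y in \<open>simp_all add: Rtw el U.smult_mult_left U.smult_mult_right\<close>)
  have one: "?L (\<Delta> \<one>\<^bsub>U\<^esub>) = \<epsilon> \<one>\<^bsub>U\<^esub> \<odot>\<^bsub>U\<^esub> \<one>\<^bsub>U\<^esub>" "?R (\<Delta> \<one>\<^bsub>U\<^esub>) = \<epsilon> \<one>\<^bsub>U\<^esub> \<odot>\<^bsub>U\<^esub> \<one>\<^bsub>U\<^esub>"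
    by (simp_all add: el flip: UU.ctensor_elem_one)
  have K: "UR.K i \<otimes>\<^bsub>U\<^esub> UR.K' i = \<one>\<^bsub>U\<^esub>" "UR.K' i \<otimes>\<^bsub>U\<^esub> UR.K i = \<one>\<^bsub>U\<^esub>"
    and LL': "UR.L i \<otimes>\<^bsub>U\<^esub> UR.L' i = \<one>\<^bsub>U\<^esub>" "UR.L' i \<otimes>\<^bsub>U\<^esub> UR.L i = \<one>\<^bsub>U\<^esub>" for i
    using U.hexp_neg[of "gT (Tplus R i)"] U.hexp_neg[of "gT (Tminus R i)"] by simp_all
  have KE: "UR.K i \<otimes>\<^bsub>U\<^esub> (UR.K' i \<otimes>\<^bsub>U\<^esub> y) = y" if "y \<in> carrier U" for i y
    using that by (simp add: K flip: U.m_assoc)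
  have good: "?L (\<Delta> (gen y)) = \<epsilon> (gen y) \<odot>\<^bsub>U\<^esub> \<one>\<^bsub>U\<^esub> \<and> ?R (\<Delta> (gen y)) = \<epsilon> (gen y) \<odot>\<^bsub>U\<^esub> \<one>\<^bsub>U\<^esub>"
    if y: "y \<in> gens" for y
    using that
    by (elim UnE imageE; hypsubst)
      (simp_all add: \<Delta>_T \<Delta>_E \<Delta>_F \<epsilon>_T \<epsilon>_E \<epsilon>_F S_T S_E S_F S_K S_L el U.l_neg U.r_neg U.l_minus U.r_minus
        U.m_assoc K LL' KE)
  show "?L (\<Delta> x) = \<epsilon> x \<odot>\<^bsub>U\<^esub> \<one>\<^bsub>U\<^esub>"
    by (rule U_eqI[OF cmp(1) sep linear_maps_comp[OF \<Delta>.linear Ll] eone one(1) _ x])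
      (simp add: Lgood good U.smult_smult)
  show "?R (\<Delta> x) = \<epsilon> x \<odot>\<^bsub>U\<^esub> \<one>\<^bsub>U\<^esub>"
    by (rule U_eqI[OF cmp(1) sep linear_maps_comp[OF \<Delta>.linear Rl] eone one(2) _ x])
      (simp add: Rgood good U.smult_smult mult.commute)
qed

lemma topological_hopf_algebra: "topological_hopf_algebra U \<Delta> \<epsilon> S"
  by (intro topological_hopf_algebra.intro topological_hopf_algebra_axioms.intro U.kh_algebra_axioms
      U.complete \<Delta> \<epsilon> S_linear coassoc counit antipode_left antipode_right)

end

theorem theorem4p3p2:
  fixes A :: "int ^ 'n::finite ^ 'n"
    and d :: "'n \<Rightarrow> nat"
    and P :: "('k::field_char_0 fps) ^ 'n ^ 'n"
    and R :: "('k, 'n, 'h) triple"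
  assumes "generalized_cartan_matrix A"
    and "symmetrizer d A"
    and "cartan_type P d A"
    and "realization P R"
  shows "let U = fompquea A d P R;
             T = (\<lambda>x. fompquea_gen A d P R (GenT x));
             E = (\<lambda>i. fompquea_gen A d P R (GenE i));
             F = (\<lambda>i. fompquea_gen A d P R (GenF i));
             tens = ctensor_elem U U
         in \<exists>\<Delta> \<epsilon> S. topological_hopf_algebra U \<Delta> \<epsilon> S \<and>
              (\<forall>i. \<Delta> (E i) = tens (E i) \<one>\<^bsub>U\<^esub> \<oplus>\<^bsub>ctensor U U\<^esub> tens (hexp U (T (Tplus R i))) (E i)) \<and>
              (\<forall>x\<in>carrier (cartan R). \<Delta> (T x) = tens (T x) \<one>\<^bsub>U\<^esub> \<oplus>\<^bsub>ctensor U U\<^esub> tens \<one>\<^bsub>U\<^esub> (T x)) \<and>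
              (\<forall>i. \<Delta> (F i) = tens (F i) (hexp U (\<ominus>\<^bsub>U\<^esub> T (Tminus R i))) \<oplus>\<^bsub>ctensor U U\<^esub> tens \<one>\<^bsub>U\<^esub> (F i)) \<and>
              (\<forall>i. \<epsilon> (E i) = 0) \<and>
              (\<forall>x\<in>carrier (cartan R). \<epsilon> (T x) = 0) \<and>
              (\<forall>i. \<epsilon> (F i) = 0) \<and>
              (\<forall>i. S (E i) = \<ominus>\<^bsub>U\<^esub> (hexp U (\<ominus>\<^bsub>U\<^esub> T (Tplus R i)) \<otimes>\<^bsub>U\<^esub> E i)) \<and>
              (\<forall>x\<in>carrier (cartan R). S (T x) = \<ominus>\<^bsub>U\<^esub> T x) \<and>
              (\<forall>i. S (F i) = \<ominus>\<^bsub>U\<^esub> (F i \<otimes>\<^bsub>U\<^esub> hexp U (T (Tminus R i))))"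
proof -
  interpret fomp A d P R by (rule fomp.intro[OF assms])
  obtain \<Delta> where \<Delta>: "\<Delta> \<in> alg_homs U UU"
    "\<forall>x\<in>H. \<Delta> (gT x) = tens (gT x) \<one>\<^bsub>U\<^esub> \<oplus>\<^bsub>UU\<^esub> tens \<one>\<^bsub>U\<^esub> (gT x)"
    "\<forall>i. \<Delta> (gE i) = tens (gE i) \<one>\<^bsub>U\<^esub> \<oplus>\<^bsub>UU\<^esub> tens (UR.K i) (gE i)"
    "\<forall>i. \<Delta> (gF i) = tens (gF i) (UR.L i) \<oplus>\<^bsub>UU\<^esub> tens \<one>\<^bsub>U\<^esub> (gF i)"
    using comult_exists by blast
  obtain \<epsilon> where \<epsilon>: "\<epsilon> \<in> alg_homs U kh" "\<forall>x\<in>H. \<epsilon> (gT x) = 0" "\<forall>i. \<epsilon> (gE i) = 0" "\<forall>i. \<epsilon> (gF i) = 0"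
    using counit_exists by blast
  obtain S where S: "S \<in> alg_homs U (op_alg U)" "\<forall>x\<in>H. S (gT x) = \<ominus>\<^bsub>U\<^esub> gT x"
    "\<forall>i. S (gE i) = \<ominus>\<^bsub>U\<^esub> (UR.K' i \<otimes>\<^bsub>U\<^esub> gE i)" "\<forall>i. S (gF i) = \<ominus>\<^bsub>U\<^esub> (gF i \<otimes>\<^bsub>U\<^esub> UR.L' i)"
    using antipode_exists by blast
  have "fomp_hopf A d P R \<Delta> \<epsilon> S"
    by (intro fomp_hopf.intro fomp_hopf_axioms.intro fomp_axioms) (use \<Delta> \<epsilon> S in blast)+
  from fomp_hopf.topological_hopf_algebra[OF this] show ?thesis
    unfolding Let_def using \<Delta> \<epsilon> S by (intro exI[of _ \<Delta>] exI[of _ \<epsilon>] exI[of _ S]) simp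
qed

end
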